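(* Let $\Bbbk$ be a perfect field, and let $A$ and $B$ be $\mathbb{Z}_{\ge0}$-graded Noetherian rings with $A_0=B_0=\Bbbk$. Let $R:=A\times_{\Bbbk}B$ be their fiber product over $\Bbbk$. Assume that $A$ and $B$ are reduced and equidimensional, and that $\dim A,\dim B>0$. Then the following are equivalent: (1) $R$ is nearly regular; (2) both $A$ and $B$ are nearly regular and $\dim A=\dim B$.
   Context: Let $\varepsilon_A:A\to A/A_{>0}\cong\Bbbk$ and $\varepsilon_B:B\to B/B_{>0}\cong\Bbbk$ be the canonical surjections; then $R=A\times_\Bbbk B=\{(a,b)\in A\times B\mid\varepsilon_A(a)=\varepsilon_B(b)\}$, graded with $R_0=\Bbbk$. For a Noetherian $\mathbb{Z}_{\ge0}$-graded ring $S$ with $S_0=\Bbbk$, let $\mathfrak m_S=\bigoplus_{i>0}S_i$; for an $S$-module $M$, $\operatorname{tr}_S(M)=\sum_{f\in\operatorname{Hom}_S(M,S)}f(M)$; $\Omega^i_{S/\Bbbk}=\bigwedge^i_S\Omega^1_{S/\Bbbk}$ (Kähler differentials). $S$ is called nearly regular if $\operatorname{tr}_S(\Omega^{\dim S}_{S/\Bbbk})\supseteq\mathfrak m_S$. Equidimensional means $\dim S/\mathfrak q=\dim S$ for every minimal prime $\mathfrak q$. *)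

theory Defs
  imports "HOL-Algebra.Algebra" "HOL-Library.Extended_Nat"
begin

section \<open>Commutative rings\<close>

text \<open>Characteristic zero, or prime characteristic \<open>p\<close> with surjective Frobenius map.\<close>

definition perfect_field :: "('k, 'm) ring_scheme \<Rightarrow> bool" where
  "perfect_field K \<longleftrightarrow> field K \<and>
     (\<forall>p::nat. Factorial_Ring.prime p \<and> [p] \<cdot>\<^bsub>K\<^esub> \<one>\<^bsub>K\<^esub> = \<zero>\<^bsub>K\<^esub> \<longrightarrow>
        (\<forall>x \<in> carrier K. \<exists>y \<in> carrier K. y [^]\<^bsub>K\<^esub> p = x))"

definition reduced_ring :: "('a, 'm) ring_scheme \<Rightarrow> bool" where
  "reduced_ring S \<longleftrightarrow> (\<forall>x \<in> carrier S. \<forall>n::nat. x [^]\<^bsub>S\<^esub> n = \<zero>\<^bsub>S\<^esub> \<longrightarrow> x = \<zero>\<^bsub>S\<^esub>)"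

text \<open>The supremum of the lengths of strictly increasing chains of prime ideals; the value at
  the zero ring is the junk value \<open>0\<close>.\<close>

definition krull_dim :: "('a, 'm) ring_scheme \<Rightarrow> enat" where
  "krull_dim S =
     (SUP n \<in> {n. \<exists>P. (\<forall>i\<le>n. primeideal (P i) S) \<and> (\<forall>i<n. P i \<subset> P (Suc i))}. enat n)"

definition minimal_prime :: "('a, 'm) ring_scheme \<Rightarrow> 'a set \<Rightarrow> bool" where
  "minimal_prime S q \<longleftrightarrow> primeideal q S \<and> (\<forall>p. primeideal p S \<and> p \<subseteq> q \<longrightarrow> p = q)"

definition equidimensional :: "('a, 'm) ring_scheme \<Rightarrow> bool" where
  "equidimensional S \<longleftrightarrow> (\<forall>q. minimal_prime S q \<longrightarrow> krull_dim (S Quot q) = krull_dim S)"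


section \<open>Modules\<close>

text \<open>The module record extends the ring record, but the module axioms do not involve the fields
  \<open>mult\<close> and \<open>one\<close>; they are left unspecified in the modules constructed here.\<close>

definition regular_module :: "('a, 'm) ring_scheme \<Rightarrow> ('a, 'a) module" where
  "regular_module S =
     \<lparr>carrier = carrier S, monoid.mult = undefined, one = undefined,
      ring.zero = \<zero>\<^bsub>S\<^esub>, ring.add = ring.add S, smult = monoid.mult S\<rparr>"

definition module_hom ::
  "('a, 'm) ring_scheme \<Rightarrow> ('a, 'b, 'p) module_scheme \<Rightarrow> ('a, 'c, 'q) module_scheme \<Rightarrow> ('b \<Rightarrow> 'c) set" where
  "module_hom S M N =
     {f \<in> carrier M \<rightarrow> carrier N.
        (\<forall>x \<in> carrier M. \<forall>y \<in> carrier M. f (x \<oplus>\<^bsub>M\<^esub> y) = f x \<oplus>\<^bsub>N\<^esub> f y) \<and>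
        (\<forall>r \<in> carrier S. \<forall>x \<in> carrier M. f (r \<odot>\<^bsub>M\<^esub> x) = r \<odot>\<^bsub>N\<^esub> f x)}"

definition trace_ideal :: "('a, 'm) ring_scheme \<Rightarrow> ('a, 'b, 'p) module_scheme \<Rightarrow> 'a set" where
  "trace_ideal S M =
     {finsum S (\<lambda>i. f i (x i)) {..<n} | (n::nat) f x.
        \<forall>i<n. f i \<in> module_hom S M (regular_module S) \<and> x i \<in> carrier M}"

definition submodule_span ::
  "('a, 'm) ring_scheme \<Rightarrow> ('a, 'b, 'p) module_scheme \<Rightarrow> 'b set \<Rightarrow> 'b set" where
  "submodule_span S M Y = \<Inter>{N. submodule N S M \<and> Y \<subseteq> N}"

definition quot_module ::
  "('a, 'm) ring_scheme \<Rightarrow> ('a, 'b, 'p) module_scheme \<Rightarrow> 'b set \<Rightarrow> ('a, 'b set) module" where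
  "quot_module S M N =
     \<lparr>carrier = a_rcosets\<^bsub>M\<^esub> N, monoid.mult = undefined, one = undefined,
      ring.zero = N, ring.add = set_add M,
      smult = (\<lambda>r C. \<Union>x \<in> C. N +>\<^bsub>M\<^esub> (r \<odot>\<^bsub>M\<^esub> x))\<rparr>"

text \<open>The free module on the set \<open>Y\<close>: finitely supported functions, extended by zero outside \<open>Y\<close>.\<close>

definition free_module :: "('a, 'm) ring_scheme \<Rightarrow> 'x set \<Rightarrow> ('a, 'x \<Rightarrow> 'a) module" where
  "free_module S Y =
     \<lparr>carrier = {f. (\<forall>x. f x \<in> carrier S) \<and> (\<forall>x. x \<notin> Y \<longrightarrow> f x = \<zero>\<^bsub>S\<^esub>) \<and> finite {x. f x \<noteq> \<zero>\<^bsub>S\<^esub>}},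
      monoid.mult = undefined, one = undefined,
      ring.zero = (\<lambda>x. \<zero>\<^bsub>S\<^esub>), ring.add = (\<lambda>f g x. f x \<oplus>\<^bsub>S\<^esub> g x),
      smult = (\<lambda>r f x. r \<otimes>\<^bsub>S\<^esub> f x)\<rparr>"

definition free_gen :: "('a, 'm) ring_scheme \<Rightarrow> 'x \<Rightarrow> 'x \<Rightarrow> 'a" where
  "free_gen S x = (\<lambda>y. if y = x then \<one>\<^bsub>S\<^esub> else \<zero>\<^bsub>S\<^esub>)"

text \<open>The \<open>n\<close>-th exterior power of \<open>M\<close>, presented by generators
  \<open>x\<^sub>1 \<and> \<dots> \<and> x\<^sub>n\<close> (lists of length \<open>n\<close>) and the relations of multilinearity and alternation.\<close>

definition ext_power ::
  "('a, 'm) ring_scheme \<Rightarrow> nat \<Rightarrow> ('a, 'b, 'p) module_scheme \<Rightarrow> ('a, ('b list \<Rightarrow> 'a) set) module" where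
  "ext_power S n M =
    (let Y = {xs. length xs = n \<and> set xs \<subseteq> carrier M};
         F = free_module S Y;
         w = free_gen S
     in quot_module S F (submodule_span S F
      ({w (xs[i := u \<oplus>\<^bsub>M\<^esub> v]) \<ominus>\<^bsub>F\<^esub> (w (xs[i := u]) \<oplus>\<^bsub>F\<^esub> w (xs[i := v])) | xs i u v.
          xs \<in> Y \<and> i < n \<and> u \<in> carrier M \<and> v \<in> carrier M}
       \<union> {w (xs[i := r \<odot>\<^bsub>M\<^esub> u]) \<ominus>\<^bsub>F\<^esub> (r \<odot>\<^bsub>F\<^esub> w (xs[i := u])) | xs i r u.
          xs \<in> Y \<and> i < n \<and> r \<in> carrier S \<and> u \<in> carrier M}
       \<union> {w xs | xs. xs \<in> Y \<and> (\<exists>i j. i < j \<and> j < n \<and> xs ! i = xs ! j)})))"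

text \<open>The module of Kaehler differentials of \<open>S\<close> over \<open>K\<close>, where \<open>\<iota>\<close> is the structure map
  \<open>K \<rightarrow> S\<close>: generators \<open>d x\<close> for \<open>x \<in> S\<close>, subject to additivity, the Leibniz rule and the
  vanishing of \<open>d\<close> on the image of \<open>K\<close>.\<close>

definition kaehler ::
  "('k, 'm) ring_scheme \<Rightarrow> ('a, 'n) ring_scheme \<Rightarrow> ('k \<Rightarrow> 'a) \<Rightarrow> ('a, ('a \<Rightarrow> 'a) set) module" where
  "kaehler K S \<iota> =
    (let F = free_module S (carrier S);
         d = free_gen S
     in quot_module S F (submodule_span S F
      ({d (x \<oplus>\<^bsub>S\<^esub> y) \<ominus>\<^bsub>F\<^esub> (d x \<oplus>\<^bsub>F\<^esub> d y) | x y. x \<in> carrier S \<and> y \<in> carrier S}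
       \<union> {d (x \<otimes>\<^bsub>S\<^esub> y) \<ominus>\<^bsub>F\<^esub> (x \<odot>\<^bsub>F\<^esub> d y \<oplus>\<^bsub>F\<^esub> y \<odot>\<^bsub>F\<^esub> d x) | x y. x \<in> carrier S \<and> y \<in> carrier S}
       \<union> {d (\<iota> c) | c. c \<in> carrier K})))"


section \<open>Graded rings with degree zero part a field\<close>

text \<open>A commutative ring \<open>S = \<Oplus>\<^sub>n S\<^sub>n\<close> (with \<open>S\<^sub>n\<close> written \<open>gr n\<close>) together with an
  identification \<open>\<iota>\<close> of the field \<open>K\<close> with \<open>S\<^sub>0\<close>.\<close>

locale connected_graded_ring = field K + S: cring S
  for K :: "('k, 'm) ring_scheme" and S :: "('a, 'n) ring_scheme"
    and \<iota> :: "'k \<Rightarrow> 'a" and gr :: "nat \<Rightarrow> 'a set" +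
  assumes incl_hom: "\<iota> \<in> ring_hom K S"
    and incl_inj: "inj_on \<iota> (carrier K)"
    and incl_image: "\<iota> ` carrier K = gr 0"
    and gr_subgroup: "additive_subgroup (gr n) S"
    and gr_mult: "x \<in> gr m \<Longrightarrow> y \<in> gr n \<Longrightarrow> x \<otimes>\<^bsub>S\<^esub> y \<in> gr (m + n)"
    and gr_direct_sum: "x \<in> carrier S \<Longrightarrow>
      \<exists>!c. (\<forall>n. c n \<in> gr n) \<and> finite {n. c n \<noteq> \<zero>\<^bsub>S\<^esub>} \<and> x = finsum S c {n. c n \<noteq> \<zero>\<^bsub>S\<^esub>}"

text \<open>The ideal \<open>S\<^bsub>>0\<^esub> = \<Oplus>\<^bsub>i>0\<^esub> S\<^sub>i\<close>.\<close>

definition irrelevant_ideal :: "('a, 'n) ring_scheme \<Rightarrow> (nat \<Rightarrow> 'a set) \<Rightarrow> 'a set" where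
  "irrelevant_ideal S gr = {finsum S c {1..n} | c n. \<forall>i \<in> {1..n}. c i \<in> gr i}"

text \<open>The canonical surjection \<open>S \<rightarrow> S / S\<^bsub>>0\<^esub> \<cong> K\<close>, where \<open>S / S\<^bsub>>0\<^esub>\<close> is identified with \<open>K\<close>
  through \<open>\<iota>\<close>.\<close>

definition augmentation ::
  "('k, 'm) ring_scheme \<Rightarrow> ('a, 'n) ring_scheme \<Rightarrow> ('k \<Rightarrow> 'a) \<Rightarrow> (nat \<Rightarrow> 'a set) \<Rightarrow> 'a \<Rightarrow> 'k" where
  "augmentation K S \<iota> gr x =
     (THE c. c \<in> carrier K \<and>
        irrelevant_ideal S gr +>\<^bsub>S\<^esub> x = irrelevant_ideal S gr +>\<^bsub>S\<^esub> \<iota> c)"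

text \<open>The Krull dimension of \<open>S\<close>, finite for the rings of interest, is named by \<open>d\<close> to serve as
  the exponent of the exterior power.\<close>

definition nearly_regular ::
  "('k, 'm) ring_scheme \<Rightarrow> ('a, 'n) ring_scheme \<Rightarrow> ('k \<Rightarrow> 'a) \<Rightarrow> (nat \<Rightarrow> 'a set) \<Rightarrow> bool" where
  "nearly_regular K S \<iota> gr \<longleftrightarrow>
     (\<exists>d. krull_dim S = enat d \<and>
        irrelevant_ideal S gr \<subseteq> trace_ideal S (ext_power S d (kaehler K S \<iota>)))"


section \<open>Fiber products over the residue field\<close>

definition fiber_product ::
  "('k, 'm) ring_scheme \<Rightarrow>
   ('a, 'n) ring_scheme \<Rightarrow> ('k \<Rightarrow> 'a) \<Rightarrow> (nat \<Rightarrow> 'a set) \<Rightarrow>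
   ('b, 'p) ring_scheme \<Rightarrow> ('k \<Rightarrow> 'b) \<Rightarrow> (nat \<Rightarrow> 'b set) \<Rightarrow> ('a \<times> 'b) ring" where
  "fiber_product K A \<iota>A grA B \<iota>B grB =
     (RDirProd A B)\<lparr>carrier := {(a, b). a \<in> carrier A \<and> b \<in> carrier B \<and>
        augmentation K A \<iota>A grA a = augmentation K B \<iota>B grB b}\<rparr>"

definition fiber_incl :: "('k \<Rightarrow> 'a) \<Rightarrow> ('k \<Rightarrow> 'b) \<Rightarrow> 'k \<Rightarrow> 'a \<times> 'b" where
  "fiber_incl \<iota>A \<iota>B c = (\<iota>A c, \<iota>B c)"

text \<open>In positive degree \<open>n\<close> the condition of lying in the fiber product is automatic, so that
  this is \<open>A\<^sub>n \<times> B\<^sub>n\<close>; in degree zero it is the diagonal copy of \<open>K\<close>.\<close>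

definition fiber_grading ::
  "('k, 'm) ring_scheme \<Rightarrow>
   ('a, 'n) ring_scheme \<Rightarrow> ('k \<Rightarrow> 'a) \<Rightarrow> (nat \<Rightarrow> 'a set) \<Rightarrow>
   ('b, 'p) ring_scheme \<Rightarrow> ('k \<Rightarrow> 'b) \<Rightarrow> (nat \<Rightarrow> 'b set) \<Rightarrow> nat \<Rightarrow> ('a \<times> 'b) set" where
  "fiber_grading K A \<iota>A grA B \<iota>B grB n =
     carrier (fiber_product K A \<iota>A grA B \<iota>B grB) \<inter> (grA n \<times> grB n)"

end

(* Homomorphisms from the d-th exterior power of the differentials of S to S are the alternating
   K-derivations D in d arguments from S to S, so the trace ideal is the ideal T(S, d) generated by
   their values.

   Put m = A_+ and d = dim R = max (dim A, dim B). The ring R retracts onto A by the projection pi,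
   with section sigma, and m x 0 is an ideal of R killed by the kernel of pi. A derivation of A with
   values in m is therefore also one of R, and this suffices for m to lie in T(R, d) whenever it lies
   in T(A, d): either every derivation takes values in m, or T(A, d) = A, and one can multiply by the
   elements of m. Conversely, a derivation D of R induces pi D(sigma ...) on A; since A is reduced of
   positive dimension, no nonzero element of A is killed by m, so pi D vanishes on the kernel of pi
   and no value is lost.

   It remains to see that T(A, d) = 0 if d > dim A. Noetherian induction on homogeneous ideals bounds
   the growth of A by a polynomial of degree dim A, so any d elements a_1, ..., a_d satisfy a
   polynomial relation over K. If u = D(a_1, ..., a_d), applying D with a_i replaced by a relation P
   of minimal degree with u P(a) = 0 shows that all partial derivatives of P vanish, so P is a p-th
   power because K is perfect, and P is not minimal unless u = 0. *)

theory Submission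
  imports Defs
begin

section \<open>Free modules and quotient modules\<close>

text \<open>The exterior powers over A and over R are quotients of free modules over different
  rings, and comparing their traces directly would need module maps between them. A function on
  lists of ring elements, by contrast, is carried from one ring to the other by composition with pi
  and sigma; this is why everything is restated for derivations. The Leibniz rule survives on R only
  where r sigma(v) = sigma(pi(r) v), and this fails already for v = 1; hence the distinction whether
  T(A, d) is m or A.

  A need not be a domain, so differentiating P(a) = 0 yields only u P_i(a) = 0. A factor u carried
  along in every relation keeps the induction closed, and reducedness removes surplus powers of u.

  The relation itself comes from counting: the (s+1)^d monomials with exponents at most s have
  degree O(s), and in these degrees there are at most O(s^r) independent elements, where r = dim A <
  d. An upper bound for the growth suffices, which avoids Noether normalization.

  The vanishing of T(A, d) above dim A is what forces dim A = dim B, because m is nonzero in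
  positive dimension.\<close>

context module
begin

lemma submodule_abelian_subgroup:
  assumes "submodule N R M" shows "abelian_subgroup N M"
  using assms by (intro abelian_subgroupI3 additive_subgroup.intro) (auto simp: submodule_def M.abelian_group_axioms)

lemma quot_carrier_iff:
  "C \<in> carrier (quot_module R M N) \<longleftrightarrow> (\<exists>x\<in>carrier M. C = N +>\<^bsub>M\<^esub> x)"
  by (auto simp: quot_module_def A_RCOSETS_def')

lemma quot_eq_iff:
  assumes N: "submodule N R M" and x: "x \<in> carrier M" and y: "y \<in> carrier M"
  shows "N +>\<^bsub>M\<^esub> x = N +>\<^bsub>M\<^esub> y \<longleftrightarrow> x \<ominus>\<^bsub>M\<^esub> y \<in> N"
proof -
  interpret N: abelian_subgroup N M by (rule submodule_abelian_subgroup[OF N])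
  have "N +>\<^bsub>M\<^esub> x = N +>\<^bsub>M\<^esub> y \<longleftrightarrow> x \<in> N +>\<^bsub>M\<^esub> y"
    using N.a_repr_independence'[OF _ y, of x] N.a_rcos_self[OF x] by auto
  also have "\<dots> \<longleftrightarrow> x \<ominus>\<^bsub>M\<^esub> y \<in> N"
    using N.a_rcos_module[OF y x] by (simp add: a_minus_def)
  finally show ?thesis .
qed

lemma quot_add:
  assumes "submodule N R M" and "x \<in> carrier M" and "y \<in> carrier M"
  shows "(N +>\<^bsub>M\<^esub> x) \<oplus>\<^bsub>quot_module R M N\<^esub> (N +>\<^bsub>M\<^esub> y) = N +>\<^bsub>M\<^esub> (x \<oplus>\<^bsub>M\<^esub> y)"
  using abelian_subgroup.a_rcos_sum[OF submodule_abelian_subgroup] assms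
  by (simp add: quot_module_def)

text \<open>The quotient multiplies by a scalar through a union over all representatives of the
  coset. As \<open>N\<close> is stable under scalars, all members of this union are the same coset,
  so the union collapses to it.\<close>

lemma quot_smult:
  assumes N: "submodule N R M" and r: "r \<in> carrier R" and x: "x \<in> carrier M"
  shows "r \<odot>\<^bsub>quot_module R M N\<^esub> (N +>\<^bsub>M\<^esub> x) = N +>\<^bsub>M\<^esub> (r \<odot>\<^bsub>M\<^esub> x)"
proof -
  interpret N: abelian_subgroup N M by (rule submodule_abelian_subgroup[OF N])
  have "N +>\<^bsub>M\<^esub> (r \<odot>\<^bsub>M\<^esub> y) = N +>\<^bsub>M\<^esub> (r \<odot>\<^bsub>M\<^esub> x)" if y: "y \<in> N +>\<^bsub>M\<^esub> x" for y
  proof -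
    obtain h where h: "h \<in> N" "y = h \<oplus>\<^bsub>M\<^esub> x" using y by (auto simp: a_r_coset_def')
    have hM: "h \<in> carrier M" using h(1) N.a_subset by auto
    have rh: "r \<odot>\<^bsub>M\<^esub> h \<in> N" using submoduleE(4)[OF N] r h by auto
    have "r \<odot>\<^bsub>M\<^esub> y \<ominus>\<^bsub>M\<^esub> r \<odot>\<^bsub>M\<^esub> x = r \<odot>\<^bsub>M\<^esub> h"
      using h hM r x by (simp add: smult_r_distr a_minus_def M.a_assoc M.r_neg)
    then show ?thesis using quot_eq_iff[OF N, of "r \<odot>\<^bsub>M\<^esub> y" "r \<odot>\<^bsub>M\<^esub> x"] rh r x h hM by simp
  qed
  moreover have "x \<in> N +>\<^bsub>M\<^esub> x" by (rule N.a_rcos_self[OF x])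
  ultimately have "(\<Union>y\<in>N +>\<^bsub>M\<^esub> x. N +>\<^bsub>M\<^esub> (r \<odot>\<^bsub>M\<^esub> y)) = N +>\<^bsub>M\<^esub> (r \<odot>\<^bsub>M\<^esub> x)"
    by blast
  then show ?thesis by (simp add: quot_module_def)
qed

text \<open>The universal property of the quotient. The induced map evaluates \<open>f\<close> at a
  chosen representative; another choice differs by an element of \<open>N\<close>, which
  \<open>f\<close> kills.\<close>

lemma quot_module_hom_ext:
  assumes "submodule N R M" "f \<in> module_hom R M T" "\<And>x. x \<in> N \<Longrightarrow> f x = \<zero>\<^bsub>T\<^esub>" "abelian_group T"
  obtains g where "g \<in> module_hom R (quot_module R M N) T" "\<And>x. x \<in> carrier M \<Longrightarrow> g (N +>\<^bsub>M\<^esub> x) = f x"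
proof -
  interpret T: abelian_group T by fact
  note N = assms(1)
  have fc: "f x \<in> carrier T" if "x \<in> carrier M" for x using assms(2) that by (auto simp: module_hom_def)
  have fadd: "f (x \<oplus>\<^bsub>M\<^esub> y) = f x \<oplus>\<^bsub>T\<^esub> f y" if "x \<in> carrier M" "y \<in> carrier M" for x y
    using assms(2) that by (auto simp: module_hom_def)
  have fsm: "f (r \<odot>\<^bsub>M\<^esub> x) = r \<odot>\<^bsub>T\<^esub> f x" if "r \<in> carrier R" "x \<in> carrier M" for r x
    using assms(2) that by (auto simp: module_hom_def)
  define g where "g C = f (SOME x. x \<in> carrier M \<and> C = N +>\<^bsub>M\<^esub> x)" for C
  have g: "g (N +>\<^bsub>M\<^esub> x) = f x" if x: "x \<in> carrier M" for x
  proof -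
    define y where "y = (SOME y. y \<in> carrier M \<and> N +>\<^bsub>M\<^esub> x = N +>\<^bsub>M\<^esub> y)"
    have y: "y \<in> carrier M \<and> N +>\<^bsub>M\<^esub> x = N +>\<^bsub>M\<^esub> y" unfolding y_def by (rule someI[of _ x]) (use x in simp)
    then have "x \<ominus>\<^bsub>M\<^esub> y \<in> N" using quot_eq_iff[OF N x, of y] by blast
    then have "f (x \<ominus>\<^bsub>M\<^esub> y) = \<zero>\<^bsub>T\<^esub>" using assms(3) by blast
    moreover have "(x \<ominus>\<^bsub>M\<^esub> y) \<oplus>\<^bsub>M\<^esub> y = x" using x y by (simp add: a_minus_def M.a_assoc M.l_neg)
    ultimately have "f x = f y" using fadd[of "x \<ominus>\<^bsub>M\<^esub> y" y] x y fc[of y] by simp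
    then show ?thesis by (simp add: g_def y_def)
  qed
  show ?thesis
  proof
    show "g \<in> module_hom R (quot_module R M N) T"
      unfolding module_hom_def
    proof (intro CollectI conjI ballI)
      show "g \<in> carrier (quot_module R M N) \<rightarrow> carrier T" using g fc by (auto simp: quot_carrier_iff)
    next
      fix C D assume "C \<in> carrier (quot_module R M N)" "D \<in> carrier (quot_module R M N)"
      then show "g (C \<oplus>\<^bsub>quot_module R M N\<^esub> D) = g C \<oplus>\<^bsub>T\<^esub> g D"
        by (auto simp: quot_carrier_iff quot_add[OF N] g fadd)
    next
      fix r C assume "r \<in> carrier R" "C \<in> carrier (quot_module R M N)"
      then show "g (r \<odot>\<^bsub>quot_module R M N\<^esub> C) = r \<odot>\<^bsub>T\<^esub> g C"
        by (auto simp: quot_carrier_iff quot_smult[OF N] g fsm)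
    qed
  qed (rule g)
qed

lemma submodule_span_props:
  assumes "Y \<subseteq> carrier M"
  shows "submodule (submodule_span R M Y) R M"
    and "Y \<subseteq> submodule_span R M Y"
    and "\<And>N. submodule N R M \<Longrightarrow> Y \<subseteq> N \<Longrightarrow> submodule_span R M Y \<subseteq> N"
proof -
  show "submodule (submodule_span R M Y) R M"
  proof (rule submoduleI)
    show "submodule_span R M Y \<subseteq> carrier M"
      using carrier_is_submodule assms unfolding submodule_span_def by auto
    show "\<zero>\<^bsub>M\<^esub> \<in> submodule_span R M Y"
      unfolding submodule_span_def using submodule.axioms(1) subgroup.one_closed by fastforce
  next
    fix a assume "a \<in> submodule_span R M Y"
    then show "\<ominus>\<^bsub>M\<^esub> a \<in> submodule_span R M Y"
      unfolding submodule_span_def using submoduleE(3) by auto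
  next
    fix a b assume "a \<in> submodule_span R M Y" "b \<in> submodule_span R M Y"
    then show "a \<oplus>\<^bsub>M\<^esub> b \<in> submodule_span R M Y"
      unfolding submodule_span_def using submoduleE(5) by auto
  next
    fix a x assume "a \<in> carrier R" "x \<in> submodule_span R M Y"
    then show "a \<odot>\<^bsub>M\<^esub> x \<in> submodule_span R M Y"
      unfolding submodule_span_def using submoduleE(4) by auto
  qed
qed (auto simp: submodule_span_def)

end

section \<open>Free modules and linear extension from generators\<close>

context cring
begin

abbreviation "FM \<equiv> free_module R"

lemma free_module_module: "module R (FM Y)"
proof (rule moduleI)
  have fin: "finite {x. f x \<oplus> g x \<noteq> \<zero>}" if "finite {x. f x \<noteq> \<zero>}" "finite {x. g x \<noteq> \<zero>}"
    for f g :: "'x \<Rightarrow> 'a"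
    by (rule finite_subset[OF _ finite_UnI[OF that]]) auto
  have fin2: "finite {x. r \<otimes> f x \<noteq> \<zero>}" if "finite {x. f x \<noteq> \<zero>}" "r \<in> carrier R" for r f
    by (rule finite_subset[OF _ that(1)]) (use that in auto)
  show "cring R" by (rule is_cring)
  show "abelian_group (FM Y)"
  proof (rule abelian_groupI)
    fix f assume f: "f \<in> carrier (FM Y)"
    show "\<exists>g\<in>carrier (FM Y). g \<oplus>\<^bsub>FM Y\<^esub> f = \<zero>\<^bsub>FM Y\<^esub>"
    proof
      show "(\<lambda>x. \<ominus> f x) \<in> carrier (FM Y)"
        using f by (auto simp: free_module_def elim: rev_finite_subset)
    qed (use f in \<open>auto simp: free_module_def l_neg\<close>)
  qed (auto simp: free_module_def a_ac fin)
  show "\<And>a x. a \<in> carrier R \<Longrightarrow> x \<in> carrier (FM Y) \<Longrightarrow> a \<odot>\<^bsub>FM Y\<^esub> x \<in> carrier (FM Y)"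
    by (auto simp: free_module_def fin2)
qed (auto simp: free_module_def l_distr r_distr m_assoc)

lemma free_module_simps:
  "\<zero>\<^bsub>FM Y\<^esub> = (\<lambda>x. \<zero>)" "f \<oplus>\<^bsub>FM Y\<^esub> g = (\<lambda>x. f x \<oplus> g x)" "r \<odot>\<^bsub>FM Y\<^esub> f = (\<lambda>x. r \<otimes> f x)"
  by (auto simp: free_module_def)

lemma free_module_carrierD:
  assumes "f \<in> carrier (FM Y)"
  shows "f x \<in> carrier R" "x \<notin> Y \<Longrightarrow> f x = \<zero>" "finite {x. f x \<noteq> \<zero>}" "{x. f x \<noteq> \<zero>} \<subseteq> Y"
  using assms by (auto simp: free_module_def)

lemma free_gen_closed: "y \<in> Y \<Longrightarrow> free_gen R y \<in> carrier (FM Y)"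
  by (auto simp: free_module_def free_gen_def)

text \<open>A finitely supported function is a finite combination of generators. The induction runs
  over a finite set containing the support and splits off the value at one point at a time.\<close>

lemma free_module_induct [consumes 1, case_names zero add smult gen]:
  assumes "f \<in> carrier (FM Y)"
    and zero: "P (\<zero>\<^bsub>FM Y\<^esub>)"
    and add: "\<And>f g. f \<in> carrier (FM Y) \<Longrightarrow> g \<in> carrier (FM Y) \<Longrightarrow> P f \<Longrightarrow> P g \<Longrightarrow> P (f \<oplus>\<^bsub>FM Y\<^esub> g)"
    and smult: "\<And>r f. r \<in> carrier R \<Longrightarrow> f \<in> carrier (FM Y) \<Longrightarrow> P f \<Longrightarrow> P (r \<odot>\<^bsub>FM Y\<^esub> f)"
    and gen: "\<And>y. y \<in> Y \<Longrightarrow> P (free_gen R y)"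
  shows "P f"
proof -
  interpret F: module R "FM Y" by (rule free_module_module)
  have "P f" if "finite T" "T \<subseteq> Y" "f \<in> carrier (FM Y)" "{x. f x \<noteq> \<zero>} \<subseteq> T" for T f
    using that
  proof (induction T arbitrary: f rule: finite_induct)
    case empty
    then have "f = \<zero>\<^bsub>FM Y\<^esub>" by (auto simp: free_module_simps)
    then show ?case using zero by simp
  next
    case (insert y T)
    note fc = free_module_carrierD[OF insert.prems(2)]
    let ?g = "f(y := \<zero>)"
    have "finite {x. ?g x \<noteq> \<zero>}" by (rule finite_subset[OF _ fc(3)]) auto
    then have g: "?g \<in> carrier (FM Y)"
      using fc(1,2) by (simp add: free_module_def)
    have "{x. ?g x \<noteq> \<zero>} \<subseteq> T" using insert.prems(3) by auto
    then have Pg: "P ?g" using insert.prems(1) by (intro insert.IH g) auto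
    have y: "y \<in> Y" using insert.prems by auto
    have Ph: "P (f y \<odot>\<^bsub>FM Y\<^esub> free_gen R y)" by (intro smult gen free_gen_closed fc y)
    have "f = ?g \<oplus>\<^bsub>FM Y\<^esub> (f y \<odot>\<^bsub>FM Y\<^esub> free_gen R y)"
      using fc by (auto simp: free_module_simps free_gen_def fun_eq_iff)
    moreover have "P (?g \<oplus>\<^bsub>FM Y\<^esub> (f y \<odot>\<^bsub>FM Y\<^esub> free_gen R y))"
      by (intro add g Pg Ph F.smult_closed free_gen_closed fc y)
    ultimately show ?case by simp
  qed
  then show ?thesis using assms(1) free_module_carrierD[OF assms(1)] by blast
qed

text \<open>The linear form on the free module that sends the generator \<open>y\<close> to
  \<open>g y\<close>. Summing over the support keeps the basis \<open>Y\<close> out of the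
  definition; the sum is finite for every element of the free module.\<close>

definition lin_ext :: "('x \<Rightarrow> 'a) \<Rightarrow> ('x \<Rightarrow> 'a) \<Rightarrow> 'a"
  where "lin_ext g f = (\<Oplus>y\<in>{y. f y \<noteq> \<zero>}. f y \<otimes> g y)"

text \<open>Linearity compares sums over the supports of several functions, and these differ. Over a
  common finite set containing them the sums can be combined term by term.\<close>

lemma lin_ext_superset:
  assumes "f \<in> carrier (FM Y)" "\<And>y. y \<in> Y \<Longrightarrow> g y \<in> carrier R"
    and "finite T" "{y. f y \<noteq> \<zero>} \<subseteq> T" "T \<subseteq> Y"
  shows "lin_ext g f = (\<Oplus>y\<in>T. f y \<otimes> g y)"
  unfolding lin_ext_def
  by (rule add.finprod_mono_neutral_cong_left) (use assms free_module_carrierD[OF assms(1)] in auto)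

lemma lin_ext_closed:
  assumes "f \<in> carrier (FM Y)" "\<And>y. y \<in> Y \<Longrightarrow> g y \<in> carrier R"
  shows "lin_ext g f \<in> carrier R"
  unfolding lin_ext_def
  by (rule finsum_closed) (use assms free_module_carrierD[OF assms(1)] in auto)

lemma lin_ext_add:
  assumes f: "f \<in> carrier (FM Y)" "f' \<in> carrier (FM Y)" and g: "\<And>y. y \<in> Y \<Longrightarrow> g y \<in> carrier R"
  shows "lin_ext g (f \<oplus>\<^bsub>FM Y\<^esub> f') = lin_ext g f \<oplus> lin_ext g f'"
proof -
  interpret F: module R "FM Y" by (rule free_module_module)
  let ?T = "{y. f y \<noteq> \<zero>} \<union> {y. f' y \<noteq> \<zero>}"
  note fc = free_module_carrierD[OF f(1)] and fc' = free_module_carrierD[OF f(2)]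
  have T: "finite ?T" "?T \<subseteq> Y" using fc fc' by auto
  have gc: "g y \<in> carrier R" if "y \<in> ?T" for y using that T g by auto
  have "lin_ext g (f \<oplus>\<^bsub>FM Y\<^esub> f') = (\<Oplus>y\<in>?T. (f \<oplus>\<^bsub>FM Y\<^esub> f') y \<otimes> g y)"
    by (rule lin_ext_superset[OF F.add.m_closed[simplified, OF f] g])
       (use T in \<open>auto simp: free_module_simps\<close>)
  also have "\<dots> = (\<Oplus>y\<in>?T. f y \<otimes> g y \<oplus> f' y \<otimes> g y)"
    by (rule finsum_cong') (use fc fc' gc in \<open>auto simp: free_module_simps l_distr\<close>)
  also have "\<dots> = (\<Oplus>y\<in>?T. f y \<otimes> g y) \<oplus> (\<Oplus>y\<in>?T. f' y \<otimes> g y)"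
    by (rule finsum_addf) (use fc fc' gc in auto)
  also have "\<dots> = lin_ext g f \<oplus> lin_ext g f'"
    using lin_ext_superset[OF f(1) g T(1) _ T(2)] lin_ext_superset[OF f(2) g T(1) _ T(2)] by simp
  finally show ?thesis .
qed

lemma lin_ext_smult:
  assumes f: "f \<in> carrier (FM Y)" and r: "r \<in> carrier R" and g: "\<And>y. y \<in> Y \<Longrightarrow> g y \<in> carrier R"
  shows "lin_ext g (r \<odot>\<^bsub>FM Y\<^esub> f) = r \<otimes> lin_ext g f"
proof -
  interpret F: module R "FM Y" by (rule free_module_module)
  note fc = free_module_carrierD[OF f(1)]
  let ?T = "{y. f y \<noteq> \<zero>}"
  have gc: "g y \<in> carrier R" if "y \<in> ?T" for y using that fc g by auto
  have "lin_ext g (r \<odot>\<^bsub>FM Y\<^esub> f) = (\<Oplus>y\<in>?T. (r \<odot>\<^bsub>FM Y\<^esub> f) y \<otimes> g y)"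
    by (rule lin_ext_superset[OF F.smult_closed[OF r f] g]) (use fc r in \<open>auto simp: free_module_simps\<close>)
  also have "\<dots> = (\<Oplus>y\<in>?T. r \<otimes> (f y \<otimes> g y))"
    by (rule finsum_cong') (use fc gc r in \<open>auto simp: free_module_simps m_assoc\<close>)
  also have "\<dots> = r \<otimes> (\<Oplus>y\<in>?T. f y \<otimes> g y)"
    by (rule finsum_rdistr[symmetric]) (use fc gc r in auto)
  finally show ?thesis by (simp add: lin_ext_def)
qed

lemma lin_ext_gen:
  assumes "y \<in> Y" and g: "\<And>y. y \<in> Y \<Longrightarrow> g y \<in> carrier R"
  shows "lin_ext g (free_gen R y) = g y"
proof -
  have "lin_ext g (free_gen R y) = (\<Oplus>z\<in>{y}. free_gen R y z \<otimes> g z)"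
    by (rule lin_ext_superset[OF free_gen_closed[OF assms(1)] g])
       (use assms in \<open>auto simp: free_gen_def\<close>)
  also have "\<dots> = free_gen R y y \<otimes> g y \<oplus> \<zero>"
    using assms by (subst finsum_insert) (auto simp: free_gen_def)
  finally show ?thesis using assms by (simp add: free_gen_def)
qed

lemma regular_module_abelian_group: "abelian_group (regular_module R)"
proof (rule abelian_groupI)
  fix x assume "x \<in> carrier (regular_module R)"
  then show "\<exists>y\<in>carrier (regular_module R). y \<oplus>\<^bsub>regular_module R\<^esub> x = \<zero>\<^bsub>regular_module R\<^esub>"
    by (intro bexI[of _ "\<ominus> x"]) (auto simp: regular_module_def l_neg)
qed (auto simp: regular_module_def a_ac)

lemma lin_ext_hom:
  assumes g: "\<And>y. y \<in> Y \<Longrightarrow> g y \<in> carrier R"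
  shows "lin_ext g \<in> module_hom R (FM Y) (regular_module R)"
  using lin_ext_closed[where Y = Y and g = g, OF _ g] lin_ext_add[where Y = Y and g = g, OF _ _ g]
    lin_ext_smult[where Y = Y and g = g, OF _ _ g]
  by (simp add: module_hom_def regular_module_def)

lemma lin_ext_cong:
  assumes "f \<in> carrier (FM Y)" "\<And>y. y \<in> Y \<Longrightarrow> g y \<in> carrier R" "\<And>y. y \<in> Y \<Longrightarrow> g y = g' y"
  shows "lin_ext g f = lin_ext g' f"
  unfolding lin_ext_def
  using free_module_carrierD[OF assms(1)] assms(2,3) by (intro finsum_cong') auto

lemma lin_ext_fun_add:
  assumes f: "f \<in> carrier (FM Y)" and g: "\<And>y. y \<in> Y \<Longrightarrow> g y \<in> carrier R" "\<And>y. y \<in> Y \<Longrightarrow> g' y \<in> carrier R"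
  shows "lin_ext (\<lambda>y. g y \<oplus> g' y) f = lin_ext g f \<oplus> lin_ext g' f"
proof -
  note fc = free_module_carrierD[OF f]
  have gc: "g y \<in> carrier R" "g' y \<in> carrier R" if "y \<in> {y. f y \<noteq> \<zero>}" for y using that fc g by auto
  have "lin_ext (\<lambda>y. g y \<oplus> g' y) f = (\<Oplus>y\<in>{y. f y \<noteq> \<zero>}. f y \<otimes> g y \<oplus> f y \<otimes> g' y)"
    unfolding lin_ext_def using fc gc by (intro finsum_cong') (auto simp: r_distr)
  also have "\<dots> = lin_ext g f \<oplus> lin_ext g' f"
    unfolding lin_ext_def by (rule finsum_addf) (use fc gc in auto)
  finally show ?thesis .
qed

lemma lin_ext_fun_smult:
  assumes f: "f \<in> carrier (FM Y)" and g: "\<And>y. y \<in> Y \<Longrightarrow> g y \<in> carrier R" and r: "r \<in> carrier R"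
  shows "lin_ext (\<lambda>y. r \<otimes> g y) f = r \<otimes> lin_ext g f"
proof -
  note fc = free_module_carrierD[OF f]
  have gc: "g y \<in> carrier R" if "y \<in> {y. f y \<noteq> \<zero>}" for y using that fc g by auto
  have "lin_ext (\<lambda>y. r \<otimes> g y) f = (\<Oplus>y\<in>{y. f y \<noteq> \<zero>}. r \<otimes> (f y \<otimes> g y))"
    unfolding lin_ext_def using fc gc r by (intro finsum_cong') (auto simp: m_lcomm)
  also have "\<dots> = r \<otimes> lin_ext g f"
    unfolding lin_ext_def by (rule finsum_rdistr[symmetric]) (use fc gc r in auto)
  finally show ?thesis .
qed

section \<open>Multilinear maps on free modules\<close>

text \<open>Induction for multilinear statements: a property that passes to sums and multiples in
  each slot holds for all lists once it holds for lists of generators. The slots are expanded from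
  the last to the first, so that behind the slot under treatment there are only generators.\<close>

lemma free_list_induct [consumes 3, case_names add smult gen]:
  assumes "Y \<noteq> {}" and "length fs = d" "set fs \<subseteq> carrier (FM Y)"
    and add: "\<And>gs i f g. length gs = d \<Longrightarrow> set gs \<subseteq> carrier (FM Y) \<Longrightarrow> i < d \<Longrightarrow>
      f \<in> carrier (FM Y) \<Longrightarrow> g \<in> carrier (FM Y) \<Longrightarrow> P (gs[i := f]) \<Longrightarrow> P (gs[i := g]) \<Longrightarrow> P (gs[i := f \<oplus>\<^bsub>FM Y\<^esub> g])"
    and smult: "\<And>gs i r f. length gs = d \<Longrightarrow> set gs \<subseteq> carrier (FM Y) \<Longrightarrow> i < d \<Longrightarrow>
      r \<in> carrier R \<Longrightarrow> f \<in> carrier (FM Y) \<Longrightarrow> P (gs[i := f]) \<Longrightarrow> P (gs[i := r \<odot>\<^bsub>FM Y\<^esub> f])"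
    and gen: "\<And>xs. length xs = d \<Longrightarrow> set xs \<subseteq> Y \<Longrightarrow> P (map (free_gen R) xs)"
  shows "P fs"
proof -
  interpret F: module R "FM Y" by (rule free_module_module)
  have "P (fs @ map (free_gen R) xs)"
    if "length fs + length xs = d" "set fs \<subseteq> carrier (FM Y)" "set xs \<subseteq> Y" for fs xs
    using that
  proof (induction fs arbitrary: xs rule: rev_induct)
    case Nil
    then show ?case using gen by simp
  next
    case (snoc f fs)
    define gs where "gs = fs @ \<zero>\<^bsub>FM Y\<^esub> # map (free_gen R) xs"
    have upd: "(fs @ [h]) @ map (free_gen R) xs = gs[length fs := h]" for h
      by (simp add: gs_def)
    have gs: "length gs = d" "set gs \<subseteq> carrier (FM Y)" "length fs < d"
      using snoc.prems by (auto simp: gs_def intro: free_gen_closed)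
    have gen': "P (gs[length fs := free_gen R y])" if "y \<in> Y" for y
    proof -
      have "P (fs @ map (free_gen R) (y # xs))" using snoc.prems that by (intro snoc.IH) auto
      then show ?thesis by (simp add: gs_def)
    qed
    have "f \<in> carrier (FM Y)" using snoc.prems by simp
    then have "P (gs[length fs := f])"
    proof (induction f rule: free_module_induct)
      case zero
      \<comment> \<open>The zero vector is handled as zero times a generator, so it falls under the
        scalar case; this is where \<open>Y\<close> has to be nonempty.\<close>
      obtain y where y: "y \<in> Y" using assms(1) by blast
      have "P (gs[length fs := \<zero> \<odot>\<^bsub>FM Y\<^esub> free_gen R y])"
        using gs y gen' by (intro smult free_gen_closed) auto
      then show ?case using y by (simp add: free_gen_closed)
    qed (use gs gen' in \<open>auto intro: add smult\<close>)
    then show ?case by (simp only: upd)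
  qed
  from this[of fs "[]"] assms(2,3) show ?thesis by simp
qed

text \<open>The multilinear extension of \<open>D\<close> from lists of generators to lists of
  vectors. It is built slot by slot: for each generator in the first slot the remaining slots are
  extended recursively, and the outcome is extended linearly in the first slot.\<close>

fun lift :: "('a list \<Rightarrow> 'a) \<Rightarrow> ('a \<Rightarrow> 'a) list \<Rightarrow> 'a" where
  "lift D [] = D []"
| "lift D (f # fs) = lin_ext (\<lambda>x. lift (\<lambda>xs. D (x # xs)) fs) f"

lemma lift_closed:
  assumes "set fs \<subseteq> carrier (FM Y)"
    and "\<And>xs. length xs = length fs \<Longrightarrow> set xs \<subseteq> Y \<Longrightarrow> D xs \<in> carrier R"
  shows "lift D fs \<in> carrier R"
  using assms
proof (induction fs arbitrary: D)
  case (Cons f fs)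
  have "lift (\<lambda>xs. D (x # xs)) fs \<in> carrier R" if "x \<in> Y" for x
    using Cons.prems that by (intro Cons.IH) auto
  then show ?case using Cons.prems by (auto intro!: lin_ext_closed[where Y = Y])
qed simp

text \<open>Additivity in the first slot is additivity of \<open>lin_ext\<close> in its vector. In a
  later slot it is additivity of \<open>lin_ext\<close> in the prescribed values, with the induction
  hypothesis applied to each generator in front.\<close>

lemma lift_add:
  assumes "set fs \<subseteq> carrier (FM Y)" "i < length fs" "f \<in> carrier (FM Y)" "g \<in> carrier (FM Y)"
    and "\<And>xs. length xs = length fs \<Longrightarrow> set xs \<subseteq> Y \<Longrightarrow> D xs \<in> carrier R"
  shows "lift D (fs[i := f \<oplus>\<^bsub>FM Y\<^esub> g]) = lift D (fs[i := f]) \<oplus> lift D (fs[i := g])"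
  using assms
proof (induction fs arbitrary: D i)
  case (Cons h fs)
  have hc: "h \<in> carrier (FM Y)" and fs: "set fs \<subseteq> carrier (FM Y)" using Cons.prems by auto
  have D: "D (x # xs) \<in> carrier R" if "x \<in> Y" "length xs = length fs" "set xs \<subseteq> Y" for x xs
    using Cons.prems(5) that by simp
  show ?case
  proof (cases i)
    case 0
    have "lift (\<lambda>xs. D (x # xs)) fs \<in> carrier R" if "x \<in> Y" for x
      using fs D that by (intro lift_closed) auto
    then show ?thesis using Cons.prems(3,4) by (simp add: 0 lin_ext_add[where Y = Y])
  next
    case (Suc j)
    have j: "j < length fs" using Cons.prems(2) Suc by simp
    have cl: "lift (\<lambda>xs. D (x # xs)) (fs[j := k]) \<in> carrier R" if "x \<in> Y" "k \<in> carrier (FM Y)" for x k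
      using fs D that set_update_subset_insert[of fs j k] by (intro lift_closed) auto
    have eq: "lift (\<lambda>xs. D (x # xs)) (fs[j := f \<oplus>\<^bsub>FM Y\<^esub> g]) =
        lift (\<lambda>xs. D (x # xs)) (fs[j := f]) \<oplus> lift (\<lambda>xs. D (x # xs)) (fs[j := g])" if "x \<in> Y" for x
      using D that by (intro Cons.IH fs j Cons.prems(3,4)) auto
    have "lift D ((h # fs)[i := f \<oplus>\<^bsub>FM Y\<^esub> g]) =
      lin_ext (\<lambda>x. lift (\<lambda>xs. D (x # xs)) (fs[j := f]) \<oplus> lift (\<lambda>xs. D (x # xs)) (fs[j := g])) h"
      using cl Cons.prems(3,4) unfolding Suc list_update.simps nat.case lift.simps
      by (intro lin_ext_cong[OF hc]) (auto simp: eq)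
    also have "\<dots> = lift D ((h # fs)[i := f]) \<oplus> lift D ((h # fs)[i := g])"
      unfolding Suc list_update.simps nat.case lift.simps
      by (intro lin_ext_fun_add[OF hc] cl Cons.prems(3,4))
    finally show ?thesis .
  qed
qed simp

lemma lift_smult:
  assumes "set fs \<subseteq> carrier (FM Y)" "i < length fs" "f \<in> carrier (FM Y)" "r \<in> carrier R"
    and "\<And>xs. length xs = length fs \<Longrightarrow> set xs \<subseteq> Y \<Longrightarrow> D xs \<in> carrier R"
  shows "lift D (fs[i := r \<odot>\<^bsub>FM Y\<^esub> f]) = r \<otimes> lift D (fs[i := f])"
  using assms
proof (induction fs arbitrary: D i)
  case (Cons h fs)
  interpret F: module R "FM Y" by (rule free_module_module)
  have hc: "h \<in> carrier (FM Y)" and fs: "set fs \<subseteq> carrier (FM Y)" using Cons.prems by auto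
  have D: "D (x # xs) \<in> carrier R" if "x \<in> Y" "length xs = length fs" "set xs \<subseteq> Y" for x xs
    using Cons.prems(5) that by simp
  show ?case
  proof (cases i)
    case 0
    have "lift (\<lambda>xs. D (x # xs)) fs \<in> carrier R" if "x \<in> Y" for x
      using fs D that by (intro lift_closed) auto
    then show ?thesis using Cons.prems(3,4) by (simp add: 0 lin_ext_smult[where Y = Y])
  next
    case (Suc j)
    have j: "j < length fs" using Cons.prems(2) Suc by simp
    have cl: "lift (\<lambda>xs. D (x # xs)) (fs[j := k]) \<in> carrier R" if "x \<in> Y" "k \<in> carrier (FM Y)" for x k
      using fs D that set_update_subset_insert[of fs j k] by (intro lift_closed) auto
    have eq: "lift (\<lambda>xs. D (x # xs)) (fs[j := r \<odot>\<^bsub>FM Y\<^esub> f]) =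
        r \<otimes> lift (\<lambda>xs. D (x # xs)) (fs[j := f])" if "x \<in> Y" for x
      using D that by (intro Cons.IH fs j Cons.prems(3,4)) auto
    have "lift D ((h # fs)[i := r \<odot>\<^bsub>FM Y\<^esub> f]) = lin_ext (\<lambda>x. r \<otimes> lift (\<lambda>xs. D (x # xs)) (fs[j := f])) h"
      using cl Cons.prems(3,4) unfolding Suc list_update.simps nat.case lift.simps
      by (intro lin_ext_cong[OF hc]) (auto simp: eq)
    also have "\<dots> = r \<otimes> lift D ((h # fs)[i := f])"
      unfolding Suc list_update.simps nat.case lift.simps
      by (intro lin_ext_fun_smult[OF hc] cl Cons.prems(3,4))
    finally show ?thesis .
  qed
qed simp

lemma lift_gen:
  assumes "set xs \<subseteq> Y" "\<And>ys. length ys = length xs \<Longrightarrow> set ys \<subseteq> Y \<Longrightarrow> D ys \<in> carrier R"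
  shows "lift D (map (free_gen R) xs) = D xs"
  using assms
proof (induction xs arbitrary: D)
  case (Cons x xs)
  have "lift (\<lambda>ys. D (y # ys)) (map (free_gen R) xs) = D (y # xs)" if "y \<in> Y" for y
    using Cons.prems that by (intro Cons.IH) auto
  moreover have "lift (\<lambda>ys. D (y # ys)) (map (free_gen R) xs) \<in> carrier R" if "y \<in> Y" for y
    using Cons.prems that by (intro lift_closed[where Y = Y]) (auto intro: free_gen_closed)
  ultimately show ?case using Cons.prems by (simp add: lin_ext_gen[where Y = Y])
qed simp

end

section \<open>Alternating derivations and the trace ideal\<close>

text \<open>These are the linear forms on the exterior power of the differentials, written without
  any module, so that they can be composed with ring homomorphisms. The slot rules overwrite
  position \<open>i\<close> of an arbitrary list, hence the old entry there plays no part. For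
  \<open>d = 0\<close> the object is a single ring element \<open>D []\<close>.\<close>

definition alternating_derivation ::
  "('k, 'm) ring_scheme \<Rightarrow> ('a, 'n) ring_scheme \<Rightarrow> ('k \<Rightarrow> 'a) \<Rightarrow> nat \<Rightarrow> ('a list \<Rightarrow> 'a) \<Rightarrow> bool" where
  "alternating_derivation K S \<iota> d D \<longleftrightarrow>
     (\<forall>xs. length xs = d \<and> set xs \<subseteq> carrier S \<longrightarrow> D xs \<in> carrier S \<and>
        (\<forall>i<d. (\<forall>x\<in>carrier S. \<forall>y\<in>carrier S.
             D (xs[i := x \<oplus>\<^bsub>S\<^esub> y]) = D (xs[i := x]) \<oplus>\<^bsub>S\<^esub> D (xs[i := y]) \<and>
             D (xs[i := x \<otimes>\<^bsub>S\<^esub> y]) = x \<otimes>\<^bsub>S\<^esub> D (xs[i := y]) \<oplus>\<^bsub>S\<^esub> y \<otimes>\<^bsub>S\<^esub> D (xs[i := x])) \<and>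
           (\<forall>c\<in>carrier K. D (xs[i := \<iota> c]) = \<zero>\<^bsub>S\<^esub>)) \<and>
        (\<forall>i j. i < j \<and> j < d \<and> xs ! i = xs ! j \<longrightarrow> D xs = \<zero>\<^bsub>S\<^esub>))"

definition derivation_ideal ::
  "('k, 'm) ring_scheme \<Rightarrow> ('a, 'n) ring_scheme \<Rightarrow> ('k \<Rightarrow> 'a) \<Rightarrow> nat \<Rightarrow> 'a set" where
  "derivation_ideal K S \<iota> d =
     Idl\<^bsub>S\<^esub> {D xs | D xs. alternating_derivation K S \<iota> d D \<and> length xs = d \<and> set xs \<subseteq> carrier S}"

lemma alternating_derivationD:
  assumes "alternating_derivation K S \<iota> d D" "length xs = d" "set xs \<subseteq> carrier S"
  shows "D xs \<in> carrier S"
    and "i < d \<Longrightarrow> x \<in> carrier S \<Longrightarrow> y \<in> carrier S \<Longrightarrow>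
      D (xs[i := x \<oplus>\<^bsub>S\<^esub> y]) = D (xs[i := x]) \<oplus>\<^bsub>S\<^esub> D (xs[i := y])"
    and "i < d \<Longrightarrow> x \<in> carrier S \<Longrightarrow> y \<in> carrier S \<Longrightarrow>
      D (xs[i := x \<otimes>\<^bsub>S\<^esub> y]) = x \<otimes>\<^bsub>S\<^esub> D (xs[i := y]) \<oplus>\<^bsub>S\<^esub> y \<otimes>\<^bsub>S\<^esub> D (xs[i := x])"
    and "i < d \<Longrightarrow> c \<in> carrier K \<Longrightarrow> D (xs[i := \<iota> c]) = \<zero>\<^bsub>S\<^esub>"
    and "i < j \<Longrightarrow> j < d \<Longrightarrow> xs ! i = xs ! j \<Longrightarrow> D xs = \<zero>\<^bsub>S\<^esub>"
  using assms unfolding alternating_derivation_def by blast+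

lemma set_list_update_subset: "set xs \<subseteq> A \<Longrightarrow> x \<in> A \<Longrightarrow> set (xs[i := x]) \<subseteq> A"
  using set_update_subset_insert[of xs i x] by auto

context cring
begin

lemma ideal_if_closed:
  assumes "I \<subseteq> carrier R" "\<zero> \<in> I" "\<And>x y. x \<in> I \<Longrightarrow> y \<in> I \<Longrightarrow> x \<oplus> y \<in> I"
    and smult: "\<And>r x. r \<in> carrier R \<Longrightarrow> x \<in> I \<Longrightarrow> r \<otimes> x \<in> I"
  shows "ideal I R"
proof (rule idealI[OF ring_axioms])
  have "\<ominus> x \<in> I" if "x \<in> I" for x
    using smult[of "\<ominus> \<one>" x] that assms(1) by (auto simp: l_minus subset_iff)
  then show "subgroup I (add_monoid R)"
    using assms(1-3) by (intro add.subgroupI) (auto simp: a_inv_def[symmetric])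
  show "x \<otimes> a \<in> I" "a \<otimes> x \<in> I" if "a \<in> I" "x \<in> carrier R" for a x
    using smult[OF that(2,1)] that assms(1) m_comm[of a x] by (auto simp: subset_iff)
qed

lemma ideal_finsum:
  assumes "ideal I R" "finite A" "\<And>i. i \<in> A \<Longrightarrow> f i \<in> I"
  shows "finsum R f A \<in> I"
proof -
  interpret I: ideal I R by fact
  show ?thesis
    using assms(2,3)
  proof (induction A rule: finite_induct)
    case (insert a A)
    then have "f \<in> A \<rightarrow> carrier R" "f a \<in> carrier R" using I.Icarr by auto
    then show ?case using insert by simp
  qed simp
qed

text \<open>The trace is by definition a set of finite sums indexed by initial segments of the
  naturals. Two such sums are joined by appending one summand at a time (\<open>step\<close>, then
  \<open>sum\<close>), and a ring element is absorbed into the homomorphisms.\<close>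

lemma trace_ideal_is_ideal: "ideal (trace_ideal R M) R"
proof -
  define H where "H = module_hom R M (regular_module R)"
  have H_closed: "f x \<in> carrier R" if "f \<in> H" "x \<in> carrier M" for f x
    using that by (auto simp: H_def module_hom_def regular_module_def)
  have H_scale: "(\<lambda>x. r \<otimes> f x) \<in> H" if "f \<in> H" "r \<in> carrier R" for f r
    using that H_closed[OF that(1)]
    by (auto simp: H_def module_hom_def regular_module_def r_distr m_lcomm)
  have T: "z \<in> trace_ideal R M \<longleftrightarrow>
      (\<exists>(n::nat) f x. z = finsum R (\<lambda>i. f i (x i)) {..<n} \<and> (\<forall>i<n. f i \<in> H \<and> x i \<in> carrier M))" for z
    unfolding trace_ideal_def H_def by blast
  have closed: "z \<in> carrier R" if "z \<in> trace_ideal R M" for z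
    using that H_closed unfolding T by (auto intro!: finsum_closed)
  have step: "z \<oplus> f y \<in> trace_ideal R M" if z: "z \<in> trace_ideal R M" and f: "f \<in> H" "y \<in> carrier M" for z f y
  proof -
    obtain n g x where z: "z = finsum R (\<lambda>i. g i (x i)) {..<n::nat}" "\<forall>i<n. g i \<in> H \<and> x i \<in> carrier M"
      using z unfolding T by blast
    let ?g = "g(n := f)" and ?x = "x(n := y)"
    have "finsum R (\<lambda>i. ?g i (?x i)) {..<Suc n} = f y \<oplus> finsum R (\<lambda>i. ?g i (?x i)) {..<n}"
      unfolding lessThan_Suc using z f H_closed by (subst finsum_insert) auto
    also have "finsum R (\<lambda>i. ?g i (?x i)) {..<n} = z"
      unfolding z(1) using z(2) H_closed by (intro finsum_cong') auto
    finally have "z \<oplus> f y = finsum R (\<lambda>i. ?g i (?x i)) {..<Suc n}"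
      using closed[OF that(1)] f H_closed by (simp add: a_comm)
    moreover have "\<forall>i<Suc n. ?g i \<in> H \<and> ?x i \<in> carrier M" using z f by auto
    ultimately show ?thesis unfolding T by blast
  qed
  have sum: "z \<oplus> finsum R (\<lambda>i. f i (x i)) {..<n} \<in> trace_ideal R M"
    if "z \<in> trace_ideal R M" "\<forall>i<n. f i \<in> H \<and> x i \<in> carrier M" for z f x and n :: nat
    using that(2)
  proof (induction n)
    case 0
    then show ?case using that(1) closed by simp
  next
    case (Suc n)
    have c: "(\<lambda>i. f i (x i)) \<in> {..<Suc n} \<rightarrow> carrier R" using Suc.prems H_closed by auto
    then have "finsum R (\<lambda>i. f i (x i)) {..<Suc n} = f n (x n) \<oplus> finsum R (\<lambda>i. f i (x i)) {..<n}"
      unfolding lessThan_Suc by (subst finsum_insert) auto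
    moreover have "finsum R (\<lambda>i. f i (x i)) {..<n} \<in> carrier R" using c by (intro finsum_closed) auto
    moreover have "f n (x n) \<in> carrier R" using c by auto
    moreover have "(z \<oplus> finsum R (\<lambda>i. f i (x i)) {..<n}) \<oplus> f n (x n) \<in> trace_ideal R M"
      by (rule step) (use Suc in auto)
    ultimately show ?case using closed[OF that(1)] by (simp add: a_ac)
  qed
  show ?thesis
  proof (rule ideal_if_closed)
    show "trace_ideal R M \<subseteq> carrier R" using closed by auto
    show "\<zero> \<in> trace_ideal R M" unfolding T by (rule exI[of _ 0]) simp
    show "x \<oplus> y \<in> trace_ideal R M" if "x \<in> trace_ideal R M" "y \<in> trace_ideal R M" for x y
      using that(2) sum[OF that(1)] unfolding T[of y] by blast
    fix r z assume r: "r \<in> carrier R" and "z \<in> trace_ideal R M"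
    then obtain n f x where z: "z = finsum R (\<lambda>i. f i (x i)) {..<n::nat}" "\<forall>i<n. f i \<in> H \<and> x i \<in> carrier M"
      unfolding T by blast
    have "r \<otimes> z = finsum R (\<lambda>i. (\<lambda>y. r \<otimes> f i y) (x i)) {..<n}"
      unfolding z(1) using z(2) r H_closed by (intro finsum_rdistr) auto
    moreover have "\<forall>i<n. (\<lambda>y. r \<otimes> f i y) \<in> H \<and> x i \<in> carrier M" using z(2) r H_scale by auto
    ultimately show "r \<otimes> z \<in> trace_ideal R M"
      unfolding T by (intro exI[of _ n] exI[of _ "\<lambda>i y. r \<otimes> f i y"] exI[of _ x] conjI)
  qed
qed

end

section \<open>Kaehler differentials\<close>

locale cring_over = cring S for K :: "('k, 'm) ring_scheme" and S :: "('a, 'n) ring_scheme" (structure) and \<iota> :: "'k \<Rightarrow> 'a" +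
  assumes incl_closed: "c \<in> carrier K \<Longrightarrow> \<iota> c \<in> carrier S"
begin

definition "F = free_module S (carrier S)"

definition "kaehler_rel =
  {free_gen S (x \<oplus> y) \<ominus>\<^bsub>F\<^esub> (free_gen S x \<oplus>\<^bsub>F\<^esub> free_gen S y) | x y. x \<in> carrier S \<and> y \<in> carrier S}
  \<union> {free_gen S (x \<otimes> y) \<ominus>\<^bsub>F\<^esub> (x \<odot>\<^bsub>F\<^esub> free_gen S y \<oplus>\<^bsub>F\<^esub> y \<odot>\<^bsub>F\<^esub> free_gen S x) | x y. x \<in> carrier S \<and> y \<in> carrier S}
  \<union> {free_gen S (\<iota> c) | c. c \<in> carrier K}"

definition "N = submodule_span S F kaehler_rel"

definition "\<Omega> = kaehler K S \<iota>"

definition "cl f = N +>\<^bsub>F\<^esub> f"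

sublocale F: module S F unfolding F_def by (rule free_module_module)

lemma gen_F [simp, intro]: "x \<in> carrier S \<Longrightarrow> free_gen S x \<in> carrier F"
  unfolding F_def by (rule free_gen_closed)

lemma Omega_def': "\<Omega> = quot_module S F N"
  unfolding \<Omega>_def N_def kaehler_rel_def kaehler_def F_def Let_def by simp

lemma kaehler_rel_closed: "kaehler_rel \<subseteq> carrier F"
  by (auto simp: kaehler_rel_def incl_closed intro!: F.M.minus_closed F.M.a_closed F.smult_closed)

lemmas N_submodule = F.submodule_span_props(1)[OF kaehler_rel_closed, folded N_def]
lemmas N_incl = F.submodule_span_props(2)[OF kaehler_rel_closed, folded N_def]
lemmas N_min = F.submodule_span_props(3)[OF kaehler_rel_closed, folded N_def]

lemma Omega_carrier: "C \<in> carrier \<Omega> \<longleftrightarrow> (\<exists>f\<in>carrier F. C = cl f)"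
  unfolding Omega_def' cl_def by (rule F.quot_carrier_iff)

lemma cl_closed: "f \<in> carrier F \<Longrightarrow> cl f \<in> carrier \<Omega>"
  using Omega_carrier by blast

lemma cl_add: "f \<in> carrier F \<Longrightarrow> g \<in> carrier F \<Longrightarrow> cl f \<oplus>\<^bsub>\<Omega>\<^esub> cl g = cl (f \<oplus>\<^bsub>F\<^esub> g)"
  unfolding Omega_def' cl_def by (rule F.quot_add[OF N_submodule])

lemma cl_smult: "r \<in> carrier S \<Longrightarrow> f \<in> carrier F \<Longrightarrow> r \<odot>\<^bsub>\<Omega>\<^esub> cl f = cl (r \<odot>\<^bsub>F\<^esub> f)"
  unfolding Omega_def' cl_def by (rule F.quot_smult[OF N_submodule])

lemma cl_eq_iff: "f \<in> carrier F \<Longrightarrow> g \<in> carrier F \<Longrightarrow> cl f = cl g \<longleftrightarrow> f \<ominus>\<^bsub>F\<^esub> g \<in> N"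
  unfolding cl_def by (rule F.quot_eq_iff[OF N_submodule])

text \<open>The representative is a function of the class, so equal differentials receive equal
  representatives. This lets the alternation relation be checked in the free module, where it reads
  as equality of two list entries.\<close>

lemma Omega_list:
  assumes "set Xs \<subseteq> carrier \<Omega>"
  obtains fs where "set fs \<subseteq> carrier F" "Xs = map cl fs" "length fs = length Xs"
    "\<And>i j. i < length Xs \<Longrightarrow> j < length Xs \<Longrightarrow> Xs ! i = Xs ! j \<Longrightarrow> fs ! i = fs ! j"
proof
  define rep where "rep C = (SOME f. f \<in> carrier F \<and> C = cl f)" for C
  have rep: "rep C \<in> carrier F \<and> C = cl (rep C)" if "C \<in> carrier \<Omega>" for C
    using someI_ex[OF Omega_carrier[THEN iffD1, OF that, unfolded Bex_def]] unfolding rep_def .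
  have rep_F: "rep C \<in> carrier F" if "C \<in> carrier \<Omega>" for C
    using conjunct1[OF rep[OF that]] .
  have cl_rep: "cl (rep C) = C" if "C \<in> carrier \<Omega>" for C
    using conjunct2[OF rep[OF that]] by (rule sym)
  have "map cl (map rep Xs) = Xs"
    using assms cl_rep by (induction Xs) simp_all
  then show "Xs = map cl (map rep Xs)" by (rule sym)
  show "set (map rep Xs) \<subseteq> carrier F" using rep_F assms by (induction Xs) simp_all
  show "length (map rep Xs) = length Xs" by simp
  show "map rep Xs ! i = map rep Xs ! j" if "i < length Xs" "j < length Xs" "Xs ! i = Xs ! j" for i j
    using that by simp
qed

definition "d_map x = cl (free_gen S x)"

text \<open>The map \<open>d_map\<close> is the universal derivation. Its vanishing on constants is
  stated as \<open>d_map (\<iota> c) = \<zero> \<odot> d_map x\<close>, the form to which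
  homogeneity of a multilinear map in one slot applies directly.\<close>

lemma d_map_props:
  assumes "x \<in> carrier S" "y \<in> carrier S"
  shows "d_map x \<in> carrier \<Omega>"
    and "d_map (x \<oplus> y) = d_map x \<oplus>\<^bsub>\<Omega>\<^esub> d_map y"
    and "d_map (x \<otimes> y) = (x \<odot>\<^bsub>\<Omega>\<^esub> d_map y) \<oplus>\<^bsub>\<Omega>\<^esub> (y \<odot>\<^bsub>\<Omega>\<^esub> d_map x)"
    and "c \<in> carrier K \<Longrightarrow> d_map (\<iota> c) = \<zero> \<odot>\<^bsub>\<Omega>\<^esub> d_map x"
proof -
  note a = assms
  show "d_map x \<in> carrier \<Omega>" using a by (auto simp: d_map_def intro: cl_closed)
  have "free_gen S (x \<oplus> y) \<ominus>\<^bsub>F\<^esub> (free_gen S x \<oplus>\<^bsub>F\<^esub> free_gen S y) \<in> N"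
    using N_incl a unfolding kaehler_rel_def by blast
  then show "d_map (x \<oplus> y) = d_map x \<oplus>\<^bsub>\<Omega>\<^esub> d_map y"
    using a by (simp add: d_map_def cl_add cl_eq_iff)
  have "free_gen S (x \<otimes> y) \<ominus>\<^bsub>F\<^esub> (x \<odot>\<^bsub>F\<^esub> free_gen S y \<oplus>\<^bsub>F\<^esub> y \<odot>\<^bsub>F\<^esub> free_gen S x) \<in> N"
    using N_incl a unfolding kaehler_rel_def by blast
  then show "d_map (x \<otimes> y) = (x \<odot>\<^bsub>\<Omega>\<^esub> d_map y) \<oplus>\<^bsub>\<Omega>\<^esub> (y \<odot>\<^bsub>\<Omega>\<^esub> d_map x)"
    using a by (simp add: d_map_def cl_add cl_smult cl_eq_iff)
  assume c: "c \<in> carrier K"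
  then have "free_gen S (\<iota> c) \<in> N" using N_incl unfolding kaehler_rel_def by blast
  then show "d_map (\<iota> c) = \<zero> \<odot>\<^bsub>\<Omega>\<^esub> d_map x"
    using a c incl_closed[OF c] F.M.l_zero[OF F.M.a_inv_closed[OF F.M.zero_closed]]
      F.M.r_neg[OF F.M.zero_closed]
    by (simp add: d_map_def cl_smult cl_eq_iff F.M.minus_eq)
qed

section \<open>The presentation of the exterior power\<close>

context
  fixes d :: nat
begin

definition "Y = {Xs. length Xs = d \<and> set Xs \<subseteq> carrier \<Omega>}"

definition "G = free_module S Y"

definition "ext_rel =
      {free_gen S (xs[i := u \<oplus>\<^bsub>\<Omega>\<^esub> v]) \<ominus>\<^bsub>G\<^esub> (free_gen S (xs[i := u]) \<oplus>\<^bsub>G\<^esub> free_gen S (xs[i := v])) | xs i u v.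
          xs \<in> Y \<and> i < d \<and> u \<in> carrier \<Omega> \<and> v \<in> carrier \<Omega>}
       \<union> {free_gen S (xs[i := r \<odot>\<^bsub>\<Omega>\<^esub> u]) \<ominus>\<^bsub>G\<^esub> (r \<odot>\<^bsub>G\<^esub> free_gen S (xs[i := u])) | xs i r u.
          xs \<in> Y \<and> i < d \<and> r \<in> carrier S \<and> u \<in> carrier \<Omega>}
       \<union> {free_gen S xs | xs. xs \<in> Y \<and> (\<exists>i j. i < j \<and> j < d \<and> xs ! i = xs ! j)}"

definition "E = submodule_span S G ext_rel"

interpretation G: module S G unfolding G_def by (rule free_module_module)

lemma gen_G [simp, intro]: "xs \<in> Y \<Longrightarrow> free_gen S xs \<in> carrier G"
  unfolding G_def by (rule free_gen_closed)

lemma Omega_ops: "u \<in> carrier \<Omega> \<Longrightarrow> v \<in> carrier \<Omega> \<Longrightarrow> u \<oplus>\<^bsub>\<Omega>\<^esub> v \<in> carrier \<Omega>"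
  "r \<in> carrier S \<Longrightarrow> u \<in> carrier \<Omega> \<Longrightarrow> r \<odot>\<^bsub>\<Omega>\<^esub> u \<in> carrier \<Omega>"
  unfolding Omega_carrier using cl_add cl_smult F.M.a_closed F.smult_closed by metis+

lemma Y_update: "xs \<in> Y \<Longrightarrow> u \<in> carrier \<Omega> \<Longrightarrow> xs[i := u] \<in> Y"
  unfolding Y_def using set_list_update_subset[of xs "carrier \<Omega>"] by auto

lemma ext_power_eq: "ext_power S d \<Omega> = quot_module S G E"
  unfolding E_def ext_rel_def ext_power_def G_def Y_def Let_def by simp

lemma ext_rel_closed: "ext_rel \<subseteq> carrier G"
  by (auto simp: ext_rel_def Omega_ops Y_update intro!: G.M.minus_closed G.M.a_closed G.smult_closed)

lemmas E_submodule = G.submodule_span_props(1)[OF ext_rel_closed, folded E_def]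
lemmas E_incl = G.submodule_span_props(2)[OF ext_rel_closed, folded E_def]
lemmas E_min = G.submodule_span_props(3)[OF ext_rel_closed, folded E_def]

end

lemma minus_self: "a \<in> carrier S \<Longrightarrow> a \<ominus> a = \<zero>"
  by (simp add: minus_eq r_neg)

lemma F_list_update: "set fs \<subseteq> carrier F \<Longrightarrow> f \<in> carrier F \<Longrightarrow> set (fs[i := f]) \<subseteq> carrier F"
  by (rule set_list_update_subset)

section \<open>From an alternating derivation to a linear form on the exterior power\<close>

context
  fixes d :: nat and D :: "'a list \<Rightarrow> 'a"
  assumes D: "alternating_derivation K S \<iota> d D"
begin

lemma liftD_closed:
  assumes "length fs = d" "set fs \<subseteq> carrier F"
  shows "lift D fs \<in> carrier S"
  using assms alternating_derivationD(1)[OF D] by (intro lift_closed[where Y = "carrier S"]) (auto simp: F_def)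

lemma liftD_add:
  assumes "length fs = d" "set fs \<subseteq> carrier F" "i < d" "f \<in> carrier F" "g \<in> carrier F"
  shows "lift D (fs[i := f \<oplus>\<^bsub>F\<^esub> g]) = lift D (fs[i := f]) \<oplus> lift D (fs[i := g])"
  using assms alternating_derivationD(1)[OF D] unfolding F_def by (intro lift_add) auto

lemma liftD_smult:
  assumes "length fs = d" "set fs \<subseteq> carrier F" "i < d" "f \<in> carrier F" "r \<in> carrier S"
  shows "lift D (fs[i := r \<odot>\<^bsub>F\<^esub> f]) = r \<otimes> lift D (fs[i := f])"
  using assms alternating_derivationD(1)[OF D] unfolding F_def by (intro lift_smult) auto

lemma liftD_zero:
  assumes "length fs = d" "set fs \<subseteq> carrier F" "i < d"
  shows "lift D (fs[i := \<zero>\<^bsub>F\<^esub>]) = \<zero>"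
  using liftD_smult[OF assms F.M.zero_closed zero_closed] liftD_closed[of "fs[i := \<zero>\<^bsub>F\<^esub>]"] assms
  by (simp add: F_list_update)

lemma liftD_minus:
  assumes "length fs = d" "set fs \<subseteq> carrier F" "i < d" "f \<in> carrier F" "g \<in> carrier F"
  shows "lift D (fs[i := f \<ominus>\<^bsub>F\<^esub> g]) = lift D (fs[i := f]) \<ominus> lift D (fs[i := g])"
proof -
  have "\<ominus>\<^bsub>F\<^esub> g = (\<ominus> \<one>) \<odot>\<^bsub>F\<^esub> g" using assms by (simp add: F.smult_l_minus)
  moreover have "lift D (fs[i := g]) \<in> carrier S" using assms by (intro liftD_closed F_list_update) auto
  ultimately show ?thesis
    using assms liftD_add[OF assms(1-4), of "\<ominus>\<^bsub>F\<^esub> g"] liftD_smult[OF assms(1-3), of g "\<ominus> \<one>"]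
    by (simp add: a_minus_def l_minus)
qed

lemma liftD_gen:
  assumes "length xs = d" "set xs \<subseteq> carrier S"
  shows "lift D (map (free_gen S) xs) = D xs"
  using assms alternating_derivationD(1)[OF D] by (intro lift_gen[where Y = "carrier S"]) auto

lemma gens_F: "set xs \<subseteq> carrier S \<Longrightarrow> set (map (free_gen S) xs) \<subseteq> carrier F"
  by auto

text \<open>Expanding the other slots by multilinearity reduces the vanishing to lists of
  generators. When the induction touches slot \<open>i\<close> itself, the change is overwritten by
  \<open>f\<close>.\<close>

lemma liftD_slot_zero:
  assumes fs: "length fs = d" "set fs \<subseteq> carrier F" and i: "i < d" and f: "f \<in> carrier F"
    and base: "\<And>xs. length xs = d \<Longrightarrow> set xs \<subseteq> carrier S \<Longrightarrow> lift D ((map (free_gen S) xs)[i := f]) = \<zero>"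
  shows "lift D (fs[i := f]) = \<zero>"
proof -
  have "carrier S \<noteq> {}" by blast
  then show ?thesis
    using fs(1) fs(2)[unfolded F_def]
  proof (induction fs rule: free_list_induct)
    case (add gs j g h)
    then show ?case
      using liftD_add[of "gs[i := f]" j g h] i f
      by (cases "i = j") (auto simp: list_update_swap F_def[symmetric] F_list_update)
  next
    case (smult gs j r g)
    then show ?case
      using liftD_smult[of "gs[i := f]" j g r] i f
      by (cases "i = j") (auto simp: list_update_swap F_def[symmetric] F_list_update)
  qed (use base in auto)
qed

lemma liftD_kaehler_rel:
  assumes fs: "length fs = d" "set fs \<subseteq> carrier F" and i: "i < d" and f: "f \<in> kaehler_rel"
  shows "lift D (fs[i := f]) = \<zero>"
proof (rule liftD_slot_zero[OF fs i])
  show "f \<in> carrier F" using f kaehler_rel_closed by auto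
  fix xs assume xs: "length xs = d" "set xs \<subseteq> carrier S"
  let ?g = "map (free_gen S) xs"
  have g: "length ?g = d" "set ?g \<subseteq> carrier F" using xs by auto
  have gen: "lift D (?g[i := free_gen S x]) = D (xs[i := x])" if "x \<in> carrier S" for x
    using liftD_gen[of "xs[i := x]"] xs that set_list_update_subset[OF xs(2) that] by (simp add: map_update)
  have cl: "D (xs[i := x]) \<in> carrier S" if "x \<in> carrier S" for x
    using alternating_derivationD(1)[OF D, of "xs[i := x]"] xs that set_list_update_subset[OF xs(2) that] by simp
  note DD = alternating_derivationD[OF D xs]
  consider (add) x y where "x \<in> carrier S" "y \<in> carrier S"
      "f = free_gen S (x \<oplus> y) \<ominus>\<^bsub>F\<^esub> (free_gen S x \<oplus>\<^bsub>F\<^esub> free_gen S y)"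
    | (mult) x y where "x \<in> carrier S" "y \<in> carrier S"
      "f = free_gen S (x \<otimes> y) \<ominus>\<^bsub>F\<^esub> (x \<odot>\<^bsub>F\<^esub> free_gen S y \<oplus>\<^bsub>F\<^esub> y \<odot>\<^bsub>F\<^esub> free_gen S x)"
    | (const) c where "c \<in> carrier K" "f = free_gen S (\<iota> c)"
    using f unfolding kaehler_rel_def by blast
  then show "lift D (?g[i := f]) = \<zero>"
  proof cases
    case add
    then show ?thesis using i g DD(2)[of i x y] cl
      by (simp add: liftD_minus liftD_add gen minus_self)
  next
    case mult
    then show ?thesis using i g DD(3)[of i x y] cl
      by (simp add: liftD_minus liftD_add liftD_smult gen minus_self)
  next
    case const
    then show ?thesis using i DD(4)[of i c] by (simp add: gen incl_closed)
  qed
qed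

text \<open>The vectors that make the lift vanish in slot \<open>i\<close> form a submodule. It
  contains the Kaehler relations, hence also the submodule \<open>N\<close> that they span.\<close>

lemma liftD_N:
  assumes fs: "length fs = d" "set fs \<subseteq> carrier F" and i: "i < d" and f: "f \<in> N"
  shows "lift D (fs[i := f]) = \<zero>"
proof -
  let ?H = "{f \<in> carrier F. lift D (fs[i := f]) = \<zero>}"
  have "submodule ?H S F"
  proof (rule F.submoduleI)
    fix a assume "a \<in> ?H"
    then show "\<ominus>\<^bsub>F\<^esub> a \<in> ?H"
      using liftD_minus[OF fs i F.M.zero_closed, of a] liftD_zero[OF fs i]
      by (simp add: F.M.minus_eq minus_eq)
  qed (use fs i in \<open>auto simp: liftD_add liftD_smult liftD_zero\<close>)
  moreover have "kaehler_rel \<subseteq> ?H" using liftD_kaehler_rel[OF fs i] kaehler_rel_closed by auto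
  ultimately have "N \<subseteq> ?H" by (rule N_min)
  then show ?thesis using f by auto
qed

text \<open>The entries are exchanged one at a time along the hybrid lists
  \<open>take k gs @ drop k fs\<close>; each exchange alters one slot by an element of
  \<open>N\<close>.\<close>

lemma liftD_cong:
  assumes "length fs = d" "set fs \<subseteq> carrier F" "length gs = d" "set gs \<subseteq> carrier F"
    and "map cl fs = map cl gs"
  shows "lift D fs = lift D gs"
proof -
  have "lift D (take k gs @ drop k fs) = lift D fs" if "k \<le> d" for k
    using that
  proof (induction k)
    case (Suc k)
    let ?L = "take k gs @ drop k fs"
    have L: "length ?L = d" "set ?L \<subseteq> carrier F" "k < d"
      using Suc.prems assms set_take_subset[of k gs] set_drop_subset[of k fs] by auto
    have 1: "?L[k := fs ! k] = ?L"
      using L assms by (intro list_update_same_conv[THEN iffD2]) (auto simp: nth_append)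
    have 2: "?L[k := gs ! k] = take (Suc k) gs @ drop (Suc k) fs"
      using L(3) assms by (simp add: list_update_append take_Suc_conv_app_nth Cons_nth_drop_Suc[symmetric])
    have c: "fs ! k \<in> carrier F" "gs ! k \<in> carrier F"
      using L(3) assms by (auto simp: subset_iff)
    have "cl (gs ! k) = cl (fs ! k)" using assms L(3) by (metis nth_map)
    then have "gs ! k \<ominus>\<^bsub>F\<^esub> fs ! k \<in> N" using cl_eq_iff c by blast
    then have "lift D (?L[k := gs ! k \<ominus>\<^bsub>F\<^esub> fs ! k]) = \<zero>" by (rule liftD_N[OF L])
    then have "lift D (?L[k := gs ! k]) \<ominus> lift D (?L[k := fs ! k]) = \<zero>"
      using liftD_minus[OF L c(2,1)] by simp
    then have "lift D (?L[k := gs ! k]) = lift D (?L[k := fs ! k])"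
      using L c by (simp add: liftD_closed F_list_update del: length_append)
    then show ?case using Suc 1 2 by simp
  qed simp
  from this[of d] show ?thesis using assms by simp
qed

lemma add_interchange_zero:
  assumes "a \<in> carrier S" "b \<in> carrier S" "a' \<in> carrier S" "b' \<in> carrier S"
    and "a \<oplus> a' = \<zero>" "b \<oplus> b' = \<zero>"
  shows "(a \<oplus> b) \<oplus> (a' \<oplus> b') = \<zero>"
proof -
  have "(a \<oplus> b) \<oplus> (a' \<oplus> b') = (a \<oplus> a') \<oplus> (b \<oplus> b')" using assms(1-4) by (simp add: a_ac)
  then show ?thesis using assms(5,6) by simp
qed

text \<open>Fixing the contents of slots \<open>i\<close> and \<open>j\<close> leaves a multilinear
  expression in the other slots, so the vanishing of such a sum is decided on generators there. It
  serves twice: for skew symmetry with the contents interchanged, and for alternation with zeros in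
  the second summand.\<close>

lemma liftD_two_slots:
  assumes fs: "length fs = d" "set fs \<subseteq> carrier F" and ij: "i < j" "j < d"
    and fg: "f \<in> carrier F" "g \<in> carrier F" "f' \<in> carrier F" "g' \<in> carrier F"
    and base: "\<And>xs. length xs = d \<Longrightarrow> set xs \<subseteq> carrier S \<Longrightarrow>
      lift D ((map (free_gen S) xs)[i := f, j := g]) \<oplus> lift D ((map (free_gen S) xs)[i := f', j := g']) = \<zero>"
  shows "lift D (fs[i := f, j := g]) \<oplus> lift D (fs[i := f', j := g']) = \<zero>"
proof -
  have swap: "gs[k := h, i := p, j := q] = (gs[i := p, j := q])[k := h]" if "k \<noteq> i" "k \<noteq> j" for gs k h p q
    using that by (simp add: list_update_swap)
  have over: "gs[i := h, i := p, j := q] = gs[i := p, j := q]" "gs[j := h, i := p, j := q] = gs[i := p, j := q]" for gs h p q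
    using ij by (simp_all add: list_update_swap)
  have cl: "lift D ((gs[i := p, j := q])[k := h]) \<in> carrier S"
    if "length gs = d" "set gs \<subseteq> carrier F" "p \<in> carrier F" "q \<in> carrier F" "h \<in> carrier F" for gs p q k h
    using that by (intro liftD_closed F_list_update) auto
  have "carrier S \<noteq> {}" by blast
  then show ?thesis
    using fs(1) fs(2)[unfolded F_def]
  proof (induction fs rule: free_list_induct)
    case (add gs k h h')
    note gs = add(1) add(2)[folded F_def] add(3) and h = add(4,5)[folded F_def] and IH = add(6,7)
    show ?case
    proof (cases "k = i \<or> k = j")
      case True
      then have "gs[k := h, i := p, j := q] = gs[i := p, j := q]" for h p q using over by auto
      then show ?thesis using IH by simp
    next
      case False
      have "lift D ((gs[i := p, j := q])[k := h \<oplus>\<^bsub>F\<^esub> h']) =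
          lift D ((gs[i := p, j := q])[k := h]) \<oplus> lift D ((gs[i := p, j := q])[k := h'])"
        if "p \<in> carrier F" "q \<in> carrier F" for p q
        using gs h that by (intro liftD_add) (auto simp: F_list_update)
      then show ?thesis
        using IH False fg gs h by (simp add: F_def[symmetric] swap add_interchange_zero cl)
    qed
  next
    case (smult gs k r h)
    note gs = smult(1) smult(2)[folded F_def] smult(3) and h = smult(5)[folded F_def] and IH = smult(6)
    show ?case
    proof (cases "k = i \<or> k = j")
      case True
      then have "gs[k := h, i := p, j := q] = gs[i := p, j := q]" for h p q using over by auto
      then show ?thesis using IH by simp
    next
      case False
      have "lift D ((gs[i := p, j := q])[k := r \<odot>\<^bsub>F\<^esub> h]) = r \<otimes> lift D ((gs[i := p, j := q])[k := h])"
        if "p \<in> carrier F" "q \<in> carrier F" for p q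
        using gs h that smult(4) by (intro liftD_smult) (auto simp: F_list_update)
      then show ?thesis
        using IH False fg gs h smult(4) by (simp add: F_def[symmetric] swap r_distr[symmetric] cl)
    qed
  qed (use base in auto)
qed

lemma liftD_gen_slots:
  assumes xs: "length xs = d" "set xs \<subseteq> carrier S" and xy: "x \<in> carrier S" "y \<in> carrier S"
  shows "lift D ((map (free_gen S) xs)[i := free_gen S x, j := free_gen S y]) = D (xs[i := x, j := y])"
  using liftD_gen[of "xs[i := x, j := y]"] xs xy by (simp add: map_update set_list_update_subset)

text \<open>Polarization: the value with \<open>x \<oplus> y\<close> in both slots is zero, and
  expanding it leaves only the two mixed terms.\<close>

lemma skew:
  assumes xs: "length xs = d" "set xs \<subseteq> carrier S" and xy: "x \<in> carrier S" "y \<in> carrier S" and ij: "i < j" "j < d"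
  shows "D (xs[i := x, j := y]) \<oplus> D (xs[i := y, j := x]) = \<zero>"
proof -
  have upd: "length (xs[i := p, j := q]) = d" "set (xs[i := p, j := q]) \<subseteq> carrier S"
    if "p \<in> carrier S" "q \<in> carrier S" for p q
    using that xs by (simp_all add: set_list_update_subset)
  have cl: "D (xs[i := p, j := q]) \<in> carrier S" if "p \<in> carrier S" "q \<in> carrier S" for p q
    by (rule alternating_derivationD(1)[OF D]) (use that upd in auto)
  have alt: "D (xs[i := p, j := p]) = \<zero>" if "p \<in> carrier S" for p
    by (rule alternating_derivationD(5)[OF D upd[OF that that] ij]) (use ij xs in auto)
  have a1: "D (xs[i := p, j := x \<oplus> y]) = D (xs[i := p, j := x]) \<oplus> D (xs[i := p, j := y])" if "p \<in> carrier S" for p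
    by (rule alternating_derivationD(2)[OF D]) (use that xs xy ij in \<open>simp_all add: set_list_update_subset\<close>)
  have a2: "D (xs[j := q, i := x \<oplus> y]) = D (xs[j := q, i := x]) \<oplus> D (xs[j := q, i := y])" if "q \<in> carrier S" for q
    by (rule alternating_derivationD(2)[OF D]) (use that xs xy ij in \<open>simp_all add: set_list_update_subset\<close>)
  have "\<zero> = D (xs[i := x \<oplus> y, j := x \<oplus> y])" using alt xy by simp
  also have "\<dots> = D (xs[i := x \<oplus> y, j := x]) \<oplus> D (xs[i := x \<oplus> y, j := y])" using a1 xy by simp
  also have "D (xs[i := x \<oplus> y, j := x]) = D (xs[i := y, j := x])"
    using a2[OF xy(1)] alt[OF xy(1)] ij cl xy by (simp add: list_update_swap)
  also have "D (xs[i := x \<oplus> y, j := y]) = D (xs[i := x, j := y])"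
    using a2[OF xy(2)] alt[OF xy(2)] ij cl xy by (simp add: list_update_swap)
  finally show ?thesis using cl xy by (simp add: a_comm)
qed

text \<open>With the other slots frozen, the lift is a bilinear form \<open>B\<close>. If
  \<open>B\<close> is skew on generators and vanishes on the diagonal of generators, then the mixed
  terms in the expansion of \<open>B f f\<close> cancel and the square terms are zero. Both facts
  are carried, since in characteristic two skew symmetry does not imply alternation.\<close>

lemma liftD_alternating:
  assumes fs: "length fs = d" "set fs \<subseteq> carrier F" and ij: "i < j" "j < d" and eq: "fs ! i = fs ! j"
  shows "lift D fs = \<zero>"
proof -
  define B where "B f g = lift D (fs[i := f, j := g])" for f g
  have B_closed: "B f g \<in> carrier S" if "f \<in> carrier F" "g \<in> carrier F" for f g
    unfolding B_def using that fs by (intro liftD_closed F_list_update) auto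
  have B_alt: "fs[i := f, j := g] = fs[j := g, i := f]" for f g using ij by (simp add: list_update_swap)
  have Badd1: "B (f \<oplus>\<^bsub>F\<^esub> f') g = B f g \<oplus> B f' g" if "f \<in> carrier F" "f' \<in> carrier F" "g \<in> carrier F" for f f' g
    unfolding B_def B_alt using that fs ij by (intro liftD_add) (auto simp: F_list_update)
  have Badd2: "B f (g \<oplus>\<^bsub>F\<^esub> g') = B f g \<oplus> B f g'" if "g \<in> carrier F" "g' \<in> carrier F" "f \<in> carrier F" for f g g'
    unfolding B_def using that fs ij by (intro liftD_add) (auto simp: F_list_update)
  have Bsm1: "B (r \<odot>\<^bsub>F\<^esub> f) g = r \<otimes> B f g" if "f \<in> carrier F" "r \<in> carrier S" "g \<in> carrier F" for f r g
    unfolding B_def B_alt using that fs ij by (intro liftD_smult) (auto simp: F_list_update)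
  have Bsm2: "B f (r \<odot>\<^bsub>F\<^esub> g) = r \<otimes> B f g" if "f \<in> carrier F" "r \<in> carrier S" "g \<in> carrier F" for f r g
    unfolding B_def using that fs ij by (intro liftD_smult) (auto simp: F_list_update)
  have B0: "B \<zero>\<^bsub>F\<^esub> g = \<zero>" "B g \<zero>\<^bsub>F\<^esub> = \<zero>" if "g \<in> carrier F" for g
    using Bsm1[of "\<zero>\<^bsub>F\<^esub>" \<zero> g] Bsm2[of g \<zero> "\<zero>\<^bsub>F\<^esub>"] that B_closed by simp_all
  have skew_gen: "B (free_gen S x) (free_gen S y) \<oplus> B (free_gen S y) (free_gen S x) = \<zero>"
    if "x \<in> carrier S" "y \<in> carrier S" for x y
    unfolding B_def by (rule liftD_two_slots[OF fs ij]) (use that in \<open>auto simp: liftD_gen_slots skew[OF _ _ _ _ ij]\<close>)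
  have alt_gen: "B (free_gen S x) (free_gen S x) = \<zero>" if x: "x \<in> carrier S" for x
  proof -
    have "D (xs[i := x, j := x]) = \<zero>" if "length xs = d" "set xs \<subseteq> carrier S" for xs
      by (rule alternating_derivationD(5)[OF D _ _ ij]) (use x that ij in \<open>simp_all add: set_list_update_subset\<close>)
    \<comment> \<open>Zeros in both slots neutralise the second summand of
      \<open>liftD_two_slots\<close>, which then speaks about a single value.\<close>
    moreover have "lift D (gs[i := \<zero>\<^bsub>F\<^esub>, j := \<zero>\<^bsub>F\<^esub>]) = \<zero>" if "length gs = d" "set gs \<subseteq> carrier F" for gs
      using that ij by (intro liftD_zero) (auto simp: F_list_update)
    moreover have "length (map (free_gen S) xs) = d" "set (map (free_gen S) xs) \<subseteq> carrier F"
      if "length xs = d" "set xs \<subseteq> carrier S" for xs using that by auto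
    ultimately have "lift D ((map (free_gen S) xs)[i := free_gen S x, j := free_gen S x]) \<oplus>
        lift D ((map (free_gen S) xs)[i := \<zero>\<^bsub>F\<^esub>, j := \<zero>\<^bsub>F\<^esub>]) = \<zero>"
      if "length xs = d" "set xs \<subseteq> carrier S" for xs
      using that x liftD_gen_slots[OF that x x, of i j] zero_closed l_zero by metis
    then have "lift D (fs[i := free_gen S x, j := free_gen S x]) \<oplus> lift D (fs[i := \<zero>\<^bsub>F\<^esub>, j := \<zero>\<^bsub>F\<^esub>]) = \<zero>"
      by (intro liftD_two_slots[OF fs ij]) (use x in auto)
    then show ?thesis using B_closed B0 x by (simp add: B_def[symmetric])
  qed
  have skew_1: "B f (free_gen S y) \<oplus> B (free_gen S y) f = \<zero>" if f: "f \<in> carrier F" and y: "y \<in> carrier S" for f y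
    using f[unfolded F_def]
  proof (induction f rule: free_module_induct)
    case (add f g)
    then show ?case using y by (simp add: F_def[symmetric] Badd1 Badd2 add_interchange_zero B_closed)
  next
    case (smult r f)
    then show ?case using y by (simp add: F_def[symmetric] Bsm1 Bsm2 r_distr[symmetric] B_closed)
  qed (use y in \<open>auto simp: F_def[symmetric] B0 skew_gen\<close>)
  have skew_2: "B f g \<oplus> B g f = \<zero>" if f: "f \<in> carrier F" and g: "g \<in> carrier F" for f g
    using g[unfolded F_def]
  proof (induction g rule: free_module_induct)
    case (add g h)
    then show ?case using f by (simp add: F_def[symmetric] Badd1 Badd2 add_interchange_zero B_closed)
  next
    case (smult r g)
    then show ?case using f by (simp add: F_def[symmetric] Bsm1 Bsm2 r_distr[symmetric] B_closed)
  qed (use f in \<open>auto simp: F_def[symmetric] B0 skew_1\<close>)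
  have "B f f = \<zero>" if f: "f \<in> carrier F" for f
    using f[unfolded F_def]
  proof (induction f rule: free_module_induct)
    case (add f g)
    then have fg: "f \<in> carrier F" "g \<in> carrier F" "B f f = \<zero>" "B g g = \<zero>" by (auto simp: F_def)
    have "B (f \<oplus>\<^bsub>F\<^esub> g) (f \<oplus>\<^bsub>F\<^esub> g) = (B f f \<oplus> B g f) \<oplus> (B f g \<oplus> B g g)"
      using fg by (simp only: Badd1 Badd2 F.M.a_closed)
    also have "\<dots> = B g f \<oplus> B f g" using fg B_closed by simp
    finally show ?case using skew_2[OF fg(2,1)] by (simp add: F_def)
  next
    case (smult r f)
    then show ?case by (simp add: F_def[symmetric] Bsm1 Bsm2 B_closed)
  qed (auto simp: F_def[symmetric] B0 alt_gen)
  moreover have "fs[i := fs ! i, j := fs ! i] = fs" by (metis eq list_update_id)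
  moreover have "fs ! i \<in> carrier F" using fs ij by (auto simp: subset_iff)
  ultimately show ?thesis unfolding B_def by fastforce
qed

text \<open>The lift of \<open>D\<close> descends to lists of differentials, extends linearly to the
  free module on such lists, and kills the relations of the exterior power. The resulting linear
  form takes the value \<open>D xs\<close> at the wedge of the differentials of \<open>xs\<close>,
  so \<open>D xs\<close> is a trace element with one summand.\<close>

lemma alternating_derivation_value_in_trace:
  assumes xs: "length xs = d" "set xs \<subseteq> carrier S"
  shows "D xs \<in> trace_ideal S (ext_power S d \<Omega>)"
proof -
  interpret G: module S "G d" unfolding G_def by (rule free_module_module)
  \<comment> \<open>The choice of representatives in \<open>\<mu>\<close> is harmless by
    \<open>liftD_cong\<close>.\<close>
  define \<mu> where "\<mu> Xs = lift D (SOME fs. set fs \<subseteq> carrier F \<and> Xs = map cl fs)" for Xs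
  have \<mu>: "\<mu> (map cl fs) = lift D fs" if "length fs = d" "set fs \<subseteq> carrier F" for fs
  proof -
    define gs where "gs = (SOME gs. set gs \<subseteq> carrier F \<and> map cl fs = map cl gs)"
    have gs: "set gs \<subseteq> carrier F \<and> map cl fs = map cl gs"
      unfolding gs_def by (rule someI[of _ fs]) (use that in simp)
    then have "length gs = d" using that map_eq_imp_length_eq by metis
    then have "lift D gs = lift D fs" using gs that by (intro liftD_cong) auto
    then show ?thesis by (simp add: \<mu>_def gs_def)
  qed
  have \<mu>_closed: "\<mu> Xs \<in> carrier S" if "Xs \<in> Y d" for Xs
  proof -
    have X: "set Xs \<subseteq> carrier \<Omega>" "length Xs = d" using that by (auto simp: Y_def)
    obtain fs where "set fs \<subseteq> carrier F" "Xs = map cl fs" "length fs = length Xs"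
      by (rule Omega_list[OF X(1)])
    then show ?thesis using \<mu>[of fs] liftD_closed[of fs] X by simp
  qed
  let ?\<phi> = "lin_ext \<mu>"
  have hom: "?\<phi> \<in> module_hom S (G d) (regular_module S)"
    unfolding G_def by (rule lin_ext_hom) (rule \<mu>_closed)
  have \<phi>_gen: "?\<phi> (free_gen S Xs) = \<mu> Xs" if "Xs \<in> Y d" for Xs
    by (rule lin_ext_gen[OF that]) (rule \<mu>_closed)
  have \<phi>_closed: "?\<phi> h \<in> carrier S" if "h \<in> carrier (G d)" for h
    using hom that by (auto simp: module_hom_def regular_module_def)
  have \<phi>_add: "?\<phi> (h \<oplus>\<^bsub>G d\<^esub> k) = ?\<phi> h \<oplus> ?\<phi> k" if "h \<in> carrier (G d)" "k \<in> carrier (G d)" for h k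
    using hom that by (auto simp: module_hom_def regular_module_def)
  have \<phi>_smult: "?\<phi> (r \<odot>\<^bsub>G d\<^esub> h) = r \<otimes> ?\<phi> h" if "r \<in> carrier S" "h \<in> carrier (G d)" for r h
    using hom that by (auto simp: module_hom_def regular_module_def)
  have \<phi>_zero: "?\<phi> \<zero>\<^bsub>G d\<^esub> = \<zero>"
    using \<phi>_smult[of \<zero> "\<zero>\<^bsub>G d\<^esub>"] \<phi>_closed by simp
  have \<phi>_uminus: "?\<phi> (\<ominus>\<^bsub>G d\<^esub> h) = \<ominus> ?\<phi> h" if "h \<in> carrier (G d)" for h
    using \<phi>_smult[of "\<ominus> \<one>" h] that \<phi>_closed[OF that] by (simp add: G.smult_l_minus l_minus)
  have \<phi>_minus: "?\<phi> (h \<ominus>\<^bsub>G d\<^esub> k) = ?\<phi> h \<ominus> ?\<phi> k" if "h \<in> carrier (G d)" "k \<in> carrier (G d)" for h k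
    using that by (simp add: G.M.minus_eq minus_eq \<phi>_add \<phi>_uminus)
  have rel: "?\<phi> h = \<zero>" if "h \<in> ext_rel d" for h
  proof -
    consider (add) Xs i u v where "Xs \<in> Y d" "i < d" "u \<in> carrier \<Omega>" "v \<in> carrier \<Omega>"
        "h = free_gen S (Xs[i := u \<oplus>\<^bsub>\<Omega>\<^esub> v]) \<ominus>\<^bsub>G d\<^esub> (free_gen S (Xs[i := u]) \<oplus>\<^bsub>G d\<^esub> free_gen S (Xs[i := v]))"
      | (smult) Xs i r u where "Xs \<in> Y d" "i < d" "r \<in> carrier S" "u \<in> carrier \<Omega>"
        "h = free_gen S (Xs[i := r \<odot>\<^bsub>\<Omega>\<^esub> u]) \<ominus>\<^bsub>G d\<^esub> (r \<odot>\<^bsub>G d\<^esub> free_gen S (Xs[i := u]))"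
      | (alt) Xs i j where "Xs \<in> Y d" "h = free_gen S Xs" "i < j" "j < d" "Xs ! i = Xs ! j"
      using \<open>h \<in> ext_rel d\<close> unfolding ext_rel_def by blast
    then show ?thesis
    proof cases
      case add
      have X: "set Xs \<subseteq> carrier \<Omega>" "length Xs = d" using add(1) by (auto simp: Y_def)
      obtain fs where fs: "set fs \<subseteq> carrier F" "Xs = map cl fs" "length fs = length Xs"
        by (rule Omega_list[OF X(1)])
      obtain f g where fg: "f \<in> carrier F" "u = cl f" "g \<in> carrier F" "v = cl g"
        using add(3,4) unfolding Omega_carrier by blast
      have eq: "Xs[i := cl k] = map cl (fs[i := k])" for k using fs by (simp add: map_update)
      have \<mu>u: "\<mu> (map cl (fs[i := k])) = lift D (fs[i := k])" if "k \<in> carrier F" for k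
        using fs X that by (intro \<mu>) (simp_all add: F_list_update)
      have c: "lift D (fs[i := k]) \<in> carrier S" if "k \<in> carrier F" for k
        using fs X that by (intro liftD_closed) (simp_all add: F_list_update)
      have "lift D (fs[i := f \<oplus>\<^bsub>F\<^esub> g]) = lift D (fs[i := f]) \<oplus> lift D (fs[i := g])"
        using fs X fg add(2) by (intro liftD_add) simp_all
      then have "\<mu> (Xs[i := u \<oplus>\<^bsub>\<Omega>\<^esub> v]) = \<mu> (Xs[i := u]) \<oplus> \<mu> (Xs[i := v])"
        using fg by (simp add: cl_add eq \<mu>u)
      then show ?thesis
        using add by (simp add: \<phi>_minus \<phi>_add \<phi>_gen gen_G Y_update Omega_ops \<mu>_closed minus_self)
    next
      case smult
      have X: "set Xs \<subseteq> carrier \<Omega>" "length Xs = d" using smult(1) by (auto simp: Y_def)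
      obtain fs where fs: "set fs \<subseteq> carrier F" "Xs = map cl fs" "length fs = length Xs"
        by (rule Omega_list[OF X(1)])
      obtain f where f: "f \<in> carrier F" "u = cl f"
        using smult(4) unfolding Omega_carrier by blast
      have eq: "Xs[i := cl k] = map cl (fs[i := k])" for k using fs by (simp add: map_update)
      have \<mu>u: "\<mu> (map cl (fs[i := k])) = lift D (fs[i := k])" if "k \<in> carrier F" for k
        using fs X that by (intro \<mu>) (simp_all add: F_list_update)
      have "lift D (fs[i := r \<odot>\<^bsub>F\<^esub> f]) = r \<otimes> lift D (fs[i := f])"
        using fs X f smult(2,3) by (intro liftD_smult) simp_all
      then have "\<mu> (Xs[i := r \<odot>\<^bsub>\<Omega>\<^esub> u]) = r \<otimes> \<mu> (Xs[i := u])"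
        using f smult(3) by (simp add: cl_smult eq \<mu>u)
      then show ?thesis
        using smult by (simp add: \<phi>_minus \<phi>_smult \<phi>_gen gen_G Y_update Omega_ops \<mu>_closed minus_self)
    next
      case alt
      have X: "set Xs \<subseteq> carrier \<Omega>" "length Xs = d" using alt(1) by (auto simp: Y_def)
      obtain fs where fs: "set fs \<subseteq> carrier F" "Xs = map cl fs" "length fs = length Xs"
        and eq: "fs ! i = fs ! j"
      proof (rule Omega_list[OF X(1)])
        fix fs assume "set fs \<subseteq> carrier F" "Xs = map cl fs" "length fs = length Xs"
          and "\<And>i j. i < length Xs \<Longrightarrow> j < length Xs \<Longrightarrow> Xs ! i = Xs ! j \<Longrightarrow> fs ! i = fs ! j"
        then show thesis using alt X by (intro that[of fs]) auto
      qed
      have "lift D fs = \<zero>"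
        by (rule liftD_alternating[OF _ fs(1) alt(3,4)]) (use fs(3) X(2) eq in simp_all)
      moreover have "?\<phi> h = \<mu> Xs" unfolding alt(2) by (rule \<phi>_gen[OF alt(1)])
      moreover have "\<mu> Xs = lift D fs" unfolding fs(2) by (rule \<mu>) (use fs(1,3) X(2) in simp_all)
      ultimately show ?thesis by simp
    qed
  qed
  have "submodule {h \<in> carrier (G d). ?\<phi> h = \<zero>} S (G d)"
    by (rule G.submoduleI) (auto simp: \<phi>_add \<phi>_smult \<phi>_zero \<phi>_uminus)
  then have "E d \<subseteq> {h \<in> carrier (G d). ?\<phi> h = \<zero>}"
    using rel ext_rel_closed by (intro E_min) auto
  then have "?\<phi> h = \<zero>\<^bsub>regular_module S\<^esub>" if "h \<in> E d" for h using that by (auto simp: regular_module_def)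
  then obtain g where g: "g \<in> module_hom S (quot_module S (G d) (E d)) (regular_module S)"
      "\<And>h. h \<in> carrier (G d) \<Longrightarrow> g (E d +>\<^bsub>G d\<^esub> h) = ?\<phi> h"
    using G.quot_module_hom_ext[OF E_submodule hom _ regular_module_abelian_group] by blast
  define Z where "Z = E d +>\<^bsub>G d\<^esub> free_gen S (map d_map xs)"
  have mY: "map d_map xs \<in> Y d" using xs by (auto simp: Y_def d_map_props(1))
  have dm: "map d_map xs = map cl (map (free_gen S) xs)" by (simp add: d_map_def)
  have "g Z = D xs"
    unfolding Z_def using mY g(2) xs \<mu>[of "map (free_gen S) xs"] liftD_gen[OF xs] gens_F[OF xs(2)]
    by (simp only: gen_G \<phi>_gen dm length_map)
  moreover have "Z \<in> carrier (quot_module S (G d) (E d))"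
    using mY G.quot_carrier_iff gen_G unfolding Z_def by blast
  moreover have "finsum S (\<lambda>i. g Z) {..<Suc 0} = g Z"
    using \<open>g Z = D xs\<close> alternating_derivationD(1)[OF D xs] by (simp add: lessThan_Suc)
  ultimately show ?thesis
    unfolding trace_ideal_def ext_power_eq using g(1)
    by (auto intro!: exI[of _ "Suc 0"] exI[of _ "\<lambda>_. g"] exI[of _ "\<lambda>_. Z"])
qed

end

text \<open>Evaluating a linear form at wedges of \<open>d_map\<close> values gives one alternating
  derivation \<open>D\<close>. Since the elements \<open>d_map x\<close> generate the differentials
  and the wedges generate the exterior power, every value of the form is a combination of values of
  \<open>D\<close>.\<close>

lemma hom_values_in_derivation_ideal:
  assumes f: "f \<in> module_hom S (ext_power S d \<Omega>) (regular_module S)"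
    and C: "C \<in> carrier (ext_power S d \<Omega>)"
  shows "f C \<in> derivation_ideal K S \<iota> d"
proof -
  interpret G: module S "G d" unfolding G_def by (rule free_module_module)
  let ?Q = "quot_module S (G d) (E d)"
  define w where "w h = E d +>\<^bsub>G d\<^esub> h" for h
  define \<psi> where "\<psi> h = f (w h)" for h
  define \<mu> where "\<mu> Xs = \<psi> (free_gen S Xs)" for Xs
  have w_closed: "w h \<in> carrier ?Q" if "h \<in> carrier (G d)" for h
    using that unfolding w_def G.quot_carrier_iff by blast
  have \<psi>_closed: "\<psi> h \<in> carrier S" if "h \<in> carrier (G d)" for h
    using f w_closed[OF that] by (auto simp: \<psi>_def module_hom_def regular_module_def ext_power_eq)
  have \<psi>_add: "\<psi> (h \<oplus>\<^bsub>G d\<^esub> k) = \<psi> h \<oplus> \<psi> k" if "h \<in> carrier (G d)" "k \<in> carrier (G d)" for h k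
  proof -
    have "f (w h \<oplus>\<^bsub>?Q\<^esub> w k) = f (w h) \<oplus> f (w k)"
      using f w_closed that by (auto simp: module_hom_def regular_module_def ext_power_eq)
    then show ?thesis unfolding \<psi>_def w_def using G.quot_add[OF E_submodule that] by simp
  qed
  have \<psi>_smult: "\<psi> (r \<odot>\<^bsub>G d\<^esub> h) = r \<otimes> \<psi> h" if "r \<in> carrier S" "h \<in> carrier (G d)" for r h
  proof -
    have "f (r \<odot>\<^bsub>?Q\<^esub> w h) = r \<otimes> f (w h)"
      using f w_closed that by (auto simp: module_hom_def regular_module_def ext_power_eq)
    then show ?thesis unfolding \<psi>_def w_def using G.quot_smult[OF E_submodule that] by simp
  qed
  have \<psi>_zero: "\<psi> \<zero>\<^bsub>G d\<^esub> = \<zero>"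
    using \<psi>_smult[of \<zero> "\<zero>\<^bsub>G d\<^esub>"] \<psi>_closed by simp
  have \<psi>_rel: "\<psi> h = \<psi> k" if "h \<ominus>\<^bsub>G d\<^esub> k \<in> ext_rel d" "h \<in> carrier (G d)" "k \<in> carrier (G d)" for h k
    using that E_incl G.quot_eq_iff[OF E_submodule that(2,3)] unfolding \<psi>_def w_def by auto
  have \<mu>_closed: "\<mu> Xs \<in> carrier S" if "Xs \<in> Y d" for Xs
    unfolding \<mu>_def using that by (intro \<psi>_closed gen_G)
  have \<mu>_add: "\<mu> (Xs[i := u \<oplus>\<^bsub>\<Omega>\<^esub> v]) = \<mu> (Xs[i := u]) \<oplus> \<mu> (Xs[i := v])"
    if "Xs \<in> Y d" "i < d" "u \<in> carrier \<Omega>" "v \<in> carrier \<Omega>" for Xs i u v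
  proof -
    have "\<psi> (free_gen S (Xs[i := u \<oplus>\<^bsub>\<Omega>\<^esub> v])) = \<psi> (free_gen S (Xs[i := u]) \<oplus>\<^bsub>G d\<^esub> free_gen S (Xs[i := v]))"
    proof (rule \<psi>_rel)
      show "free_gen S (Xs[i := u \<oplus>\<^bsub>\<Omega>\<^esub> v]) \<ominus>\<^bsub>G d\<^esub> (free_gen S (Xs[i := u]) \<oplus>\<^bsub>G d\<^esub> free_gen S (Xs[i := v])) \<in> ext_rel d"
        unfolding ext_rel_def using that by blast
    qed (use that in \<open>simp_all add: gen_G Y_update Omega_ops\<close>)
    then show ?thesis using that by (simp add: \<mu>_def \<psi>_add gen_G Y_update)
  qed
  have \<mu>_smult: "\<mu> (Xs[i := r \<odot>\<^bsub>\<Omega>\<^esub> u]) = r \<otimes> \<mu> (Xs[i := u])"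
    if "Xs \<in> Y d" "i < d" "r \<in> carrier S" "u \<in> carrier \<Omega>" for Xs i r u
  proof -
    have "\<psi> (free_gen S (Xs[i := r \<odot>\<^bsub>\<Omega>\<^esub> u])) = \<psi> (r \<odot>\<^bsub>G d\<^esub> free_gen S (Xs[i := u]))"
    proof (rule \<psi>_rel)
      show "free_gen S (Xs[i := r \<odot>\<^bsub>\<Omega>\<^esub> u]) \<ominus>\<^bsub>G d\<^esub> (r \<odot>\<^bsub>G d\<^esub> free_gen S (Xs[i := u])) \<in> ext_rel d"
        unfolding ext_rel_def using that by blast
    qed (use that in \<open>simp_all add: gen_G Y_update Omega_ops\<close>)
    then show ?thesis using that by (simp add: \<mu>_def \<psi>_smult gen_G Y_update)
  qed
  have \<mu>_alt: "\<mu> Xs = \<zero>" if "Xs \<in> Y d" "i < j" "j < d" "Xs ! i = Xs ! j" for Xs i j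
  proof -
    have "free_gen S Xs \<in> ext_rel d" unfolding ext_rel_def using that by blast
    moreover have "free_gen S Xs \<ominus>\<^bsub>G d\<^esub> \<zero>\<^bsub>G d\<^esub> = free_gen S Xs"
      using G.M.r_neg[OF G.M.zero_closed] G.M.l_zero[OF G.M.a_inv_closed[OF G.M.zero_closed]] gen_G[OF that(1)]
      by (simp add: G.M.minus_eq)
    ultimately have "\<psi> (free_gen S Xs) = \<psi> \<zero>\<^bsub>G d\<^esub>"
      using gen_G[OF that(1)] by (intro \<psi>_rel) simp_all
    then show ?thesis by (simp add: \<mu>_def \<psi>_zero)
  qed
  define D where "D xs = \<mu> (map d_map xs)" for xs
  have mY: "map d_map xs \<in> Y d" if "length xs = d" "set xs \<subseteq> carrier S" for xs
    using that by (auto simp: Y_def d_map_props(1))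
  have D: "alternating_derivation K S \<iota> d D"
    unfolding alternating_derivation_def
  proof (intro allI impI, elim conjE, intro conjI allI impI ballI)
    fix xs assume xs: "length xs = d" "set xs \<subseteq> carrier S"
    note m = mY[OF xs]
    show "D xs \<in> carrier S" unfolding D_def by (rule \<mu>_closed[OF m])
    fix i assume i: "i < d"
    show "D (xs[i := \<iota> c]) = \<zero>" if c: "c \<in> carrier K" for c
      using m i c incl_closed[OF c] d_map_props(4)[of \<zero> \<zero> c] \<mu>_closed[OF Y_update[OF m]]
      by (simp add: D_def map_update \<mu>_smult d_map_props(1))
    fix x y assume xy: "x \<in> carrier S" "y \<in> carrier S"
    note dx = d_map_props(1)[OF xy] d_map_props(1)[OF xy(2,1)]
    show "D (xs[i := x \<oplus> y]) = D (xs[i := x]) \<oplus> D (xs[i := y])"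
      using m i dx xy by (simp add: D_def map_update d_map_props(2) \<mu>_add)
    show "D (xs[i := x \<otimes> y]) = x \<otimes> D (xs[i := y]) \<oplus> y \<otimes> D (xs[i := x])"
      using m i dx xy by (simp add: D_def map_update d_map_props(3) \<mu>_add \<mu>_smult Omega_ops)
  next
    fix xs i j assume xs: "length xs = d" "set xs \<subseteq> carrier S" and ij: "i < j \<and> j < d \<and> xs ! i = xs ! j"
    then show "D xs = \<zero>" unfolding D_def by (intro \<mu>_alt[OF mY[OF xs], of i j]) auto
  qed
  let ?V = "{D xs | D xs. alternating_derivation K S \<iota> d D \<and> length xs = d \<and> set xs \<subseteq> carrier S}"
  have V: "?V \<subseteq> carrier S" using alternating_derivationD(1) by blast
  interpret I: ideal "derivation_ideal K S \<iota> d" S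
    unfolding derivation_ideal_def by (rule genideal_ideal[OF V])
  have D_in: "D xs \<in> derivation_ideal K S \<iota> d" if "length xs = d" "set xs \<subseteq> carrier S" for xs
    unfolding derivation_ideal_def using genideal_self[OF V] D that by blast
  \<comment> \<open>A wedge of arbitrary differentials is expanded into wedges of generators
    \<open>d_map x\<close>; on these \<open>\<mu>\<close> agrees with \<open>D\<close>.\<close>
  have \<mu>_in: "\<mu> Xs \<in> derivation_ideal K S \<iota> d" if "Xs \<in> Y d" for Xs
  proof -
    have X: "set Xs \<subseteq> carrier \<Omega>" "length Xs = d" using that by (auto simp: Y_def)
    obtain fs where fs: "set fs \<subseteq> carrier F" "Xs = map cl fs" "length fs = length Xs"
      by (rule Omega_list[OF X(1)])
    have "carrier S \<noteq> {}" by blast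
    moreover have "length fs = d" using fs X by simp
    ultimately have "\<mu> (map cl fs) \<in> derivation_ideal K S \<iota> d"
      using fs(1)[unfolded F_def]
    proof (induction fs rule: free_list_induct)
      case (add gs i f g)
      then have "map cl gs \<in> Y d" by (auto simp: Y_def F_def[symmetric] intro: cl_closed)
      then have "\<mu> ((map cl gs)[i := cl f \<oplus>\<^bsub>\<Omega>\<^esub> cl g]) = \<mu> (map cl (gs[i := f])) \<oplus> \<mu> (map cl (gs[i := g]))"
        using add by (simp add: \<mu>_add F_def[symmetric] cl_closed map_update)
      then show ?case using add by (simp add: cl_add F_def[symmetric] map_update)
    next
      case (smult gs i r f)
      then have "map cl gs \<in> Y d" by (auto simp: Y_def F_def[symmetric] intro: cl_closed)
      then have "\<mu> ((map cl gs)[i := r \<odot>\<^bsub>\<Omega>\<^esub> cl f]) = r \<otimes> \<mu> (map cl (gs[i := f]))"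
        using smult by (simp add: \<mu>_smult F_def[symmetric] cl_closed map_update)
      then show ?case using smult I.I_l_closed by (simp add: cl_smult F_def[symmetric] map_update)
    next
      case (gen xs)
      have "map cl (map (free_gen S) xs) = map d_map xs" by (simp add: d_map_def)
      then show ?case using D_in[OF gen] by (simp only: D_def)
    qed
    then show ?thesis using fs by simp
  qed
  have "\<psi> h \<in> derivation_ideal K S \<iota> d" if "h \<in> carrier (G d)" for h
    using that[unfolded G_def]
  proof (induction h rule: free_module_induct)
    case (gen Xs)
    then show ?case using \<mu>_in by (simp add: \<mu>_def)
  qed (auto simp: G_def[symmetric] \<psi>_zero \<psi>_add \<psi>_smult I.I_l_closed)
  moreover obtain h where "h \<in> carrier (G d)" "C = w h"
    using C unfolding ext_power_eq G.quot_carrier_iff w_def by blast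
  ultimately show ?thesis by (simp add: \<psi>_def)
qed

theorem trace_ideal_ext_power_kaehler:
  "trace_ideal S (ext_power S d (kaehler K S \<iota>)) = derivation_ideal K S \<iota> d"
proof
  show "trace_ideal S (ext_power S d (kaehler K S \<iota>)) \<subseteq> derivation_ideal K S \<iota> d"
    unfolding \<Omega>_def[symmetric]
  proof
    fix z assume "z \<in> trace_ideal S (ext_power S d \<Omega>)"
    then obtain n f x where z: "z = finsum S (\<lambda>i. f i (x i)) {..<n::nat}"
      and fx: "\<forall>i<n. f i \<in> module_hom S (ext_power S d \<Omega>) (regular_module S) \<and> x i \<in> carrier (ext_power S d \<Omega>)"
      unfolding trace_ideal_def by blast
    have "{D xs | D xs. alternating_derivation K S \<iota> d D \<and> length xs = d \<and> set xs \<subseteq> carrier S} \<subseteq> carrier S"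
      using alternating_derivationD(1) by blast
    then interpret I: ideal "derivation_ideal K S \<iota> d" S
      unfolding derivation_ideal_def by (rule genideal_ideal)
    have "f i (x i) \<in> derivation_ideal K S \<iota> d" if "i < n" for i
      using fx that by (intro hom_values_in_derivation_ideal) auto
    then show "z \<in> derivation_ideal K S \<iota> d"
      unfolding z by (intro ideal_finsum[OF I.ideal_axioms]) auto
  qed
  show "derivation_ideal K S \<iota> d \<subseteq> trace_ideal S (ext_power S d (kaehler K S \<iota>))"
    unfolding \<Omega>_def[symmetric] derivation_ideal_def
    using alternating_derivation_value_in_trace by (intro genideal_minimal[OF trace_ideal_is_ideal]) blast
qed

end

section \<open>Derivations and algebraic dependence\<close>

context cring
begin

section \<open>The Frobenius map in prime characteristic\<close>

abbreviation nat_elem :: "nat \<Rightarrow> 'a" where "nat_elem n \<equiv> [n] \<cdot> \<one>"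

lemma nat_elem_add: "nat_elem (m + n) = nat_elem m \<oplus> nat_elem n"
  by (simp add: add.nat_pow_mult)

lemma nat_elem_mult: "nat_elem (m * n) = nat_elem m \<otimes> nat_elem n"
proof (induction m)
  case (Suc m)
  have "nat_elem (Suc m * n) = nat_elem n \<oplus> nat_elem m \<otimes> nat_elem n"
    using Suc by (simp only: mult_Suc nat_elem_add)
  also have "\<dots> = (nat_elem m \<oplus> \<one>) \<otimes> nat_elem n" by (simp add: l_distr a_comm)
  finally show ?case by simp
qed simp

lemma binomial_expansion:
  assumes x: "x \<in> carrier R" and y: "y \<in> carrier R"
  shows "(x \<oplus> y) [^] (n::nat) = (\<Oplus>k\<in>{..n}. nat_elem (n choose k) \<otimes> (x [^] k \<otimes> y [^] (n - k)))"
proof (induction n)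
  case 0
  then show ?case by simp
next
  case (Suc n)
  define t where "t n k = nat_elem (n choose k) \<otimes> (x [^] k \<otimes> y [^] (n - k))" for n k
  have t_closed: "t n k \<in> carrier R" for n k using x y by (simp add: t_def)
  \<comment> \<open>For the index \<open>Suc n\<close> the exponent \<open>n - Suc n\<close> of
    \<open>y\<close> is truncated to zero; the vanishing binomial coefficient makes that term
    correct all the same.\<close>
  have "n choose Suc n = 0" by (rule binomial_eq_0) simp
  then have c0: "nat_elem (n choose Suc n) = \<zero>" by (simp only: add.nat_pow_0)
  have t_Suc: "t (Suc n) (Suc k) = x \<otimes> t n k \<oplus> y \<otimes> t n (Suc k)" if "k \<le> n" for k
  proof -
    have 1: "nat_elem (n choose k) \<otimes> (x [^] Suc k \<otimes> y [^] (n - k)) = x \<otimes> t n k"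
      using x y by (simp add: t_def m_ac)
    have 2: "nat_elem (n choose Suc k) \<otimes> (x [^] Suc k \<otimes> y [^] (n - k)) = y \<otimes> t n (Suc k)"
    proof (cases "k = n")
      case True
      then show ?thesis using x y c0 by (simp add: t_def del: nat_pow_Suc)
    next
      case False
      then have "n - k = Suc (n - Suc k)" using that by simp
      then have "y [^] (n - k) = y [^] (n - Suc k) \<otimes> y" by (simp only: nat_pow_Suc)
      then show ?thesis using x y by (simp add: t_def m_ac)
    qed
    have "t (Suc n) (Suc k) = (nat_elem (n choose k) \<oplus> nat_elem (n choose Suc k)) \<otimes> (x [^] Suc k \<otimes> y [^] (n - k))"
      by (simp only: t_def binomial_Suc_Suc nat_elem_add diff_Suc_Suc)
    also have "\<dots> = x \<otimes> t n k \<oplus> y \<otimes> t n (Suc k)"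
      using x y by (simp only: l_distr 1 2 nat_pow_closed m_closed add.nat_pow_closed one_closed)
    finally show ?thesis .
  qed
  have t0: "t (Suc n) 0 = y \<otimes> t n 0" using y by (simp add: t_def m_comm)
  have tn: "t n (Suc n) = \<zero>" using x y c0 by (simp add: t_def del: nat_pow_Suc)
  define S0 where "S0 = (\<Oplus>k\<in>{..n}. t n k)"
  define S1 where "S1 = (\<Oplus>k\<in>{..n}. t n (Suc k))"
  have S_closed: "S0 \<in> carrier R" "S1 \<in> carrier R" unfolding S0_def S1_def by (rule finsum_closed, use t_closed in blast)+
  have "(\<Oplus>k\<in>{..Suc n}. t (Suc n) k) = (\<Oplus>k\<in>{..n}. t (Suc n) (Suc k)) \<oplus> t (Suc n) 0"
    by (rule finsum_Suc2) (use t_closed in auto)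
  also have "(\<Oplus>k\<in>{..n}. t (Suc n) (Suc k)) = (\<Oplus>k\<in>{..n}. x \<otimes> t n k \<oplus> y \<otimes> t n (Suc k))"
    by (rule finsum_cong') (use t_closed x y in \<open>auto simp: t_Suc\<close>)
  also have "\<dots> = (\<Oplus>k\<in>{..n}. x \<otimes> t n k) \<oplus> (\<Oplus>k\<in>{..n}. y \<otimes> t n (Suc k))"
    by (rule finsum_addf) (use x y t_closed in auto)
  also have "(\<Oplus>k\<in>{..n}. x \<otimes> t n k) = x \<otimes> S0"
    unfolding S0_def by (rule finsum_rdistr[symmetric]) (use x t_closed in auto)
  also have "(\<Oplus>k\<in>{..n}. y \<otimes> t n (Suc k)) = y \<otimes> S1"
    unfolding S1_def by (rule finsum_rdistr[symmetric]) (use y t_closed in auto)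
  also have "x \<otimes> S0 \<oplus> y \<otimes> S1 \<oplus> t (Suc n) 0 = x \<otimes> S0 \<oplus> y \<otimes> (S1 \<oplus> t n 0)"
    using x y t_closed S_closed by (simp add: t0 a_assoc r_distr)
  also have "S1 \<oplus> t n 0 = (\<Oplus>k\<in>{..Suc n}. t n k)"
    unfolding S1_def by (rule finsum_Suc2[symmetric]) (use t_closed in auto)
  also have "\<dots> = t n (Suc n) \<oplus> S0"
    unfolding S0_def by (rule finsum_Suc) (use t_closed in auto)
  also have "\<dots> = S0" using S_closed tn by simp
  also have "x \<otimes> S0 \<oplus> y \<otimes> S0 = (x \<oplus> y) \<otimes> S0" using S_closed x y by (simp add: l_distr)
  also have "\<dots> = (x \<oplus> y) [^] Suc n" using Suc S_closed x y by (simp add: S0_def t_def m_comm)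
  finally show ?case by (simp only: t_def)
qed

text \<open>The prime \<open>p\<close> divides all inner binomial coefficients, so only the two
  outer terms of the binomial expansion survive.\<close>

lemma frobenius_add:
  assumes p: "Factorial_Ring.prime p" "nat_elem p = \<zero>" and x: "x \<in> carrier R" and y: "y \<in> carrier R"
  shows "(x \<oplus> y) [^] p = x [^] p \<oplus> y [^] p"
proof -
  define t where "t k = nat_elem (p choose k) \<otimes> (x [^] k \<otimes> y [^] (p - k))" for k
  have t_closed: "t k \<in> carrier R" for k using x y by (simp add: t_def)
  have p0: "p > 0" using p(1) by (simp add: prime_gt_0_nat)
  have t0: "t k = \<zero>" if "0 < k" "k < p" for k
  proof -
    have "p dvd p choose k"
      using p(1) that by (intro dvd_choose_prime) auto
    then obtain q where "p choose k = p * q" by auto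
    then have "nat_elem (p choose k) = \<zero>" by (simp add: nat_elem_mult p(2))
    then show ?thesis using x y by (simp add: t_def)
  qed
  have "(x \<oplus> y) [^] p = (\<Oplus>k\<in>{..p}. t k)"
    using binomial_expansion[OF x y] by (simp add: t_def)
  also have "\<dots> = (\<Oplus>k\<in>{0, p}. t k)"
    by (rule add.finprod_mono_neutral_cong_right) (use t0 t_closed in auto)
  also have "\<dots> = t 0 \<oplus> t p" using p0 t_closed by (subst finsum_insert) auto
  finally show ?thesis using x y by (simp add: t_def a_comm)
qed

lemma frobenius_finsum:
  assumes p: "Factorial_Ring.prime p" "nat_elem p = \<zero>" and "finite A" "f \<in> A \<rightarrow> carrier R"
  shows "(\<Oplus>i\<in>A. f i) [^] p = (\<Oplus>i\<in>A. f i [^] p)"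
  using assms(3,4)
proof (induction A rule: finite_induct)
  case empty
  then show ?case using p(1) prime_gt_0_nat[of p] by (cases p) auto
next
  case (insert a A)
  have "(\<Oplus>i\<in>insert a A. f i) [^] p = (f a \<oplus> (\<Oplus>i\<in>A. f i)) [^] p"
    using insert by (subst finsum_insert) auto
  also have "\<dots> = f a [^] p \<oplus> (\<Oplus>i\<in>A. f i) [^] p"
    by (rule frobenius_add[OF p]) (use insert in auto)
  also have "\<dots> = (\<Oplus>i\<in>insert a A. f i [^] p)"
    using insert by (subst finsum_insert) auto
  finally show ?case .
qed

section \<open>Derivations that vanish on a subfield\<close>

definition derivation :: "'a set \<Rightarrow> ('a \<Rightarrow> 'a) \<Rightarrow> bool" where
  "derivation H \<delta> \<longleftrightarrow> \<delta> \<in> carrier R \<rightarrow> carrier R \<and>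
     (\<forall>x\<in>carrier R. \<forall>y\<in>carrier R. \<delta> (x \<oplus> y) = \<delta> x \<oplus> \<delta> y \<and> \<delta> (x \<otimes> y) = x \<otimes> \<delta> y \<oplus> y \<otimes> \<delta> x) \<and>
     (\<forall>c\<in>H. \<delta> c = \<zero>)"

context
  fixes H \<delta> assumes \<delta>: "derivation H \<delta>" and H: "subfield H R"
begin

lemma der_closed [simp]: "x \<in> carrier R \<Longrightarrow> \<delta> x \<in> carrier R"
  using \<delta> by (auto simp: derivation_def)

lemma der_add: "x \<in> carrier R \<Longrightarrow> y \<in> carrier R \<Longrightarrow> \<delta> (x \<oplus> y) = \<delta> x \<oplus> \<delta> y"
  using \<delta> by (auto simp: derivation_def)

lemma der_mult: "x \<in> carrier R \<Longrightarrow> y \<in> carrier R \<Longrightarrow> \<delta> (x \<otimes> y) = x \<otimes> \<delta> y \<oplus> y \<otimes> \<delta> x"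
  using \<delta> by (auto simp: derivation_def)

lemma der_const: "c \<in> H \<Longrightarrow> \<delta> c = \<zero>"
  using \<delta> by (auto simp: derivation_def)

lemma H_sub: "H \<subseteq> carrier R" "\<one> \<in> H" "\<zero> \<in> H"
  using subfieldE(3)[OF H] subringE(2,3)[OF subfieldE(1)[OF H]] by simp_all

text \<open>For \<open>n = 0\<close> the exponent \<open>n - 1\<close> is truncated to zero, but the
  coefficient is zero as well.\<close>

lemma der_pow: "x \<in> carrier R \<Longrightarrow> \<delta> (x [^] (n::nat)) = nat_elem n \<otimes> (x [^] (n - 1) \<otimes> \<delta> x)"
proof (induction n)
  case 0
  then show ?case using der_const H_sub by simp
next
  case (Suc n)
  show ?case
  proof (cases n)
    case 0
    then show ?thesis using Suc.prems by simp
  next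
    case (Suc m)
    then have "x \<otimes> (nat_elem n \<otimes> (x [^] (n - 1) \<otimes> \<delta> x)) = nat_elem n \<otimes> (x [^] n \<otimes> \<delta> x)"
      using Suc.prems by (simp add: m_ac)
    moreover have "\<delta> (x [^] Suc n) = x [^] n \<otimes> \<delta> x \<oplus> x \<otimes> (nat_elem n \<otimes> (x [^] (n - 1) \<otimes> \<delta> x))"
      using Suc.IH Suc.prems by (simp add: der_mult)
    ultimately show ?thesis using Suc.prems by (simp add: l_distr a_comm)
  qed
qed

lemma der_finprod_zero:
  assumes "finite A" "f \<in> A \<rightarrow> carrier R" "\<And>i. i \<in> A \<Longrightarrow> \<delta> (f i) = \<zero>"
  shows "\<delta> (\<Otimes>i\<in>A. f i) = \<zero>"
  using assms
proof (induction A rule: finite_induct)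
  case empty
  then show ?case using der_const H_sub by simp
next
  case (insert a A)
  then show ?case by (subst finprod_insert) (auto simp: der_mult)
qed

lemma der_finsum:
  assumes "finite A" "f \<in> A \<rightarrow> carrier R"
  shows "\<delta> (\<Oplus>i\<in>A. f i) = (\<Oplus>i\<in>A. \<delta> (f i))"
  using assms
proof (induction A rule: finite_induct)
  case empty
  then show ?case using der_const H_sub by simp
next
  case (insert a A)
  then have "(\<lambda>i. \<delta> (f i)) \<in> insert a A \<rightarrow> carrier R" by (auto simp: Pi_iff)
  with insert show ?case by (auto simp: der_add)
qed

end


section \<open>Monomials and their derivatives\<close>

text \<open>Exponents are total functions of which only the values below \<open>d\<close> enter.
  Relations are therefore indexed by exponents that vanish from \<open>d\<close> on, so that each
  exponent vector is represented by one function.\<close>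

definition monomial :: "nat \<Rightarrow> (nat \<Rightarrow> 'a) \<Rightarrow> (nat \<Rightarrow> nat) \<Rightarrow> 'a" where
  "monomial d a \<beta> = (\<Otimes>i\<in>{..<d}. a i [^] \<beta> i)"

lemma monomial_closed [simp]: "(\<And>i. i < d \<Longrightarrow> a i \<in> carrier R) \<Longrightarrow> monomial d a \<beta> \<in> carrier R"
  unfolding monomial_def by (rule finprod_closed) auto

lemma finprod_pow:
  assumes "finite A" "f \<in> A \<rightarrow> carrier R"
  shows "(\<Otimes>i\<in>A. f i) [^] (n::nat) = (\<Otimes>i\<in>A. f i [^] n)"
  using assms
proof (induction A rule: finite_induct)
  case (insert a A)
  have c: "f a \<in> carrier R" "finprod R f A \<in> carrier R" using insert.prems by auto
  have "(\<lambda>i. f i [^] n) \<in> A \<rightarrow> carrier R" using insert.prems by auto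
  then show ?case
    using insert c by (simp add: nat_pow_distrib)
qed simp

lemma monomial_pow:
  assumes "\<And>i. i < d \<Longrightarrow> a i \<in> carrier R"
  shows "monomial d a \<beta> [^] (p::nat) = monomial d a (\<lambda>i. p * \<beta> i)"
proof -
  have "monomial d a \<beta> [^] p = (\<Otimes>i\<in>{..<d}. (a i [^] \<beta> i) [^] p)"
    unfolding monomial_def by (rule finprod_pow) (use assms in auto)
  also have "\<dots> = monomial d a (\<lambda>i. p * \<beta> i)"
    unfolding monomial_def by (rule finprod_cong') (use assms in \<open>auto simp: nat_pow_pow mult.commute\<close>)
  finally show ?thesis .
qed

lemma monomial_split:
  assumes "\<And>i. i < d \<Longrightarrow> a i \<in> carrier R" "i < d"
  shows "monomial d a \<beta> = a i [^] \<beta> i \<otimes> (\<Otimes>j\<in>{..<d} - {i}. a j [^] \<beta> j)"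
proof -
  have "{..<d} = insert i ({..<d} - {i})" using assms by auto
  then have "monomial d a \<beta> = (\<Otimes>j\<in>insert i ({..<d} - {i}). a j [^] \<beta> j)"
    unfolding monomial_def by simp
  also have "\<dots> = a i [^] \<beta> i \<otimes> (\<Otimes>j\<in>{..<d} - {i}. a j [^] \<beta> j)"
    by (rule finprod_insert) (use assms in auto)
  finally show ?thesis .
qed

text \<open>If \<open>\<delta>\<close> maps \<open>a i\<close> to \<open>u\<close> and the other
  \<open>a j\<close> to zero, then it acts on monomials as \<open>u\<close> times the partial
  derivative in the variable \<open>i\<close>. For \<open>\<beta> i = 0\<close> the truncated
  exponent is harmless, as the coefficient vanishes.\<close>

lemma der_monomial:
  assumes H: "subfield H R" and \<delta>: "derivation H \<delta>" and a: "\<And>i. i < d \<Longrightarrow> a i \<in> carrier R" and i: "i < d"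
    and u: "u \<in> carrier R" and \<delta>_a: "\<And>j. j < d \<Longrightarrow> \<delta> (a j) = (if i = j then u else \<zero>)"
  shows "\<delta> (monomial d a \<beta>) = u \<otimes> (nat_elem (\<beta> i) \<otimes> monomial d a (\<beta>(i := \<beta> i - 1)))"
proof -
  let ?r = "\<Otimes>j\<in>{..<d} - {i}. a j [^] \<beta> j"
  have r: "?r \<in> carrier R" by (rule finprod_closed) (use a in auto)
  have "\<delta> ?r = \<zero>"
    by (rule der_finprod_zero[OF \<delta> H]) (use a \<delta>_a in \<open>auto simp: der_pow[OF \<delta> H]\<close>)
  moreover have "\<delta> (a i [^] \<beta> i) = nat_elem (\<beta> i) \<otimes> (a i [^] (\<beta> i - 1) \<otimes> u)"
    using der_pow[OF \<delta> H a[OF i], of "\<beta> i"] \<delta>_a[OF i] by simp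
  moreover have "(\<Otimes>j\<in>{..<d} - {i}. a j [^] (\<beta>(i := \<beta> i - 1)) j) = ?r"
    by (rule finprod_cong') (use a in auto)
  then have "monomial d a (\<beta>(i := \<beta> i - 1)) = a i [^] (\<beta> i - 1) \<otimes> ?r"
    using monomial_split[where a = a and d = d and i = i and \<beta> = "\<beta>(i := \<beta> i - 1)", OF a i] by simp
  moreover have "monomial d a \<beta> = a i [^] \<beta> i \<otimes> ?r" by (rule monomial_split[OF a i])
  ultimately show ?thesis
    using der_mult[OF \<delta> H, of "a i [^] \<beta> i" ?r] a[OF i] r u by (simp add: m_ac)
qed

lemma reduced_pow_zero: "reduced_ring R \<Longrightarrow> x \<in> carrier R \<Longrightarrow> x [^] (n::nat) = \<zero> \<Longrightarrow> x = \<zero>"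
  unfolding reduced_ring_def by blast

lemma subfield_nat_elem: "subfield H R \<Longrightarrow> nat_elem n \<in> H"
proof (induction n)
  case 0
  then show ?case using subringE(2)[OF subfieldE(1)] by simp
next
  case (Suc n)
  then show ?case using subringE(3,7)[OF subfieldE(1)[OF Suc.prems]] by simp
qed

text \<open>The characteristic as the least positive \<open>n\<close> whose multiple of one
  vanishes. Division with remainder shows that it divides every other such \<open>n\<close>, and the
  absence of zero divisors in \<open>H\<close> makes it prime.\<close>

lemma subfield_char:
  assumes H: "subfield H R" and n: "n > 0" "nat_elem n = \<zero>"
  obtains p where "Factorial_Ring.prime p" "nat_elem p = \<zero>" "\<forall>m. nat_elem m = \<zero> \<longrightarrow> p dvd m"
proof
  define p where "p = (LEAST n. n > 0 \<and> nat_elem n = \<zero>)"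
  have p: "p > 0" "nat_elem p = \<zero>" using LeastI[of "\<lambda>n. n > 0 \<and> nat_elem n = \<zero>" n] n by (auto simp: p_def)
  have le: "p \<le> m" if "m > 0" "nat_elem m = \<zero>" for m
    unfolding p_def by (rule Least_le) (use that in simp)
  show "nat_elem p = \<zero>" by fact
  have dvd: "p dvd m" if m: "nat_elem m = \<zero>" for m
  proof -
    have "nat_elem (m div p * p + m mod p) = nat_elem (m div p) \<otimes> nat_elem p \<oplus> nat_elem (m mod p)"
      by (simp only: nat_elem_add nat_elem_mult)
    then have "nat_elem (m mod p) = \<zero>" using m p(2) by simp
    then have "m mod p = 0" using le[of "m mod p"] p(1) by (metis mod_less_divisor not_gr_zero not_less)
    then show ?thesis by auto
  qed
  then show "\<forall>m. nat_elem m = \<zero> \<longrightarrow> p dvd m" by blast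
  have p1: "p \<noteq> 1"
    using p(2) subfieldE(6)[OF H] by auto
  show "Factorial_Ring.prime p"
  proof (rule prime_natI)
    show "p \<ge> 2" using p(1) p1 by simp
    fix x y assume "p dvd x * y"
    then have "nat_elem x \<otimes> nat_elem y = \<zero>"
      using p(2) by (auto elim!: dvdE simp: nat_elem_mult[symmetric]) (simp add: nat_elem_mult)
    then show "p dvd x \<or> p dvd y"
      using subfieldE(5)[OF H subfield_nat_elem[OF H] subfield_nat_elem[OF H]] dvd by blast
  qed
qed

text \<open>Induction on a degree bound for the relation: formal partial derivatives of a relation are again
  relations, and a relation all of whose partial derivatives vanish is a \<open>p\<close>-th power.\<close>

lemma derivation_value_zero_of_relation:
  assumes H: "subfield H R" and red: "reduced_ring R"
    and perf: "\<And>p x. Factorial_Ring.prime p \<Longrightarrow> nat_elem p = \<zero> \<Longrightarrow> x \<in> H \<Longrightarrow> \<exists>y\<in>H. y [^] p = x"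
    and a: "\<And>i. i < d \<Longrightarrow> a i \<in> carrier R" and u: "u \<in> carrier R"
    and \<delta>: "\<And>i. i < d \<Longrightarrow> derivation H (\<delta> i)"
    and \<delta>_a: "\<And>i j. i < d \<Longrightarrow> j < d \<Longrightarrow> \<delta> i (a j) = (if i = j then u else \<zero>)"
    and B: "finite B" "B \<noteq> {}" "\<And>\<beta>. \<beta> \<in> B \<Longrightarrow> c \<beta> \<in> H - {\<zero>}" "\<And>\<beta> i. \<beta> \<in> B \<Longrightarrow> d \<le> i \<Longrightarrow> \<beta> i = 0"
    and rel: "u \<otimes> (\<Oplus>\<beta>\<in>B. c \<beta> \<otimes> monomial d a \<beta>) = \<zero>"
  shows "u = \<zero>"
proof -
  note Hc = subsetD[OF subfieldE(3)[OF H]]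
  have "u = \<zero>"
    if "finite B" "B \<noteq> {}" "\<And>\<beta>. \<beta> \<in> B \<Longrightarrow> c \<beta> \<in> H - {\<zero>}" "\<And>\<beta> i. \<beta> \<in> B \<Longrightarrow> d \<le> i \<Longrightarrow> \<beta> i = 0"
      "u \<otimes> (\<Oplus>\<beta>\<in>B. c \<beta> \<otimes> monomial d a \<beta>) = \<zero>" "\<And>\<beta>. \<beta> \<in> B \<Longrightarrow> (\<Sum>i<d. \<beta> i) \<le> n" for n B c
    using that
  proof (induction n arbitrary: B c rule: less_induct)
    case (less n)
    note fin = less.prems(1) and ne = less.prems(2) and c = less.prems(3) and supp = less.prems(4)
      and rel = less.prems(5) and deg = less.prems(6)
    have m: "monomial d a \<beta> \<in> carrier R" for \<beta> using a by (rule monomial_closed)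
    have cc: "c \<beta> \<in> carrier R" "c \<beta> \<in> H" "c \<beta> \<noteq> \<zero>" if "\<beta> \<in> B" for \<beta> using c[OF that] Hc by auto
    define v where "v = (\<Oplus>\<beta>\<in>B. c \<beta> \<otimes> monomial d a \<beta>)"
    have v: "v \<in> carrier R" unfolding v_def by (rule finsum_closed) (use cc m in auto)
    have uv: "u \<otimes> v = \<zero>" using rel by (simp add: v_def)
    show ?case
    proof (cases "\<exists>i<d. \<exists>\<beta>\<in>B. nat_elem (\<beta> i) \<noteq> \<zero>")
      case True
      then obtain i \<beta>0 where i: "i < d" and \<beta>0: "\<beta>0 \<in> B" "nat_elem (\<beta>0 i) \<noteq> \<zero>" by blast
      define dn where "dn \<beta> = \<beta>(i := \<beta> i - 1)" for \<beta> :: "nat \<Rightarrow> nat"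
      \<comment> \<open>Lowering the exponent \<open>i\<close> is undone by raising it, because
        \<open>\<beta> i\<close> is positive on \<open>B1\<close>. Distinct terms of the derivative
        thus have distinct exponents, and no coefficient can cancel.\<close>
      define up where "up \<beta> = \<beta>(i := Suc (\<beta> i))" for \<beta> :: "nat \<Rightarrow> nat"
      define B1 where "B1 = {\<beta>\<in>B. nat_elem (\<beta> i) \<noteq> \<zero>}"
      define c' where "c' \<beta> = c (up \<beta>) \<otimes> nat_elem (up \<beta> i)" for \<beta>
      have pos: "\<beta> i > 0" if "\<beta> \<in> B1" for \<beta> using that by (auto simp: B1_def intro: gr0I)
      have up_dn: "up (dn \<beta>) = \<beta>" if "\<beta> \<in> B1" for \<beta> using pos[OF that] by (simp add: up_def dn_def)
      have inj: "inj_on dn B1" by (rule inj_on_inverseI[where g = up]) (rule up_dn)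
      have B1: "finite B1" "B1 \<subseteq> B" using fin by (auto simp: B1_def)
      define w where "w = (\<Oplus>\<beta>\<in>B. c \<beta> \<otimes> (nat_elem (\<beta> i) \<otimes> monomial d a (dn \<beta>)))"
      have w: "w \<in> carrier R" unfolding w_def by (rule finsum_closed) (use cc m in auto)
      have der_c: "\<delta> i (c \<beta> \<otimes> monomial d a \<beta>) = u \<otimes> (c \<beta> \<otimes> (nat_elem (\<beta> i) \<otimes> monomial d a (dn \<beta>)))"
        if "\<beta> \<in> B" for \<beta>
        using der_mult[OF \<delta>[OF i] H cc(1)[OF that] m, of \<beta>] der_const[OF \<delta>[OF i] H cc(2)[OF that]]
          der_monomial[where a = a and d = d, OF H \<delta>[OF i] a i u \<delta>_a[OF i], of \<beta>] cc[OF that] m u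
        by (simp add: dn_def m_lcomm)
      have "\<delta> i v = (\<Oplus>\<beta>\<in>B. \<delta> i (c \<beta> \<otimes> monomial d a \<beta>))"
        unfolding v_def by (rule der_finsum[OF \<delta>[OF i] H fin]) (use cc m in auto)
      also have "\<dots> = (\<Oplus>\<beta>\<in>B. u \<otimes> (c \<beta> \<otimes> (nat_elem (\<beta> i) \<otimes> monomial d a (dn \<beta>))))"
        by (rule finsum_cong') (use der_c cc m u in auto)
      also have "\<dots> = u \<otimes> w"
        unfolding w_def by (rule finsum_rdistr[symmetric]) (use fin cc m u in auto)
      finally have dv: "\<delta> i v = u \<otimes> w" .
      have du: "\<delta> i u \<in> carrier R" by (rule der_closed[OF \<delta>[OF i] H u])
      \<comment> \<open>Nothing is known about \<open>\<delta> i u\<close>, but its coefficient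
        \<open>v\<close> is killed by \<open>u\<close>. One more factor \<open>u\<close> therefore
        leaves the cube of \<open>u\<close> times \<open>w\<close> equal to zero, and reducedness
        turns this into \<open>u \<otimes> w = \<zero>\<close>, a relation of smaller
        degree.\<close>
      have "\<zero> = \<delta> i (u \<otimes> v)"
        using der_const[OF \<delta>[OF i] H] subringE(2)[OF subfieldE(1)[OF H]] by (simp add: uv)
      also have "\<dots> = u \<otimes> (u \<otimes> w) \<oplus> v \<otimes> \<delta> i u" using der_mult[OF \<delta>[OF i] H u v] dv by simp
      finally have eq: "u \<otimes> (u \<otimes> w) \<oplus> v \<otimes> \<delta> i u = \<zero>" by simp
      have "u \<otimes> (v \<otimes> \<delta> i u) = \<zero>" using uv u v du by (simp add: m_assoc[symmetric])
      then have "u \<otimes> (u \<otimes> (u \<otimes> w)) = u \<otimes> (u \<otimes> (u \<otimes> w) \<oplus> v \<otimes> \<delta> i u)"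
        using u v w du by (simp add: r_distr)
      then have uuuw: "u \<otimes> (u \<otimes> (u \<otimes> w)) = \<zero>" using eq u by simp
      have "(u \<otimes> w) [^] (3::nat) = (u \<otimes> (u \<otimes> (u \<otimes> w))) \<otimes> (w \<otimes> w)"
        using u w by (simp add: numeral_3_eq_3 m_ac)
      then have "(u \<otimes> w) [^] (3::nat) = \<zero>" using uuuw w by simp
      then have uw: "u \<otimes> w = \<zero>" by (rule reduced_pow_zero[OF red m_closed[OF u w]])
      have "w = (\<Oplus>\<beta>\<in>B1. c \<beta> \<otimes> (nat_elem (\<beta> i) \<otimes> monomial d a (dn \<beta>)))"
        unfolding w_def
        by (rule add.finprod_mono_neutral_cong_right) (use B1 fin cc m in \<open>auto simp: B1_def\<close>)
      also have "\<dots> = (\<Oplus>\<beta>\<in>B1. c' (dn \<beta>) \<otimes> monomial d a (dn \<beta>))"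
        by (rule finsum_cong') (use B1 cc m in \<open>auto simp: c'_def up_dn m_assoc subset_iff\<close>)
      also have "\<dots> = (\<Oplus>\<beta>\<in>dn ` B1. c' \<beta> \<otimes> monomial d a \<beta>)"
        by (rule finsum_reindex[symmetric, OF _ inj]) (use B1 cc m in \<open>auto simp: c'_def up_dn subset_iff\<close>)
      finally have w_eq: "w = (\<Oplus>\<beta>\<in>dn ` B1. c' \<beta> \<otimes> monomial d a \<beta>)" .
      have sum_dn: "(\<Sum>j<d. dn \<beta> j) < n" if "\<beta> \<in> B1" for \<beta>
      proof -
        have "(\<Sum>j<d. dn \<beta> j) < (\<Sum>j<d. \<beta> j)"
          by (rule sum_strict_mono_ex1) (use pos[OF that] i in \<open>auto simp: dn_def\<close>)
        also have "\<dots> \<le> n" using deg that B1 by auto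
        finally show ?thesis .
      qed
      have B1_ne: "\<beta>0 \<in> B1" using \<beta>0 by (simp add: B1_def)
      have n: "n > 0" using sum_dn[OF B1_ne] by simp
      show "u = \<zero>"
      proof (rule less.IH[of "n - 1" "dn ` B1" c'])
        show "n - 1 < n" using n by simp
        show "finite (dn ` B1)" "dn ` B1 \<noteq> {}" using B1 B1_ne by auto
        show "c' \<beta> \<in> H - {\<zero>}" if im: "\<beta> \<in> dn ` B1" for \<beta>
        proof -
          obtain \<gamma> where \<gamma>: "\<gamma> \<in> B1" "\<beta> = dn \<gamma>" using im by blast
          have g: "c \<gamma> \<in> H" "c \<gamma> \<noteq> \<zero>" "nat_elem (\<gamma> i) \<in> H" "nat_elem (\<gamma> i) \<noteq> \<zero>"
            using \<gamma>(1) cc subfield_nat_elem[OF H] by (auto simp: B1_def)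
          then have "c \<gamma> \<otimes> nat_elem (\<gamma> i) \<in> H" using subringE(6)[OF subfieldE(1)[OF H]] by blast
          moreover have "c \<gamma> \<otimes> nat_elem (\<gamma> i) \<noteq> \<zero>" using subfieldE(5)[OF H g(1,3)] g by blast
          ultimately show ?thesis using \<gamma> by (simp add: c'_def up_dn)
        qed
        show "\<beta> j = 0" if "\<beta> \<in> dn ` B1" "d \<le> j" for \<beta> j
          using that supp B1 i by (auto simp: dn_def)
        show "u \<otimes> (\<Oplus>\<beta>\<in>dn ` B1. c' \<beta> \<otimes> monomial d a \<beta>) = \<zero>" using uw w_eq by simp
        show "(\<Sum>j<d. \<beta> j) \<le> n - 1" if "\<beta> \<in> dn ` B1" for \<beta> using that sum_dn by force
      qed
    next
      case False
      then have zero: "nat_elem (\<beta> i) = \<zero>" if "\<beta> \<in> B" "i < d" for \<beta> i using that by blast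
      show "u = \<zero>"
      proof (cases "\<exists>\<beta>\<in>B. \<exists>i<d. \<beta> i \<noteq> 0")
        case False
        then have "\<beta> = (\<lambda>_. 0)" if "\<beta> \<in> B" for \<beta> using that supp by (metis not_le)
        then have B_eq: "B = {\<lambda>_. 0}" using ne by auto
        let ?c = "c (\<lambda>_. 0)"
        have c0: "?c \<in> H - {\<zero>}" using c B_eq by simp
        have "monomial d a (\<lambda>_. 0) = \<one>" unfolding monomial_def by (simp add: finprod_one_eqI)
        then have "v = ?c" unfolding v_def B_eq using c0 Hc by simp
        then have "u \<otimes> ?c \<otimes> inv ?c = \<zero>"
          using uv subfield_m_inv(1)[OF H c0] Hc by simp
        moreover have "u \<otimes> ?c \<otimes> inv ?c = u"
          using subfield_m_inv[OF H c0] u Hc c0 by (simp add: m_assoc)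
        ultimately show ?thesis by simp
      next
        case True
        then obtain \<beta>0 i0 where \<beta>0: "\<beta>0 \<in> B" "i0 < d" "\<beta>0 i0 \<noteq> 0" by blast
        obtain p where p: "Factorial_Ring.prime p" "nat_elem p = \<zero>" "\<forall>m. nat_elem m = \<zero> \<longrightarrow> p dvd m"
          by (rule subfield_char[OF H \<beta>0(3)[unfolded neq0_conv] zero[OF \<beta>0(1,2)]])
        have p2: "p \<ge> 2" using p(1) by (rule prime_ge_2_nat)
        \<comment> \<open>All exponents are multiples of \<open>p\<close>, and the coefficients have
          \<open>p\<close>-th roots in \<open>H\<close>, so \<open>v\<close> is the
          \<open>p\<close>-th power of the polynomial \<open>s\<close> with exponents divided by
          \<open>p\<close>. From \<open>u \<otimes> v = \<zero>\<close> the element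
          \<open>u \<otimes> s\<close> is nilpotent, hence zero; the new relation has degree at most
          \<open>n div p\<close>.\<close>
        define dv where "dv \<beta> = (\<lambda>i. \<beta> i div p)" for \<beta> :: "nat \<Rightarrow> nat"
        define mu where "mu \<beta> = (\<lambda>i. p * \<beta> i)" for \<beta> :: "nat \<Rightarrow> nat"
        have mu_dv: "mu (dv \<beta>) = \<beta>" if "\<beta> \<in> B" for \<beta>
        proof
          fix i
          have "p dvd \<beta> i" using p(3) zero[OF that, of i] supp[OF that, of i] by (cases "i < d") auto
          then show "mu (dv \<beta>) i = \<beta> i" by (simp add: mu_def dv_def)
        qed
        then have inj: "inj_on dv B" by (intro inj_on_inverseI[where g = mu])
        define r where "r x = (SOME y. y \<in> H \<and> y [^] p = x)" for x
        have r: "r x \<in> H \<and> r x [^] p = x" if "x \<in> H" for x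
          unfolding r_def by (rule someI_ex) (use perf[OF p(1,2) that] in blast)
        define b where "b \<beta> = r (c (mu \<beta>))" for \<beta>
        have b: "b (dv \<beta>) \<in> H" "b (dv \<beta>) [^] p = c \<beta>" if "\<beta> \<in> B" for \<beta>
          using r[OF cc(2)[OF that]] mu_dv[OF that] by (simp_all add: b_def)
        define s where "s = (\<Oplus>\<beta>\<in>B. b (dv \<beta>) \<otimes> monomial d a (dv \<beta>))"
        have s: "s \<in> carrier R" unfolding s_def by (rule finsum_closed) (use b Hc m in auto)
        have "s [^] p = (\<Oplus>\<beta>\<in>B. (b (dv \<beta>) \<otimes> monomial d a (dv \<beta>)) [^] p)"
          unfolding s_def by (rule frobenius_finsum[OF p(1,2) fin]) (use b Hc m in auto)
        also have "\<dots> = v"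
          unfolding v_def
        proof (rule finsum_cong')
          fix \<beta> assume \<beta>: "\<beta> \<in> B"
          have "monomial d a (dv \<beta>) [^] p = monomial d a \<beta>"
            using monomial_pow[of d a "dv \<beta>" p] a mu_dv[OF \<beta>] by (simp add: mu_def)
          then show "(b (dv \<beta>) \<otimes> monomial d a (dv \<beta>)) [^] p = c \<beta> \<otimes> monomial d a \<beta>"
            using b[OF \<beta>] Hc m by (simp add: nat_pow_distrib)
        qed (use cc m in auto)
        finally have "(u \<otimes> s) [^] p = u [^] p \<otimes> v" using u s by (simp add: nat_pow_distrib)
        also have "u [^] p = u [^] (p - 1) \<otimes> u" using p2 nat_pow_Suc[of u "p - 1"] by simp
        finally have "(u \<otimes> s) [^] p = \<zero>" using u v uv by (simp add: m_assoc)
        then have us: "u \<otimes> s = \<zero>" by (rule reduced_pow_zero[OF red m_closed[OF u s]])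
        have "s = (\<Oplus>\<beta>\<in>dv ` B. b \<beta> \<otimes> monomial d a \<beta>)"
          unfolding s_def by (rule finsum_reindex[symmetric, OF _ inj]) (use b Hc m in auto)
        then have rel': "u \<otimes> (\<Oplus>\<beta>\<in>dv ` B. b \<beta> \<otimes> monomial d a \<beta>) = \<zero>" using us by simp
        have deg': "p * (\<Sum>i<d. dv \<beta> i) \<le> n" if "\<beta> \<in> B" for \<beta>
        proof -
          have "p * (\<Sum>i<d. dv \<beta> i) = (\<Sum>i<d. mu (dv \<beta>) i)" by (simp add: sum_distrib_left mu_def)
          then show ?thesis using deg[OF that] mu_dv[OF that] by simp
        qed
        have "\<beta>0 i0 \<le> (\<Sum>i<d. \<beta>0 i)" using \<beta>0(2) by (intro member_le_sum) auto
        then have n: "n > 0" using deg[OF \<beta>0(1)] \<beta>0(3) by simp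
        show "u = \<zero>"
        proof (rule less.IH[of "n div p" "dv ` B" b])
          show "n div p < n" using n p2 by simp
          show "finite (dv ` B)" "dv ` B \<noteq> {}" using fin ne by auto
          show "b \<beta> \<in> H - {\<zero>}" if im: "\<beta> \<in> dv ` B" for \<beta>
          proof -
            obtain \<gamma> where \<gamma>: "\<gamma> \<in> B" "\<beta> = dv \<gamma>" using im by blast
            have "b (dv \<gamma>) \<noteq> \<zero>"
              using b(2)[OF \<gamma>(1)] cc(3)[OF \<gamma>(1)] p2 by (auto simp: nat_pow_zero)
            then show ?thesis using b(1)[OF \<gamma>(1)] \<gamma> by simp
          qed
          show "\<beta> j = 0" if im: "\<beta> \<in> dv ` B" and j: "d \<le> j" for \<beta> j
          proof -
            obtain \<gamma> where \<gamma>: "\<gamma> \<in> B" "\<beta> = dv \<gamma>" using im by blast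
            then show ?thesis using supp[OF \<gamma>(1) j] by (simp add: dv_def)
          qed
          show "u \<otimes> (\<Oplus>\<beta>\<in>dv ` B. b \<beta> \<otimes> monomial d a \<beta>) = \<zero>" by (rule rel')
          show "(\<Sum>j<d. \<beta> j) \<le> n div p" if im: "\<beta> \<in> dv ` B" for \<beta>
          proof -
            obtain \<gamma> where \<gamma>: "\<gamma> \<in> B" "\<beta> = dv \<gamma>" using im by blast
            have "(\<Sum>j<d. \<beta> j) = p * (\<Sum>j<d. \<beta> j) div p" using p2 by simp
            also have "\<dots> \<le> n div p" using deg'[OF \<gamma>(1)] \<gamma>(2) by (intro div_le_mono) simp
            finally show ?thesis .
          qed
        qed
      qed
    qed
  qed
  note * = this
  have "sum \<beta> {..<d} \<le> (MAX \<beta>\<in>B. sum \<beta> {..<d})" if "\<beta> \<in> B" for \<beta>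
    using B(1) that by simp
  with B rel show ?thesis by (rule *[of B c])
qed

end

section \<open>Homogeneous ideals\<close>

lemma (in ring) Span_image:
  assumes K: "subfield K R" and Us: "set Us \<subseteq> carrier R"
    and closed: "\<And>x. x \<in> carrier R \<Longrightarrow> \<phi> x \<in> carrier R"
    and add: "\<And>x y. x \<in> carrier R \<Longrightarrow> y \<in> carrier R \<Longrightarrow> \<phi> (x \<oplus> y) = \<phi> x \<oplus> \<phi> y"
    and smult: "\<And>k x. k \<in> K \<Longrightarrow> x \<in> carrier R \<Longrightarrow> \<phi> (k \<otimes> x) = k \<otimes> \<phi> x"
    and s: "s \<in> Span K Us"
  shows "\<phi> s \<in> Span K (map \<phi> Us)"
  using Us s
proof (induction Us arbitrary: s)
  case Nil
  have "\<phi> \<zero> \<oplus> \<phi> \<zero> = \<phi> \<zero>" using add[of \<zero> \<zero>] by simp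
  then have "\<phi> \<zero> = \<zero>" using closed[of \<zero>] by simp
  then show ?case using Nil by simp
next
  case (Cons u Us)
  then obtain k v where kv: "k \<in> K" "v \<in> Span K Us" "s = k \<otimes> u \<oplus> v"
    using line_extension_mem_iff[of s K u "Span K Us"] by auto
  have c: "k \<in> carrier R" "v \<in> carrier R" "u \<in> carrier R"
    using kv Cons.prems subfieldE(3)[OF K] Span_in_carrier[OF subfieldE(3)[OF K], of Us] by auto
  have "\<phi> s = k \<otimes> \<phi> u \<oplus> \<phi> v" using c kv add smult by simp
  moreover have "\<phi> v \<in> Span K (map \<phi> Us)" using Cons kv by simp
  ultimately show ?case using line_extension_mem_iff[of "\<phi> s" K "\<phi> u" "Span K (map \<phi> Us)"] kv by auto
qed

section \<open>Homogeneous components\<close>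

locale graded_algebra = connected_graded_ring K S \<iota> gr
  for K :: "('k, 'm) ring_scheme" and S :: "('a, 'n) ring_scheme" (structure)
    and \<iota> :: "'k \<Rightarrow> 'a" and gr :: "nat \<Rightarrow> 'a set"
begin

lemma gr_carrier: "x \<in> gr n \<Longrightarrow> x \<in> carrier S"
  using additive_subgroup.a_Hcarr[OF gr_subgroup] .

lemma gr_zero [simp]: "\<zero> \<in> gr n"
  using additive_subgroup.zero_closed[OF gr_subgroup] .

lemma gr_add: "x \<in> gr n \<Longrightarrow> y \<in> gr n \<Longrightarrow> x \<oplus> y \<in> gr n"
  using additive_subgroup.a_closed[OF gr_subgroup] .

lemma one_gr: "\<one> \<in> gr 0"
  using incl_image ring_hom_one[OF incl_hom] one_closed by (metis imageI)

lemma gr0_subfield: "subfield (gr 0) S"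
proof -
  interpret h: ring_hom_ring K S \<iota>
    by (rule ring_hom_ringI2[OF ring_axioms S.ring_axioms incl_hom])
  have "\<one> \<noteq> \<zero>"
  proof
    assume "\<one> = \<zero>"
    then have "\<iota> \<one>\<^bsub>K\<^esub> = \<iota> \<zero>\<^bsub>K\<^esub>" by simp
    then show False using inj_onD[OF incl_inj, of "\<one>\<^bsub>K\<^esub>" "\<zero>\<^bsub>K\<^esub>"] by simp
  qed
  then have "subfield (\<iota> ` carrier K) S"
    using h.img_is_subfield(2)[OF carrier_is_subfield] by simp
  then show ?thesis by (simp add: incl_image)
qed

text \<open>The homogeneous component of \<open>x\<close> in degree \<open>n\<close>; the
  description is proper on the carrier because the decomposition exists and is unique there.\<close>

definition hc :: "'a \<Rightarrow> nat \<Rightarrow> 'a" where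
  "hc x = (THE c. (\<forall>n. c n \<in> gr n) \<and> finite {n. c n \<noteq> \<zero>} \<and> x = finsum S c {n. c n \<noteq> \<zero>})"

lemma hc_props:
  assumes "x \<in> carrier S"
  shows "hc x n \<in> gr n" "finite {n. hc x n \<noteq> \<zero>}" "finsum S (hc x) {n. hc x n \<noteq> \<zero>} = x"
  using theI'[OF gr_direct_sum[OF assms]] unfolding hc_def[symmetric] by auto

lemma hc_closed [simp]: "x \<in> carrier S \<Longrightarrow> hc x n \<in> carrier S"
  using hc_props(1) gr_carrier by blast

lemma hc_eqI:
  assumes c: "\<And>n. c n \<in> gr n" and A: "finite A" "\<And>n. n \<notin> A \<Longrightarrow> c n = \<zero>" and x: "x = finsum S c A"
  shows "hc x = c"
proof -
  have cc: "c \<in> A \<rightarrow> carrier S" using c gr_carrier by auto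
  have sub: "{n. c n \<noteq> \<zero>} \<subseteq> A" using A(2) by auto
  then have "finsum S c {n. c n \<noteq> \<zero>} = finsum S c A"
    by (intro S.add.finprod_mono_neutral_cong_left) (use A cc in auto)
  then have "(\<forall>n. c n \<in> gr n) \<and> finite {n. c n \<noteq> \<zero>} \<and> x = finsum S c {n. c n \<noteq> \<zero>}"
    using c x finite_subset[OF sub A(1)] by simp
  moreover have "x \<in> carrier S" using x cc by simp
  ultimately show ?thesis
    unfolding hc_def by (intro the1_equality[OF gr_direct_sum])
qed

lemma hc_sum_superset:
  assumes "x \<in> carrier S" "finite A" "{n. hc x n \<noteq> \<zero>} \<subseteq> A"
  shows "finsum S (hc x) A = x"
proof -
  have "finsum S (hc x) {n. hc x n \<noteq> \<zero>} = finsum S (hc x) A"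
    by (intro S.add.finprod_mono_neutral_cong_left) (use assms in auto)
  then show ?thesis using hc_props(3)[OF assms(1)] by simp
qed

lemma hc_homogeneous: "x \<in> gr n \<Longrightarrow> hc x = (\<lambda>i. if i = n then x else \<zero>)"
proof (rule hc_eqI[where A = "{n}"])
  assume "x \<in> gr n"
  then show "x = (\<Oplus>i\<in>{n}. if i = n then x else \<zero>)"
    using gr_carrier by (subst S.finsum_insert) auto
qed auto

lemma hc_zero [simp]: "hc \<zero> n = \<zero>"
  using hc_homogeneous[OF gr_zero, of 0] by simp

lemma hc_add:
  assumes x: "x \<in> carrier S" and y: "y \<in> carrier S"
  shows "hc (x \<oplus> y) n = hc x n \<oplus> hc y n"
proof -
  let ?A = "{n. hc x n \<noteq> \<zero>} \<union> {n. hc y n \<noteq> \<zero>}"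
  have fin: "finite ?A" using hc_props(2) x y by auto
  have "hc (x \<oplus> y) = (\<lambda>n. hc x n \<oplus> hc y n)"
  proof (rule hc_eqI[OF _ fin])
    have "(\<Oplus>n\<in>?A. hc x n \<oplus> hc y n) = finsum S (hc x) ?A \<oplus> finsum S (hc y) ?A"
      by (rule S.finsum_addf) (use x y in auto)
    also have "finsum S (hc x) ?A = x" by (rule hc_sum_superset[OF x fin]) auto
    also have "finsum S (hc y) ?A = y" by (rule hc_sum_superset[OF y fin]) auto
    finally show "x \<oplus> y = (\<Oplus>n\<in>?A. hc x n \<oplus> hc y n)" by simp
  qed (use x y hc_props(1) gr_add in auto)
  then show ?thesis by simp
qed

lemma hc_mult_homogeneous:
  assumes z: "z \<in> gr e" and x: "x \<in> carrier S"
  shows "hc (z \<otimes> x) n = (if e \<le> n then z \<otimes> hc x (n - e) else \<zero>)"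
proof -
  let ?A = "{n. hc x n \<noteq> \<zero>}"
  have fin: "finite ?A" using hc_props(2) x by auto
  have zc: "z \<in> carrier S" using gr_carrier z by auto
  have "hc (z \<otimes> x) = (\<lambda>n. if e \<le> n then z \<otimes> hc x (n - e) else \<zero>)"
  proof (rule hc_eqI[where A = "(\<lambda>n. n + e) ` ?A"])
    fix n
    show "(if e \<le> n then z \<otimes> hc x (n - e) else \<zero>) \<in> gr n"
      using gr_mult[OF z hc_props(1)[OF x], of "n - e"] by auto
  next
    fix n assume n: "n \<notin> (\<lambda>n. n + e) ` ?A"
    have "hc x (n - e) = \<zero>" if "e \<le> n"
    proof (rule ccontr)
      assume "hc x (n - e) \<noteq> \<zero>"
      then have "n - e + e \<in> (\<lambda>n. n + e) ` ?A" by blast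
      then show False using n that by simp
    qed
    then show "(if e \<le> n then z \<otimes> hc x (n - e) else \<zero>) = \<zero>" using zc by simp
  next
    have "(\<Oplus>n\<in>(\<lambda>n. n + e) ` ?A. if e \<le> n then z \<otimes> hc x (n - e) else \<zero>) = (\<Oplus>n\<in>?A. z \<otimes> hc x n)"
      by (subst S.finsum_reindex) (use x zc in \<open>auto simp: inj_on_def\<close>)
    also have "\<dots> = z \<otimes> finsum S (hc x) ?A" by (rule S.finsum_rdistr[symmetric]) (use fin x zc in auto)
    also have "\<dots> = z \<otimes> x" using hc_props(3)[OF x] by simp
    finally show "z \<otimes> x = (\<Oplus>n\<in>(\<lambda>n. n + e) ` ?A. if e \<le> n then z \<otimes> hc x (n - e) else \<zero>)" by simp
  qed (use fin in auto)
  then show ?thesis by simp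
qed

lemma hc_finsum:
  assumes "finite A" "f \<in> A \<rightarrow> carrier S"
  shows "hc (finsum S f A) n = (\<Oplus>i\<in>A. hc (f i) n)"
  using assms
proof (induction A rule: finite_induct)
  case (insert a A)
  have "f a \<in> carrier S" "finsum S f A \<in> carrier S" "(\<lambda>i. hc (f i) n) \<in> A \<rightarrow> carrier S"
    using insert.prems by (auto simp: Pi_iff)
  then show ?case using insert by (simp add: hc_add)
qed simp

lemma hc_eq_iff: "x \<in> carrier S \<Longrightarrow> y \<in> carrier S \<Longrightarrow> x = y \<longleftrightarrow> (\<forall>n. hc x n = hc y n)"
  using hc_props(3) by (metis ext)

lemma hc_mult:
  assumes x: "x \<in> carrier S" and y: "y \<in> carrier S"
  shows "hc (x \<otimes> y) n = (\<Oplus>i\<in>{..n}. hc x i \<otimes> hc y (n - i))"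
proof -
  let ?A = "{n. hc x n \<noteq> \<zero>} \<union> {..n}"
  have fin: "finite ?A" using hc_props(2) x by auto
  have "x \<otimes> y = finsum S (hc x) ?A \<otimes> y" using hc_sum_superset[OF x fin] by auto
  also have "\<dots> = (\<Oplus>i\<in>?A. hc x i \<otimes> y)" by (rule S.finsum_ldistr) (use fin x y in auto)
  finally have "hc (x \<otimes> y) n = (\<Oplus>i\<in>?A. hc (hc x i \<otimes> y) n)"
    using hc_finsum[OF fin, of "\<lambda>i. hc x i \<otimes> y"] x y by simp
  also have "\<dots> = (\<Oplus>i\<in>{..n}. hc x i \<otimes> hc y (n - i))"
    by (rule S.add.finprod_mono_neutral_cong_right)
      (use fin x y in \<open>auto simp: hc_mult_homogeneous[OF hc_props(1)[OF x] y]\<close>)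
  finally show ?thesis .
qed

section \<open>Truncation and the filtration by degree\<close>

definition trunc :: "nat \<Rightarrow> 'a \<Rightarrow> 'a" where
  "trunc n x = (\<Oplus>i\<in>{..n}. hc x i)"

definition Fil :: "nat \<Rightarrow> 'a set" where
  "Fil n = {x \<in> carrier S. \<forall>i>n. hc x i = \<zero>}"

lemma trunc_closed [simp]: "x \<in> carrier S \<Longrightarrow> trunc n x \<in> carrier S"
  unfolding trunc_def by (rule S.finsum_closed) auto

lemma hc_trunc: 
  assumes x: "x \<in> carrier S" shows "hc (trunc n x) i = (if i \<le> n then hc x i else \<zero>)"
proof -
  have "hc (trunc n x) i = (\<Oplus>j\<in>{..n}. hc (hc x j) i)"
    unfolding trunc_def by (rule hc_finsum) (use x in auto)
  also have "\<dots> = (\<Oplus>j\<in>{..n}. if i = j then hc x j else \<zero>)"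
    by (rule S.finsum_cong') (use x in \<open>auto simp: hc_homogeneous[OF hc_props(1)[OF x]]\<close>)
  also have "\<dots> = (if i \<le> n then hc x i else \<zero>)"
  proof (cases "i \<le> n")
    case True
    then show ?thesis using S.finsum_singleton[of i "{..n}" "hc x"] x by simp
  next
    case False
    then have "(\<Oplus>j\<in>{..n}. if i = j then hc x j else \<zero>) = (\<Oplus>j\<in>{..n}. \<zero>)"
      by (intro S.finsum_cong') auto
    then show ?thesis using False by simp
  qed
  finally show ?thesis .
qed

lemma trunc_Fil: "x \<in> carrier S \<Longrightarrow> trunc n x \<in> Fil n"
  by (simp add: Fil_def hc_trunc)

lemma trunc_id: "x \<in> Fil n \<Longrightarrow> trunc n x = x"
  by (subst hc_eq_iff) (auto simp: Fil_def hc_trunc)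

lemma trunc_add: "x \<in> carrier S \<Longrightarrow> y \<in> carrier S \<Longrightarrow> trunc n (x \<oplus> y) = trunc n x \<oplus> trunc n y"
  by (subst hc_eq_iff) (auto simp: hc_trunc hc_add)

lemma trunc_mult_homogeneous:
  "z \<in> gr e \<Longrightarrow> x \<in> carrier S \<Longrightarrow> trunc n (z \<otimes> x) = (if e \<le> n then z \<otimes> trunc (n - e) x else \<zero>)"
  by (subst hc_eq_iff) (auto simp: hc_trunc hc_mult_homogeneous gr_carrier)

lemma trunc_smult: "c \<in> gr 0 \<Longrightarrow> x \<in> carrier S \<Longrightarrow> trunc n (c \<otimes> x) = c \<otimes> trunc n x"
  using trunc_mult_homogeneous[of c 0 x n] by simp

lemma Fil_exists: 
  assumes "x \<in> carrier S" obtains n where "x \<in> Fil n"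
proof -
  obtain n where "\<forall>i\<in>{n. hc x n \<noteq> \<zero>}. i \<le> n"
    using hc_props(2)[OF assms] finite_nat_set_iff_bounded_le by blast
  then have "x \<in> Fil n" using assms unfolding Fil_def using not_le by blast
  then show thesis by (rule that)
qed

lemma Fil_mono: "m \<le> n \<Longrightarrow> Fil m \<subseteq> Fil n"
  by (auto simp: Fil_def)

lemma Fil_mult: 
  assumes "x \<in> Fil m" "y \<in> Fil n" shows "x \<otimes> y \<in> Fil (m + n)"
proof -
  have c: "x \<in> carrier S" "y \<in> carrier S" using assms by (auto simp: Fil_def)
  have "hc (x \<otimes> y) k = \<zero>" if "k > m + n" for k
  proof -
    have "hc x i \<otimes> hc y (k - i) = \<zero>" if "i \<le> k" for i
    proof (cases "i > m")
      case False
      then have "k - i > n" using \<open>k > m + n\<close> by simp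
      then show ?thesis using assms c by (simp add: Fil_def)
    qed (use assms c in \<open>simp add: Fil_def\<close>)
    then have "(\<Oplus>i\<in>{..k}. hc x i \<otimes> hc y (k - i)) = (\<Oplus>i\<in>{..k}. \<zero>)"
      by (intro S.finsum_cong') auto
    then show ?thesis using c by (simp add: hc_mult)
  qed
  then show ?thesis using c by (simp add: Fil_def)
qed

lemma Fil_one: "\<one> \<in> Fil 0"
  by (simp add: Fil_def hc_homogeneous[OF one_gr])

section \<open>Homogeneous ideals\<close>

definition homogeneous_ideal :: "'a set \<Rightarrow> bool" where
  "homogeneous_ideal I \<longleftrightarrow> ideal I S \<and> (\<forall>x\<in>I. \<forall>n. hc x n \<in> I)"

lemma ideal_closed:
  assumes "ideal I S"
  shows "x \<in> I \<Longrightarrow> x \<in> carrier S" "\<zero> \<in> I" "x \<in> I \<Longrightarrow> y \<in> I \<Longrightarrow> x \<oplus> y \<in> I"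
    and "x \<in> I \<Longrightarrow> y \<in> carrier S \<Longrightarrow> y \<otimes> x \<in> I" "x \<in> I \<Longrightarrow> y \<in> carrier S \<Longrightarrow> x \<otimes> y \<in> I"
    and "x \<in> I \<Longrightarrow> \<ominus> x \<in> I"
proof -
  interpret I: ideal I S by fact
  show "x \<in> I \<Longrightarrow> x \<in> carrier S" "\<zero> \<in> I" "x \<in> I \<Longrightarrow> y \<in> I \<Longrightarrow> x \<oplus> y \<in> I"
    "x \<in> I \<Longrightarrow> y \<in> carrier S \<Longrightarrow> y \<otimes> x \<in> I" "x \<in> I \<Longrightarrow> y \<in> carrier S \<Longrightarrow> x \<otimes> y \<in> I"
    "x \<in> I \<Longrightarrow> \<ominus> x \<in> I"
    by (auto intro: I.I_l_closed I.I_r_closed)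
qed

lemma homogeneous_idealD:
  assumes "homogeneous_ideal I"
  shows "ideal I S" "x \<in> I \<Longrightarrow> hc x n \<in> I" "x \<in> I \<Longrightarrow> trunc n x \<in> I"
  using assms S.ideal_finsum[of I "{..n}" "hc x"] unfolding homogeneous_ideal_def trunc_def by auto

text \<open>For an ideal \<open>I\<close> this is the sum of \<open>I\<close> and the principal
  ideal of \<open>z\<close>.\<close>

definition adjoin :: "'a set \<Rightarrow> 'a \<Rightarrow> 'a set" where
  "adjoin I z = {y \<oplus> z \<otimes> b | y b. y \<in> I \<and> b \<in> carrier S}"

lemma adjoin_ideal:
  assumes I: "ideal I S" and z: "z \<in> carrier S"
  shows "ideal (adjoin I z) S" "I \<subseteq> adjoin I z" "z \<in> adjoin I z"
    and "ideal J S \<Longrightarrow> I \<subseteq> J \<Longrightarrow> z \<in> J \<Longrightarrow> adjoin I z \<subseteq> J"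
proof -
  note Ic = ideal_closed[OF I]
  have mem: "y \<oplus> z \<otimes> b \<in> adjoin I z" if "y \<in> I" "b \<in> carrier S" for y b
    using that unfolding adjoin_def by blast
  show "ideal (adjoin I z) S"
  proof (rule S.ideal_if_closed)
    show "adjoin I z \<subseteq> carrier S" using Ic(1) z by (auto simp: adjoin_def)
    show "\<zero> \<in> adjoin I z" using mem[OF Ic(2), of \<zero>] z by simp
  next
    fix x y assume "x \<in> adjoin I z" "y \<in> adjoin I z"
    then obtain p b q c where *: "x = p \<oplus> z \<otimes> b" "y = q \<oplus> z \<otimes> c" "p \<in> I" "q \<in> I" "b \<in> carrier S" "c \<in> carrier S"
      by (auto simp: adjoin_def)
    then have "x \<oplus> y = (p \<oplus> q) \<oplus> z \<otimes> (b \<oplus> c)" using z Ic(1) by (simp add: S.r_distr S.a_ac)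
    then show "x \<oplus> y \<in> adjoin I z" using mem[of "p \<oplus> q" "b \<oplus> c"] * Ic(3) by simp
  next
    fix r x assume r: "r \<in> carrier S" and "x \<in> adjoin I z"
    then obtain p b where *: "x = p \<oplus> z \<otimes> b" "p \<in> I" "b \<in> carrier S" by (auto simp: adjoin_def)
    then have "r \<otimes> x = (r \<otimes> p) \<oplus> z \<otimes> (r \<otimes> b)" using z r Ic(1) by (simp add: S.r_distr S.m_lcomm)
    then show "r \<otimes> x \<in> adjoin I z" using mem[of "r \<otimes> p" "r \<otimes> b"] * r Ic(4) by simp
  qed
  show "I \<subseteq> adjoin I z"
  proof
    fix y assume "y \<in> I"
    then show "y \<in> adjoin I z" using mem[of y \<zero>] z Ic(1) by simp
  qed
  show "z \<in> adjoin I z" using mem[OF Ic(2), of \<one>] z by simp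
  assume "ideal J S" "I \<subseteq> J" "z \<in> J"
  then show "adjoin I z \<subseteq> J" using ideal_closed(3,5)[of J] by (auto simp: adjoin_def)
qed

lemma adjoin_homogeneous:
  assumes I: "homogeneous_ideal I" and z: "z \<in> gr e"
  shows "homogeneous_ideal (adjoin I z)"
proof -
  note zc = gr_carrier[OF z] and iI = homogeneous_idealD(1)[OF I]
  have "hc x n \<in> adjoin I z" if x: "x \<in> adjoin I z" for x n
  proof -
    obtain y b where *: "x = y \<oplus> z \<otimes> b" "y \<in> I" "b \<in> carrier S" using x by (auto simp: adjoin_def)
    note yc = ideal_closed(1)[OF iI *(2)]
    define b' where "b' = (if e \<le> n then hc b (n - e) else \<zero>)"
    have b': "b' \<in> carrier S" using * by (simp add: b'_def)
    have "hc x n = hc y n \<oplus> z \<otimes> b'"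
      using * yc zc by (simp add: hc_add hc_mult_homogeneous[OF z] b'_def)
    then show ?thesis unfolding adjoin_def using homogeneous_idealD(2)[OF I *(2)] b' by blast
  qed
  then show ?thesis unfolding homogeneous_ideal_def using adjoin_ideal(1)[OF iI zc] by blast
qed

text \<open>Let \<open>i\<close> and \<open>j\<close> be the top degrees in which \<open>x\<close>
  and \<open>y\<close> have components outside \<open>I\<close>. In degree \<open>i + j\<close> of
  the product, every contribution other than the product of these two components lies in
  \<open>I\<close>; so that product lies in \<open>I\<close> as well, against the assumption on
  homogeneous elements.\<close>

lemma homogeneous_primeI:
  assumes I: "homogeneous_ideal I" and ne: "I \<noteq> carrier S"
    and prime: "\<And>x y m n. x \<in> gr m \<Longrightarrow> y \<in> gr n \<Longrightarrow> x \<otimes> y \<in> I \<Longrightarrow> x \<in> I \<or> y \<in> I"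
  shows "primeideal I S"
proof (rule primeidealI)
  note iI = homogeneous_idealD(1)[OF I]
  show "ideal I S" by fact
  show "cring S" by (rule S.is_cring)
  show "carrier S \<noteq> I" using ne by simp
  have top: "\<exists>i. hc x i \<notin> I \<and> (\<forall>j>i. hc x j \<in> I)" if x: "x \<in> carrier S" "x \<notin> I" for x
  proof -
    let ?A = "{i. hc x i \<notin> I}"
    have sub: "?A \<subseteq> {i. hc x i \<noteq> \<zero>}" using ideal_closed(2)[OF iI] by auto
    then have fin: "finite ?A" using hc_props(2)[OF x(1)] finite_subset by blast
    have "?A \<noteq> {}"
    proof
      assume "?A = {}"
      then have "finsum S (hc x) {n. hc x n \<noteq> \<zero>} \<in> I"
        by (intro S.ideal_finsum[OF iI hc_props(2)[OF x(1)]]) auto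
      then show False using hc_props(3)[OF x(1)] x(2) by simp
    qed
    then have "Max ?A \<in> ?A" "\<forall>j>Max ?A. j \<notin> ?A"
      using fin Max_in[OF fin] Max_ge[OF fin] by (auto simp: not_less[symmetric])
    then show ?thesis by blast
  qed
  fix x y assume xy: "x \<in> carrier S" "y \<in> carrier S" "x \<otimes> y \<in> I"
  show "x \<in> I \<or> y \<in> I"
  proof (rule ccontr)
    assume "\<not> (x \<in> I \<or> y \<in> I)"
    then obtain i j where i: "hc x i \<notin> I" "\<And>k. k > i \<Longrightarrow> hc x k \<in> I" and j: "hc y j \<notin> I" "\<And>k. k > j \<Longrightarrow> hc y k \<in> I"
      using top xy by metis
    let ?f = "\<lambda>s. hc x s \<otimes> hc y (i + j - s)"
    have split: "{..i + j} = insert i ({..i + j} - {i})" by auto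
    have "finsum S ?f ({..i + j} - {i}) \<in> I"
    proof (rule S.ideal_finsum[OF iI])
      fix s assume "s \<in> {..i + j} - {i}"
      then consider "s > i" | "i + j - s > j" by force
      then show "?f s \<in> I"
        using i(2) j(2) xy ideal_closed(4,5)[OF iI] by cases auto
    qed auto
    moreover have "hc (x \<otimes> y) (i + j) \<in> I" by (rule homogeneous_idealD(2)[OF I xy(3)])
    moreover have "hc (x \<otimes> y) (i + j) = ?f i \<oplus> finsum S ?f ({..i + j} - {i})"
      unfolding hc_mult[OF xy(1,2)] by (subst split, subst S.finsum_insert) (use xy in auto)
    ultimately have "(?f i \<oplus> finsum S ?f ({..i + j} - {i})) \<ominus> finsum S ?f ({..i + j} - {i}) \<in> I"
      using ideal_closed(3,6)[OF iI] by (simp add: S.minus_eq)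
    moreover have "finsum S ?f ({..i + j} - {i}) \<in> carrier S" "?f i \<in> carrier S" using xy by auto
    ultimately have "?f i \<in> I" by (simp add: S.minus_eq S.a_assoc S.r_neg)
    then have "hc x i \<otimes> hc y j \<in> I" by simp
    then show False using prime[OF hc_props(1)[OF xy(1)] hc_props(1)[OF xy(2)]] i(1) j(1) by blast
  qed
qed

text \<open>The irrelevant ideal, described by a missing constant term instead of by sums of
  components; \<open>irrelevant_ideal_eq\<close> identifies the two.\<close>

definition positive_part :: "'a set" where
  "positive_part = {x \<in> carrier S. hc x 0 = \<zero>}"

lemma hc_mult_0: "x \<in> carrier S \<Longrightarrow> y \<in> carrier S \<Longrightarrow> hc (x \<otimes> y) 0 = hc x 0 \<otimes> hc y 0"
  by (simp add: hc_mult)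

lemma positive_part_prime: "primeideal positive_part S"
proof (rule primeidealI)
  show "ideal positive_part S"
    by (rule S.ideal_if_closed) (auto simp: positive_part_def hc_add hc_mult_0)
  show "cring S" by (rule S.is_cring)
  have "\<one> \<notin> positive_part"
    using subfieldE(6)[OF gr0_subfield] by (simp add: positive_part_def hc_homogeneous[OF one_gr])
  then show "carrier S \<noteq> positive_part" using S.one_closed by blast
  fix x y assume xy: "x \<in> carrier S" "y \<in> carrier S" "x \<otimes> y \<in> positive_part"
  then have "hc x 0 \<otimes> hc y 0 = \<zero>" by (simp add: positive_part_def hc_mult_0)
  then show "x \<in> positive_part \<or> y \<in> positive_part"
    using subfieldE(5)[OF gr0_subfield hc_props(1)[OF xy(1)] hc_props(1)[OF xy(2)]] xy
    by (auto simp: positive_part_def)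
qed

text \<open>The degree zero part is a field, so a nonzero constant term of an element of
  \<open>I\<close>, which lies in \<open>I\<close> by homogeneity, would be a unit in
  \<open>I\<close>.\<close>

lemma homogeneous_proper_subset:
  assumes I: "homogeneous_ideal I" and ne: "I \<noteq> carrier S"
  shows "I \<subseteq> positive_part"
proof
  fix x assume x: "x \<in> I"
  note iI = homogeneous_idealD(1)[OF I]
  have xc: "x \<in> carrier S" using ideal_closed(1)[OF iI x] .
  have "hc x 0 = \<zero>"
  proof (rule ccontr)
    assume "hc x 0 \<noteq> \<zero>"
    then have h: "hc x 0 \<in> gr 0 - {\<zero>}" using hc_props(1)[OF xc] by auto
    have "inv (hc x 0) \<otimes> hc x 0 \<in> I"
      using S.subfield_m_inv(1)[OF gr0_subfield h] gr_carrier homogeneous_idealD(2)[OF I x]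
      by (intro ideal_closed(4)[OF iI]) auto
    then have "\<one> \<in> I" using S.subfield_m_inv(3)[OF gr0_subfield h] by simp
    then have "y \<in> I" if "y \<in> carrier S" for y using ideal_closed(4)[OF iI, of \<one> y] that by simp
    then show False using ne ideal_closed(1)[OF iI] by blast
  qed
  then show "x \<in> positive_part" using xc by (simp add: positive_part_def)
qed

text \<open>The image of \<open>Fil n\<close> in the quotient by \<open>I\<close> has dimension at
  most \<open>N\<close> over the degree zero field. Spanning lists in the ring express this without
  a quotient vector space.\<close>

definition covered :: "'a set \<Rightarrow> nat \<Rightarrow> nat \<Rightarrow> bool" where
  "covered I n N \<longleftrightarrow> (\<exists>Es. set Es \<subseteq> carrier S \<and> length Es \<le> N \<and>
     (\<forall>x\<in>Fil n. \<exists>s\<in>S.Span (gr 0) Es. \<exists>y\<in>I. x = s \<oplus> y))"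

lemma covered_mono: "covered I n M \<Longrightarrow> M \<le> N \<Longrightarrow> covered I n N"
  unfolding covered_def using order_trans by blast

lemma Span_append_add:
  assumes "set Us \<subseteq> carrier S" "set Vs \<subseteq> carrier S" "s \<in> S.Span (gr 0) Us" "t \<in> S.Span (gr 0) Vs"
  shows "s \<oplus> t \<in> S.Span (gr 0) (Us @ Vs)"
  using S.mono_Span_append[OF gr0_subfield assms(1,2)] S.mono_Span_append[OF gr0_subfield assms(2,1)] assms
    S.Span_subgroup_props(3)[OF gr0_subfield, of "Us @ Vs" s t]
  by auto

text \<open>The exact sequence \<open>S/I' (-e) \<rightarrow> S/I \<rightarrow> S/(I + zS) \<rightarrow> 0\<close> given by multiplication with \<open>z\<close>.\<close>

lemma covered_step:
  assumes I: "homogeneous_ideal I" and z: "z \<in> gr e"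
    and I': "ideal I' S" "\<And>y. y \<in> I' \<Longrightarrow> z \<otimes> y \<in> I"
    and N: "covered (adjoin I z) n N" and M: "e \<le> n \<Longrightarrow> covered I' (n - e) M"
  shows "covered I n (N + M)"
proof -
  note zc = gr_carrier[OF z] and iI = homogeneous_idealD(1)[OF I]
  obtain Es where Es: "set Es \<subseteq> carrier S" "length Es \<le> N"
      "\<And>x. x \<in> Fil n \<Longrightarrow> \<exists>s\<in>S.Span (gr 0) Es. \<exists>y\<in>adjoin I z. x = s \<oplus> y"
    using N unfolding covered_def by blast
  obtain Es' where Es': "set Es' \<subseteq> carrier S" "length Es' \<le> M"
      "\<And>x. e \<le> n \<Longrightarrow> x \<in> Fil (n - e) \<Longrightarrow> \<exists>s\<in>S.Span (gr 0) Es'. \<exists>y\<in>I'. x = s \<oplus> y"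
  proof (cases "e \<le> n")
    case True
    then show thesis using M that unfolding covered_def by blast
  next
    case False
    then show thesis using that[of "[]"] by simp
  qed
  \<comment> \<open>The elements of \<open>Es\<close> may have components above degree
    \<open>n\<close>, so the decomposition of \<open>x\<close> is truncated at \<open>n\<close>.
    Truncation turns \<open>z \<otimes> b\<close> into \<open>z\<close> times the truncation of
    \<open>b\<close> at \<open>n - e\<close>, to which the cover modulo \<open>I'\<close> applies,
    or into zero if \<open>e\<close> exceeds \<open>n\<close>.\<close>
  let ?T = "map (trunc n) Es" and ?Z = "map ((\<otimes>) z) Es'"
  have T: "set ?T \<subseteq> carrier S" "set ?Z \<subseteq> carrier S" using Es(1) Es'(1) zc by auto
  have "\<exists>s\<in>S.Span (gr 0) (?T @ ?Z). \<exists>y\<in>I. x = s \<oplus> y" if x: "x \<in> Fil n" for x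
  proof -
    obtain s y b where *: "s \<in> S.Span (gr 0) Es" "y \<in> I" "b \<in> carrier S" "x = s \<oplus> (y \<oplus> z \<otimes> b)"
      using Es(3)[OF x] unfolding adjoin_def by blast
    have sc: "s \<in> carrier S" using S.Span_in_carrier[OF subfieldE(3)[OF gr0_subfield] Es(1)] *(1) by blast
    have yc: "y \<in> carrier S" using ideal_closed(1)[OF iI *(2)] .
    have ts: "trunc n s \<in> S.Span (gr 0) ?T"
      by (rule S.Span_image[OF gr0_subfield Es(1) _ _ _ *(1)]) (auto simp: trunc_add trunc_smult)
    have ty: "trunc n y \<in> I" by (rule homogeneous_idealD(3)[OF I *(2)])
    have x_eq: "x = trunc n s \<oplus> (trunc n y \<oplus> trunc n (z \<otimes> b))"
      using trunc_id[OF x] * sc yc zc by (simp add: trunc_add)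
    have "\<exists>s'\<in>S.Span (gr 0) ?Z. \<exists>y'\<in>I. trunc n (z \<otimes> b) = s' \<oplus> y'"
    proof (cases "e \<le> n")
      case True
      obtain s' y' where **: "s' \<in> S.Span (gr 0) Es'" "y' \<in> I'" "trunc (n - e) b = s' \<oplus> y'"
        using Es'(3)[OF True trunc_Fil[OF *(3)]] by blast
      have c: "s' \<in> carrier S" "y' \<in> carrier S"
        using S.Span_in_carrier[OF subfieldE(3)[OF gr0_subfield] Es'(1)] **(1) ideal_closed(1)[OF I'(1) **(2)] by blast+
      have "z \<otimes> s' \<in> S.Span (gr 0) ?Z"
        by (rule S.Span_image[OF gr0_subfield Es'(1) _ _ _ **(1)])
          (use zc in \<open>auto simp: S.r_distr S.m_lcomm gr_carrier\<close>)
      moreover have "trunc n (z \<otimes> b) = z \<otimes> s' \<oplus> z \<otimes> y'"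
        using True trunc_mult_homogeneous[OF z *(3), of n] **(3) c zc by (simp add: S.r_distr)
      ultimately show ?thesis using I'(2)[OF **(2)] by blast
    next
      case False
      have "\<zero> \<in> S.Span (gr 0) ?Z" by (rule S.Span_subgroup_props(2)[OF gr0_subfield T(2)])
      moreover have "trunc n (z \<otimes> b) = \<zero> \<oplus> \<zero>"
        using False trunc_mult_homogeneous[OF z *(3), of n] by simp
      ultimately show ?thesis using ideal_closed(2)[OF iI] by blast
    qed
    then obtain s' y' where **: "s' \<in> S.Span (gr 0) ?Z" "y' \<in> I" "trunc n (z \<otimes> b) = s' \<oplus> y'" by blast
    have c: "s' \<in> carrier S" "y' \<in> carrier S" "trunc n s \<in> carrier S" "trunc n y \<in> carrier S"
      using S.Span_in_carrier[OF subfieldE(3)[OF gr0_subfield] T(2)] **(1) ideal_closed(1)[OF iI **(2)] sc yc by auto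
    have "x = (trunc n s \<oplus> s') \<oplus> (trunc n y \<oplus> y')"
      using x_eq **(3) c by (simp add: S.a_ac)
    moreover have "trunc n s \<oplus> s' \<in> S.Span (gr 0) (?T @ ?Z)" by (rule Span_append_add[OF T ts **(1)])
    moreover have "trunc n y \<oplus> y' \<in> I" by (rule ideal_closed(3)[OF iI ty **(2)])
    ultimately show ?thesis by blast
  qed
  moreover have "length (?T @ ?Z) \<le> N + M" using Es(2) Es'(2) by simp
  moreover have "set (?T @ ?Z) \<subseteq> carrier S" using T by simp
  ultimately show ?thesis unfolding covered_def by blast
qed

end

section \<open>Growth and Krull dimension\<close>

text \<open>An infinite strictly ascending sequence of ideals would be a chain whose union belongs
  to it, so the sequence would be stationary.\<close>

lemma (in noetherian_ring) ideal_wf: "wf {(J, I). ideal I R \<and> ideal J R \<and> I \<subset> J}"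
proof (rule ccontr)
  assume "\<not> ?thesis"
  then obtain f where f: "\<And>i. (f (Suc i), f i) \<in> {(J, I). ideal I R \<and> ideal J R \<and> I \<subset> J}"
    unfolding wf_iff_no_infinite_down_chain by blast
  have "f i \<subseteq> f j" if "i \<le> j" for i j
    using lift_Suc_mono_le[of f i j] f that by blast
  then have "subset.chain {I. ideal I R} (range f)"
    using f nat_le_linear unfolding subset.chain_def by (auto simp: subset_iff) blast+
  then have "\<Union>(range f) \<in> range f" by (intro ideal_chain_is_trivial) auto
  then obtain i where "\<Union>(range f) = f i" by auto
  then have "f (Suc i) \<subseteq> f i" by blast
  then show False using f[of i] by blast
qed

text \<open>The exchange lemma compares two independent lists. Dropping redundant vectors turns the
  spanning list into an independent one with the same span that is no longer than it.\<close>

lemma (in ring) spanning_length_bound: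
  assumes K: "subfield K R" and Vs: "set Vs \<subseteq> carrier R" and Us: "set Us \<subseteq> Span K Vs" "independent K Us"
  shows "length Us \<le> length Vs"
proof -
  have "\<exists>Ws. independent K Ws \<and> Span K Ws = Span K Vs \<and> length Ws \<le> length Vs"
    using Vs
  proof (induction Vs)
    case Nil
    then show ?case by (intro exI[of _ "[]"]) (auto intro: li_Nil)
  next
    case (Cons v Vs)
    then obtain Ws where Ws: "independent K Ws" "Span K Ws = Span K Vs" "length Ws \<le> length Vs" by auto
    have Wc: "set Ws \<subseteq> carrier R" by (rule independent_in_carrier[OF Ws(1)])
    have eq: "Span K (v # Vs) = Span K (v # Ws)" 
    proof -
      have "Span K (v # Us) = line_extension K v (Span K Us)" for Us by simp
      then show ?thesis by (simp only: Ws(2))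
    qed
    show ?case
    proof (cases "v \<in> Span K Ws")
      case True
      have "Span K (v # Ws) \<subseteq> Span K Ws"
        using True Span_base_incl[OF K Wc] by (intro mono_Span_subset[OF K _ Wc]) auto
      moreover have "Span K Ws \<subseteq> Span K (v # Ws)"
        using Cons.prems Wc by (intro mono_Span[OF K]) auto
      ultimately show ?thesis using eq Ws by (intro exI[of _ Ws]) auto
    next
      case False
      then have "independent K (v # Ws)" using Cons.prems Ws(1) by (intro li_Cons) auto
      then show ?thesis using eq Ws(3) by (intro exI[of _ "v # Ws"]) auto
    qed
  qed
  then obtain Ws where "independent K Ws" "Span K Ws = Span K Vs" "length Ws \<le> length Vs" by blast
  then show ?thesis using independent_length_le[OF K Us(2), of Ws] Us(1) by simp
qed

lemma (in ring) combine_eq_finsum: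
  assumes "distinct bs" "length Ks = length bs" "set Ks \<subseteq> carrier R" "g \<in> set bs \<rightarrow> carrier R"
  shows "combine Ks (map g bs) = (\<Oplus>b\<in>set bs. the (map_of (zip bs Ks) b) \<otimes> g b)"
  using assms
proof (induction bs arbitrary: Ks)
  case (Cons b bs)
  obtain k Ks' where Ks: "Ks = k # Ks'" using Cons.prems(2) by (cases Ks) auto
  have c: "the (map_of (zip bs Ks') x) \<in> carrier R" if x: "x \<in> set bs" for x
  proof -
    have "x \<in> dom (map_of (zip bs Ks'))" using Cons.prems(2) Ks x by simp
    then obtain y where y: "map_of (zip bs Ks') x = Some y" unfolding domIff by (rule not_None_eq[THEN iffD1, THEN exE])
    have "y \<in> set Ks'" using set_zip_rightD[OF map_of_SomeD[OF y]] .
    then show ?thesis using y Cons.prems(3) Ks by auto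
  qed
  have "(\<Oplus>x\<in>set bs. the (map_of (zip (b # bs) Ks) x) \<otimes> g x) = (\<Oplus>x\<in>set bs. the (map_of (zip bs Ks') x) \<otimes> g x)"
    by (rule finsum_cong') (use Cons.prems Ks c in auto)
  also have "\<dots> = combine Ks' (map g bs)" by (rule Cons.IH[symmetric]) (use Cons.prems Ks in auto)
  finally have "(\<Oplus>x\<in>set bs. the (map_of (zip (b # bs) Ks) x) \<otimes> g x) = combine Ks' (map g bs)" .
  moreover have "(\<Oplus>x\<in>set (b # bs). the (map_of (zip (b # bs) Ks) x) \<otimes> g x)
      = k \<otimes> g b \<oplus> (\<Oplus>x\<in>set bs. the (map_of (zip (b # bs) Ks) x) \<otimes> g x)"
    unfolding list.set by (subst finsum_insert) (use Cons.prems Ks c in auto)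
  ultimately show ?case by (simp add: Ks)
qed simp

context graded_algebra
begin

text \<open>The quotient by \<open>I\<close> has Krull dimension at most \<open>r\<close>, phrased
  through chains of primes of \<open>S\<close> that contain \<open>I\<close>.\<close>

definition chain_bound :: "'a set \<Rightarrow> nat \<Rightarrow> bool" where
  "chain_bound I r \<longleftrightarrow> (\<forall>n P. (\<forall>i\<le>n. primeideal (P i) S) \<and> (\<forall>i<n. P i \<subset> P (Suc i)) \<and> I \<subseteq> P 0 \<longrightarrow> n \<le> r)"

lemma chain_boundD:
  "chain_bound I r \<Longrightarrow> (\<And>i. i \<le> n \<Longrightarrow> primeideal (P i) S) \<Longrightarrow> (\<And>i. i < n \<Longrightarrow> P i \<subset> P (Suc i)) \<Longrightarrow> I \<subseteq> P 0 \<Longrightarrow> n \<le> r"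
  unfolding chain_bound_def by blast

lemma chain_bound_mono: "chain_bound I r \<Longrightarrow> I \<subseteq> J \<Longrightarrow> chain_bound J r"
  unfolding chain_bound_def by (meson order_trans)

text \<open>Any chain of primes above \<open>J\<close> is lengthened by putting the prime
  \<open>I\<close> in front.\<close>

lemma chain_bound_prime:
  assumes b: "chain_bound I r" and I: "primeideal I S" and J: "I \<subset> J"
  shows "chain_bound J (r - 1)"
  unfolding chain_bound_def
proof (intro allI impI, elim conjE)
  fix n P assume P: "\<forall>i\<le>n. primeideal (P i) S" "\<forall>i<n. P i \<subset> P (Suc i)" "J \<subseteq> P 0"
  let ?P = "case_nat I P"
  have "Suc n \<le> r"
  proof (rule chain_boundD[OF b, of "Suc n" ?P])
    show "primeideal (?P i) S" if "i \<le> Suc n" for i using that I P(1) by (cases i) auto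
    show "?P i \<subset> ?P (Suc i)" if "i < Suc n" for i using that J P(2,3) by (cases i) auto
  qed auto
  then show "n \<le> r - 1" by simp
qed

text \<open>The upper bound in the theorem of Hilbert and Serre, by Noetherian induction on
  \<open>I\<close>. If \<open>I\<close> is not prime, there are homogeneous \<open>x\<close>,
  \<open>y\<close> outside \<open>I\<close> with product in \<open>I\<close>, and the growth modulo
  \<open>I\<close> is bounded by that modulo \<open>adjoin I x\<close> plus that modulo
  \<open>adjoin I y\<close>. If \<open>I\<close> is prime and misses a homogeneous \<open>z\<close>
  of positive degree, the dimension drops modulo \<open>adjoin I z\<close>, and summing the bound
  there over the degrees raises the exponent by one. Otherwise the quotient is zero or the ground
  field.\<close>

lemma covered_polynomial:
  assumes noeth: "noetherian_ring S" and I: "homogeneous_ideal I" and b: "chain_bound I r"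
  shows "\<exists>C. \<forall>n. covered I n (C * (n + 1) ^ r)"
  using I b
proof (induction I arbitrary: r rule: wf_induct_rule[OF noetherian_ring.ideal_wf[OF noeth]])
  case (1 I)
  note I = \<open>homogeneous_ideal I\<close> and b = \<open>chain_bound I r\<close>
  note iI = homogeneous_idealD(1)[OF I]
  have IH: "\<exists>C. \<forall>n. covered (adjoin I z) n (C * (n + 1) ^ k)"
    if z: "z \<in> gr e" "z \<notin> I" and k: "chain_bound (adjoin I z) k" for z e k
  proof -
    have "ideal (adjoin I z) S" "I \<subset> adjoin I z"
      using adjoin_ideal(1-3)[OF iI gr_carrier[OF z(1)]] z(2) by auto
    then show ?thesis using 1(1)[of "adjoin I z" k] adjoin_homogeneous[OF I z(1)] k iI by blast
  qed
  consider (whole) "I = carrier S" | (positive) "I \<noteq> carrier S" "positive_part \<subseteq> I"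
    | (prime) z e where "primeideal I S" "I \<noteq> carrier S" "z \<in> gr e" "z \<notin> I" "e > 0"
    | (split) x y m n where "x \<in> gr m" "y \<in> gr n" "x \<otimes> y \<in> I" "x \<notin> I" "y \<notin> I"
  proof (cases "I = carrier S")
    case True
    then show thesis by (rule whole)
  next
    case ne: False
    show thesis
    proof (cases "\<exists>x y m n. x \<in> gr m \<and> y \<in> gr n \<and> x \<otimes> y \<in> I \<and> x \<notin> I \<and> y \<notin> I")
      case True
      then show thesis using split by blast
    next
      case False
      then have prime_I: "primeideal I S" by (intro homogeneous_primeI[OF I ne]) blast
      show thesis
      proof (cases "\<exists>z e. z \<in> gr e \<and> z \<notin> I \<and> e > 0")
        case True
        then show thesis using prime prime_I ne by blast
      next
        case False
        have "positive_part \<subseteq> I"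
        proof
          fix x assume x: "x \<in> positive_part"
          then have xc: "x \<in> carrier S" "hc x 0 = \<zero>" by (auto simp: positive_part_def)
          have "hc x i \<in> I" for i
            using False hc_props(1)[OF xc(1), of i] xc(2) ideal_closed(2)[OF iI] by (cases "i = 0") auto
          then have "finsum S (hc x) {n. hc x n \<noteq> \<zero>} \<in> I" by (intro S.ideal_finsum[OF iI hc_props(2)[OF xc(1)]])
          then show "x \<in> I" using hc_props(3)[OF xc(1)] by simp
        qed
        then show thesis using positive ne by blast
      qed
    qed
  qed
  then show ?case
  proof cases
    case whole
    have "covered I n 0" for n
      unfolding covered_def whole by (rule exI[of _ "[]"]) (auto simp: Fil_def)
    then show ?thesis by (intro exI[of _ 0]) simp
  next
    case positive
    have "covered I n 1" for n
      unfolding covered_def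
    proof (intro exI[of _ "[\<one>]"] conjI ballI)
      fix x assume "x \<in> Fil n"
      then have xc: "x \<in> carrier S" by (simp add: Fil_def)
      have h: "hc x 0 \<in> gr 0" by (rule hc_props(1)[OF xc])
      have "hc (x \<ominus> hc x 0) 0 = \<zero>"
      proof -
        have "hc x 0 = hc ((x \<ominus> hc x 0) \<oplus> hc x 0) 0" using xc by (simp add: S.minus_eq S.a_assoc S.l_neg)
        also have "\<dots> = hc (x \<ominus> hc x 0) 0 \<oplus> hc (hc x 0) 0" using xc by (intro hc_add) auto
        also have "hc (hc x 0) 0 = hc x 0" by (simp add: hc_homogeneous[OF h])
        finally show ?thesis using xc S.add.l_cancel_one'[of "hc x 0" "hc (x \<ominus> hc x 0) 0"] by (simp add: S.a_comm)
      qed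
      then have "x \<ominus> hc x 0 \<in> I" using positive(2) xc S.minus_closed[OF xc hc_closed[OF xc]] unfolding positive_part_def by blast
      moreover have "hc x 0 \<otimes> \<one> \<oplus> \<zero> \<in> S.Span (gr 0) [\<one>]"
      proof -
        have "S.Span (gr 0) [\<one>] = S.line_extension (gr 0) \<one> {\<zero>}" by simp
        then show ?thesis 
          using h by (simp only:) (rule S.line_extension_mem_iff[THEN iffD2], blast)
      qed
      moreover have "x = (hc x 0 \<otimes> \<one> \<oplus> \<zero>) \<oplus> (x \<ominus> hc x 0)"
        using xc by (simp add: S.minus_eq S.a_lcomm S.r_neg)
      ultimately show "\<exists>s\<in>S.Span (gr 0) [\<one>]. \<exists>y\<in>I. x = s \<oplus> y" by blast
    qed auto
    then have "covered I n (1 * (n + 1) ^ r)" for n by (rule covered_mono) simp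
    then show ?thesis by blast
  next
    case prime
    have zc: "z \<in> carrier S" using gr_carrier[OF prime(3)] .
    have "I \<subset> adjoin I z" using adjoin_ideal(2,3)[OF iI zc] prime(4) by auto
    then have b': "chain_bound (adjoin I z) (r - 1)" by (rule chain_bound_prime[OF b prime(1)])
    then obtain C where C: "\<And>n. covered (adjoin I z) n (C * (n + 1) ^ (r - 1))"
      using IH[OF prime(3,4)] by blast
    have "z \<in> positive_part" using zc prime(5) by (simp add: positive_part_def hc_homogeneous[OF prime(3)])
    then have "I \<subset> positive_part" using homogeneous_proper_subset[OF I prime(2)] prime(4) by auto
    \<comment> \<open>The chain from \<open>I\<close> to \<open>positive_part\<close> shows that
      \<open>r\<close> is positive, so that \<open>r - 1\<close> is a genuine predecessor.\<close>
    then have "Suc 0 \<le> r"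
      by (intro chain_boundD[OF b, of "Suc 0" "case_nat I (\<lambda>_. positive_part)"])
        (use prime(1) positive_part_prime in \<open>auto simp: le_Suc_eq\<close>)
    then obtain q where q: "r = Suc q" by (cases r) auto
    have "covered I n (C * (n + 1) ^ r)" for n
    proof (induction n rule: less_induct)
      case (less n)
      show ?case
      proof (cases "n = 0")
        case True
        then show ?thesis using covered_step[OF I prime(3) iI _ C[of n], of 0] prime(5) ideal_closed(4)[OF iI] zc by auto
      next
        case False
        \<comment> \<open>Since \<open>e\<close> is positive, \<open>n - e + 1\<close> is at most
          \<open>n\<close>; the induction hypothesis thus leaves a gap to the bound for
          \<open>n\<close>, large enough for the contribution of \<open>adjoin I z\<close>.\<close>
        have "covered I (n - e) (C * n ^ r)" if "e \<le> n"
        proof (rule covered_mono)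
          show "covered I (n - e) (C * (n - e + 1) ^ r)" using prime(5) False by (intro less) auto
          show "C * (n - e + 1) ^ r \<le> C * n ^ r" using that prime(5) by (intro mult_le_mono2 power_mono) auto
        qed
        then have "covered I n (C * (n + 1) ^ (r - 1) + C * n ^ r)"
          using ideal_closed(4)[OF iI] zc by (intro covered_step[OF I prime(3) iI _ C]) auto
        \<comment> \<open>With \<open>r = Suc q\<close> this reduces to
          \<open>(n + 1) ^ q + n * n ^ q \<le> (n + 1) ^ Suc q\<close>, so the constant
          \<open>C\<close> obtained modulo \<open>adjoin I z\<close> also serves for
          \<open>I\<close>.\<close>
        moreover have "C * (n + 1) ^ (r - 1) + C * n ^ r \<le> C * (n + 1) ^ r"
        proof -
          have "n ^ q \<le> (n + 1) ^ q" by (rule power_mono) auto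
          then have "(n + 1) ^ q + n * n ^ q \<le> (n + 1) ^ q + n * (n + 1) ^ q" by (intro add_left_mono mult_le_mono2)
          then have "C * ((n + 1) ^ (r - 1) + n ^ r) \<le> C * (n + 1) ^ r" unfolding q by (intro mult_le_mono2) simp
          then show ?thesis by (simp add: distrib_left)
        qed
        ultimately show ?thesis by (rule covered_mono)
      qed
    qed
    then show ?thesis by blast
  next
    case split
    note c = gr_carrier[OF split(1)] gr_carrier[OF split(2)]
    have bx: "chain_bound (adjoin I x) r" "chain_bound (adjoin I y) r"
      using adjoin_ideal(2)[OF iI] c b chain_bound_mono by blast+
    obtain C D where C: "\<And>n. covered (adjoin I x) n (C * (n + 1) ^ r)"
      and D: "\<And>n. covered (adjoin I y) n (D * (n + 1) ^ r)"
      using IH[OF split(1,4) bx(1)] IH[OF split(2,5) bx(2)] by blast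
    \<comment> \<open>Multiplication by \<open>x\<close> sends \<open>y\<close> into
      \<open>I\<close>, so \<open>adjoin I y\<close> can take the place of the annihilator of
      \<open>x\<close> modulo \<open>I\<close> in \<open>covered_step\<close>.\<close>
    have xI: "x \<otimes> w \<in> I" if w: "w \<in> adjoin I y" for w
    proof -
      obtain p b where w: "w = p \<oplus> y \<otimes> b" "p \<in> I" "b \<in> carrier S" using w by (auto simp: adjoin_def)
      then have "x \<otimes> w = x \<otimes> p \<oplus> (x \<otimes> y) \<otimes> b"
        using c ideal_closed(1)[OF iI w(2)] by (simp add: S.r_distr S.m_assoc)
      then show ?thesis using ideal_closed(3,4,5)[OF iI] w(2,3) split(3) c by simp
    qed
    have "covered I n ((C + D) * (n + 1) ^ r)" for n
    proof -
      have "covered (adjoin I y) (n - m) (D * (n + 1) ^ r)"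
        by (rule covered_mono[OF D]) (intro mult_le_mono2 power_mono, auto)
      then have "covered I n (C * (n + 1) ^ r + D * (n + 1) ^ r)"
        by (intro covered_step[OF I split(1) adjoin_ideal(1)[OF iI c(2)] xI C])
      then show ?thesis by (simp add: distrib_right)
    qed
    then show ?thesis by blast
  qed
qed

section \<open>Algebraic dependence by counting monomials\<close>

lemma finite_Fil_bound:
  assumes "\<And>i. i < (d::nat) \<Longrightarrow> a i \<in> carrier S"
  shows "\<exists>e. \<forall>i<d. a i \<in> Fil e"
  using assms
proof (induction d)
  case (Suc d)
  have "\<exists>e. \<forall>i<d. a i \<in> Fil e" by (rule Suc.IH) (simp add: Suc.prems)
  then obtain e where e: "\<forall>i<d. a i \<in> Fil e" by blast
  have "a d \<in> carrier S" by (simp add: Suc.prems)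
  then obtain e' where e': "a d \<in> Fil e'" by (rule Fil_exists)
  have "a i \<in> Fil (max e e')" if "i < Suc d" for i
    using that e e' Fil_mono[of e "max e e'"] Fil_mono[of e' "max e e'"] by (cases "i = d") auto
  then show ?case by blast
qed simp

lemma Fil_pow: "x \<in> Fil e \<Longrightarrow> x [^] (n::nat) \<in> Fil (n * e)"
proof (induction n)
  case (Suc n)
  then show ?case using Fil_mult[of "x [^] n" "n * e" x e] by (simp add: add.commute)
qed (simp add: Fil_one)

lemma monomial_Fil:
  assumes a: "\<And>i. i < d \<Longrightarrow> a i \<in> Fil e" and \<beta>: "\<And>i. i < d \<Longrightarrow> \<beta> i \<le> s"
  shows "S.monomial d a \<beta> \<in> Fil (d * (s * e))"
  using assms
proof (induction d)
  case 0
  then show ?case by (simp add: S.monomial_def Fil_one)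
next
  case (Suc d)
  have ac: "a i \<in> carrier S" if "i < Suc d" for i using Suc.prems(1)[OF that] by (simp add: Fil_def)
  have "S.monomial (Suc d) a \<beta> = a d [^] \<beta> d \<otimes> S.monomial d a \<beta>"
    unfolding S.monomial_def lessThan_Suc by (rule S.finprod_insert) (use ac in auto)
  also have "\<dots> \<in> Fil (\<beta> d * e + d * (s * e))"
    using Suc by (intro Fil_mult Fil_pow) auto
  also have "\<dots> \<subseteq> Fil (Suc d * (s * e))"
    using Suc.prems(2)[of d] by (intro Fil_mono) simp
  finally show ?case .
qed

lemma covered_zero_ideal:
  assumes "covered {\<zero>} n N"
  obtains Es where "set Es \<subseteq> carrier S" "length Es \<le> N" "Fil n \<subseteq> S.Span (gr 0) Es"
proof -
  obtain Es where Es: "set Es \<subseteq> carrier S" "length Es \<le> N"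
      "\<forall>x\<in>Fil n. \<exists>s\<in>S.Span (gr 0) Es. \<exists>y\<in>{\<zero>}. x = s \<oplus> y"
    using assms unfolding covered_def by blast
  have "Fil n \<subseteq> S.Span (gr 0) Es"
  proof
    fix x assume "x \<in> Fil n"
    then obtain s where s: "s \<in> S.Span (gr 0) Es" "x = s \<oplus> \<zero>" using Es(3) by blast
    moreover have "s \<in> carrier S"
      using S.Span_in_carrier[OF subfieldE(3)[OF gr0_subfield] Es(1)] s(1) by blast
    ultimately show "x \<in> S.Span (gr 0) Es" by simp
  qed
  then show thesis using Es that by blast
qed

text \<open>Monomials in \<open>d\<close> elements of \<open>Fil e\<close> with exponents at most
  \<open>s\<close> lie in \<open>Fil (d * (s * e))\<close>. There are more of them than the growth
  bound of exponent \<open>r < d\<close> allows for independent elements, provided that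
  \<open>s\<close> is large.\<close>

lemma algebraic_dependence:
  assumes noeth: "noetherian_ring S" and b: "chain_bound {\<zero>} r" and d: "r < d"
    and a: "\<And>i. i < d \<Longrightarrow> a i \<in> carrier S"
  shows "\<exists>B c. finite B \<and> B \<noteq> {} \<and> (\<forall>\<beta>\<in>B. c \<beta> \<in> gr 0 - {\<zero>}) \<and> (\<forall>\<beta>\<in>B. \<forall>i\<ge>d. \<beta> i = 0) \<and>
    (\<Oplus>\<beta>\<in>B. c \<beta> \<otimes> S.monomial d a \<beta>) = \<zero>"
proof -
  have "homogeneous_ideal {\<zero>}"
    unfolding homogeneous_ideal_def using S.zeroideal by simp
  then obtain C where C: "\<And>n. covered {\<zero>} n (C * (n + 1) ^ r)"
    using covered_polynomial[OF noeth _ b] by blast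
  obtain e where e: "\<And>i. i < d \<Longrightarrow> a i \<in> Fil e" using finite_Fil_bound[where a = a and d = d, OF a] by blast
  \<comment> \<open>The choice that makes the count work: \<open>n + 1\<close> is at most
    \<open>(d * e + 1) * (s + 1)\<close>, so the spanning list has length at most
    \<open>s * (s + 1) ^ r\<close>, which is less than \<open>(s + 1) ^ Suc r\<close>.\<close>
  define s where "s = C * (d * e + 1) ^ r"
  define n where "n = d * (s * e)"
  obtain Es where Es: "set Es \<subseteq> carrier S" "length Es \<le> C * (n + 1) ^ r" "Fil n \<subseteq> S.Span (gr 0) Es"
    by (rule covered_zero_ideal[OF C])
  have "C * (n + 1) ^ r \<le> C * ((d * e + 1) * (s + 1)) ^ r"
    by (intro mult_le_mono2 power_mono) (auto simp: n_def algebra_simps)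
  also have "\<dots> = (C * (d * e + 1) ^ r) * (s + 1) ^ r" by (simp only: power_mult_distrib mult.assoc)
  also have "\<dots> = s * (s + 1) ^ r" by (simp only: s_def[symmetric])
  also have "\<dots> < (s + 1) ^ Suc r" by simp
  also have "\<dots> \<le> (s + 1) ^ d" using d by (intro power_increasing) auto
  finally have len: "length Es < (s + 1) ^ d" using Es(2) by simp
  \<comment> \<open>Members of the extensional function space are \<open>undefined\<close> outside
    the first \<open>d\<close> indices; resetting them to zero there gives exponents of the required
    shape and loses no information.\<close>
  define Ex where "Ex = (\<lambda>\<beta> i. if i < d then \<beta> i else 0 :: nat) ` ({..<d} \<rightarrow>\<^sub>E {..s})"
  have inj: "inj_on (\<lambda>\<beta> i. if i < d then \<beta> i else 0 :: nat) ({..<d} \<rightarrow>\<^sub>E {..s})"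
  proof (rule inj_onI)
    fix \<beta> \<gamma> assume *: "\<beta> \<in> {..<d} \<rightarrow>\<^sub>E {..s}" "\<gamma> \<in> {..<d} \<rightarrow>\<^sub>E {..s}"
      "(\<lambda>i. if i < d then \<beta> i else 0) = (\<lambda>i. if i < d then \<gamma> i else 0)"
    have "\<beta> i = \<gamma> i" if "i < d" for i using fun_cong[OF *(3), of i] that by simp
    then show "\<beta> = \<gamma>" using *(1,2) by (intro PiE_ext[of \<beta> "{..<d}" "\<lambda>_. {..s}"]) auto
  qed
  have finE: "finite Ex" unfolding Ex_def by (intro finite_imageI finite_PiE) auto
  have cardE: "card Ex = (s + 1) ^ d" unfolding Ex_def card_image[OF inj] by (simp add: card_PiE)
  have Ex: "\<beta> i \<le> s" "d \<le> i \<Longrightarrow> \<beta> i = 0" if "\<beta> \<in> Ex" for \<beta> i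
    using that by (auto simp: Ex_def PiE_def Pi_def)
  obtain bs where bs: "set bs = Ex" "distinct bs" using finite_distinct_list[OF finE] by blast
  let ?Us = "map (S.monomial d a) bs"
  have Us: "set ?Us \<subseteq> S.Span (gr 0) Es"
    using Es(3) monomial_Fil[where a = a and d = d and e = e and s = s, OF e] Ex(1) bs(1) unfolding n_def by auto
  have len_bs: "length bs = (s + 1) ^ d" using bs cardE distinct_card by metis
  have "\<not> S.independent (gr 0) ?Us"
    using S.spanning_length_bound[OF gr0_subfield Es(1) Us] len len_bs by auto
  moreover have Uc: "set ?Us \<subseteq> carrier S" using a by auto
  ultimately obtain Ks where Ks: "length Ks = length ?Us" "S.combine Ks ?Us = \<zero>" "set Ks \<subseteq> gr 0" "set Ks \<noteq> {\<zero>}"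
    using S.dependent_imp_non_trivial_combine[OF gr0_subfield] by blast
  define c where "c \<beta> = the (map_of (zip bs Ks) \<beta>)" for \<beta>
  have Kc: "set Ks \<subseteq> carrier S" using Ks(3) gr_carrier by blast
  have sum0: "(\<Oplus>\<beta>\<in>Ex. c \<beta> \<otimes> S.monomial d a \<beta>) = \<zero>"
    using S.combine_eq_finsum[OF bs(2) _ Kc, of "S.monomial d a"] Ks(1,2) a unfolding c_def bs(1) by simp
  have c_nth: "c (bs ! k) = Ks ! k" if "k < length bs" for k
    using map_of_zip_nth[of bs Ks k] Ks(1) bs(2) that by (simp add: c_def)
  have cg: "c \<beta> \<in> gr 0" if "\<beta> \<in> Ex" for \<beta>
  proof -
    obtain k where "k < length bs" "\<beta> = bs ! k" using \<open>\<beta> \<in> Ex\<close> bs(1) by (metis in_set_conv_nth)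
    then show ?thesis using c_nth Ks(1,3) by (auto simp: subset_iff)
  qed
  \<comment> \<open>The condition \<open>set Ks \<noteq> {\<zero>}\<close> would also hold for the
    empty list; the length of \<open>bs\<close>, a power of \<open>s + 1\<close>, rules this
    out.\<close>
  have "\<exists>k<length bs. Ks ! k \<noteq> \<zero>"
  proof (rule ccontr)
    assume "\<not> ?thesis"
    then have "set Ks \<subseteq> {\<zero>}" using Ks(1) by (auto simp: in_set_conv_nth)
    moreover have "Ks \<noteq> []" using Ks(1) len_bs by auto
    ultimately show False using Ks(4) by (cases Ks) auto
  qed
  then obtain k where k: "k < length bs" "c (bs ! k) \<noteq> \<zero>" using c_nth by auto
  define B where "B = {\<beta>\<in>Ex. c \<beta> \<noteq> \<zero>}"
  have "(\<Oplus>\<beta>\<in>B. c \<beta> \<otimes> S.monomial d a \<beta>) = (\<Oplus>\<beta>\<in>Ex. c \<beta> \<otimes> S.monomial d a \<beta>)"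
    by (rule S.add.finprod_mono_neutral_cong_left)
      (use finE a gr_carrier[OF cg] in \<open>auto simp: B_def\<close>)
  moreover have "bs ! k \<in> B" using k bs(1) nth_mem by (auto simp: B_def)
  ultimately show ?thesis
    using finE Ex(2) cg sum0 by (intro exI[of _ B] exI[of _ c]) (auto simp: B_def)
qed

section \<open>Vanishing of alternating derivations above the Krull dimension\<close>

lemma incl_nat_elem: "\<iota> ([n] \<cdot>\<^bsub>K\<^esub> \<one>\<^bsub>K\<^esub>) = [n] \<cdot> \<one>" for n :: nat
proof -
  interpret h: ring_hom_ring K S \<iota>
    by (rule ring_hom_ringI2[OF ring_axioms S.ring_axioms incl_hom])
  show ?thesis by (induction n) auto
qed

lemma incl_closed: "c \<in> carrier K \<Longrightarrow> \<iota> c \<in> carrier S"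
  using incl_image gr_carrier by blast

sublocale over: cring_over K S \<iota>
  by (intro cring_over.intro cring_over_axioms.intro S.is_cring incl_closed)

lemma perfect_root:
  assumes perf: "perfect_field K" and p: "Factorial_Ring.prime (p::nat)" "[p] \<cdot> \<one> = \<zero>" and x: "x \<in> gr 0"
  shows "\<exists>y\<in>gr 0. y [^] p = x"
proof -
  interpret h: ring_hom_ring K S \<iota>
    by (rule ring_hom_ringI2[OF ring_axioms S.ring_axioms incl_hom])
  have "\<iota> ([p] \<cdot>\<^bsub>K\<^esub> \<one>\<^bsub>K\<^esub>) = \<iota> \<zero>\<^bsub>K\<^esub>" using incl_nat_elem[of p] p(2) by simp
  then have pK: "[p] \<cdot>\<^bsub>K\<^esub> \<one>\<^bsub>K\<^esub> = \<zero>\<^bsub>K\<^esub>" by (rule inj_onD[OF incl_inj]) auto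
  obtain k where k: "k \<in> carrier K" "x = \<iota> k" using x incl_image by blast
  then obtain y where y: "y \<in> carrier K" "y [^]\<^bsub>K\<^esub> p = k"
    using perf p(1) pK unfolding perfect_field_def by blast
  have "\<iota> (y [^]\<^bsub>K\<^esub> n) = \<iota> y [^] n" for n :: nat using y(1) by (induction n) auto
  from this[of p] have "\<iota> y [^] p = x" using k(2) y(2) by simp
  moreover have "\<iota> y \<in> gr 0" using y(1) incl_image by blast
  ultimately show ?thesis by blast
qed

text \<open>Freezing all entries of \<open>xs\<close> but one turns \<open>D\<close> into
  derivations in one variable. Alternation makes the \<open>i\<close>-th of them send
  \<open>xs ! i\<close> to \<open>D xs\<close> and every other entry to zero, since putting
  \<open>xs ! j\<close> into slot \<open>i\<close> repeats an entry. So they play the part of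
  partial derivatives scaled by \<open>u = D xs\<close>.\<close>

theorem derivation_ideal_zero:
  assumes perf: "perfect_field K" and noeth: "noetherian_ring S" and red: "reduced_ring S"
    and b: "chain_bound {\<zero>} r" and d: "r < d"
  shows "derivation_ideal K S \<iota> d = {\<zero>}"
proof -
  have zero: "D xs = \<zero>" if D: "alternating_derivation K S \<iota> d D" and xs: "length xs = d" "set xs \<subseteq> carrier S" for D xs
  proof -
    note DD = alternating_derivationD[OF D xs]
    have a: "xs ! i \<in> carrier S" if "i < d" for i using that xs by (auto simp: subset_iff)
    have upd: "length (xs[i := x]) = d" "set (xs[i := x]) \<subseteq> carrier S" if "x \<in> carrier S" for i x
      using xs that by (simp_all add: set_list_update_subset)
    obtain B c where B: "finite B" "B \<noteq> {}" "\<And>\<beta>. \<beta> \<in> B \<Longrightarrow> c \<beta> \<in> gr 0 - {\<zero>}"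
      "\<And>\<beta> i. \<beta> \<in> B \<Longrightarrow> d \<le> i \<Longrightarrow> \<beta> i = 0" "(\<Oplus>\<beta>\<in>B. c \<beta> \<otimes> S.monomial d ((!) xs) \<beta>) = \<zero>"
      using algebraic_dependence[where a = "(!) xs", OF noeth b d a] by blast
    show ?thesis
    proof (rule S.derivation_value_zero_of_relation[where a = "(!) xs" and B = B and c = c and d = d
          and \<delta> = "\<lambda>i x. D (xs[i := x])" and u = "D xs", OF gr0_subfield red _ a DD(1) _ _ B(1,2)])
      show "\<exists>y\<in>gr 0. y [^] p = x" if "Factorial_Ring.prime p" "[p] \<cdot> \<one> = \<zero>" "x \<in> gr 0" for p :: nat and x
        using perfect_root[OF perf that] .
      show "c \<beta> \<in> gr 0 - {\<zero>}" "d \<le> i \<Longrightarrow> \<beta> i = 0" if "\<beta> \<in> B" for \<beta> i using B(3,4) that by blast+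
      show "S.derivation (gr 0) (\<lambda>x. D (xs[i := x]))" if i: "i < d" for i
        unfolding S.derivation_def
      proof (intro conjI ballI)
        show "(\<lambda>x. D (xs[i := x])) \<in> carrier S \<rightarrow> carrier S"
          using alternating_derivationD(1)[OF D upd] by blast
        show "D (xs[i := c]) = \<zero>" if "c \<in> gr 0" for c
        proof -
          obtain k where "k \<in> carrier K" "c = \<iota> k" using \<open>c \<in> gr 0\<close> incl_image by blast
          then show ?thesis using DD(4)[OF i] by simp
        qed
      qed (use DD(2,3)[OF i] in auto)
      show "D (xs[i := xs ! j]) = (if i = j then D xs else \<zero>)" if ij: "i < d" "j < d" for i j
      proof (cases "i = j")
        case False
        let ?ys = "xs[i := xs ! j]"
        have eq: "?ys ! min i j = ?ys ! max i j" using False ij xs by (auto simp: min_def max_def)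
        have "min i j < max i j" "max i j < d" using False ij by auto
        then have "D ?ys = \<zero>" using alternating_derivationD(5)[OF D upd[OF a[OF ij(2)]] _ _ eq] by blast
        then show ?thesis using False by simp
      qed simp
      show "D xs \<otimes> (\<Oplus>\<beta>\<in>B. c \<beta> \<otimes> S.monomial d ((!) xs) \<beta>) = \<zero>"
        using B(5) DD(1) by simp
    qed
  qed
  have "derivation_ideal K S \<iota> d \<subseteq> {\<zero>}"
    unfolding derivation_ideal_def by (rule S.genideal_minimal[OF S.zeroideal]) (use zero in auto)
  moreover have "{D xs |D xs. alternating_derivation K S \<iota> d D \<and> length xs = d \<and> set xs \<subseteq> carrier S} \<subseteq> carrier S"
    using alternating_derivationD(1) by blast
  then have "\<zero> \<in> derivation_ideal K S \<iota> d"
    unfolding derivation_ideal_def using ideal_closed(2)[OF S.genideal_ideal] by blast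
  ultimately show ?thesis by blast
qed

end

section \<open>Retracts of rings\<close>

lemma (in cring) derivation_ideal_props:
  shows "ideal (derivation_ideal K R \<iota> d) R"
    and "alternating_derivation K R \<iota> d D \<Longrightarrow> length xs = d \<Longrightarrow> set xs \<subseteq> carrier R \<Longrightarrow> D xs \<in> derivation_ideal K R \<iota> d"
    and "ideal I R \<Longrightarrow> (\<And>D xs. alternating_derivation K R \<iota> d D \<Longrightarrow> length xs = d \<Longrightarrow> set xs \<subseteq> carrier R \<Longrightarrow> D xs \<in> I) \<Longrightarrow>
      derivation_ideal K R \<iota> d \<subseteq> I"
proof -
  have V: "{D xs | D xs. alternating_derivation K R \<iota> d D \<and> length xs = d \<and> set xs \<subseteq> carrier R} \<subseteq> carrier R"
    using alternating_derivationD(1) by blast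
  show "ideal (derivation_ideal K R \<iota> d) R"
    unfolding derivation_ideal_def by (rule genideal_ideal[OF V])
  show "alternating_derivation K R \<iota> d D \<Longrightarrow> length xs = d \<Longrightarrow> set xs \<subseteq> carrier R \<Longrightarrow> D xs \<in> derivation_ideal K R \<iota> d"
    unfolding derivation_ideal_def using genideal_self[OF V] by blast
  show "ideal I R \<Longrightarrow> (\<And>D xs. alternating_derivation K R \<iota> d D \<Longrightarrow> length xs = d \<Longrightarrow> set xs \<subseteq> carrier R \<Longrightarrow> D xs \<in> I) \<Longrightarrow>
      derivation_ideal K R \<iota> d \<subseteq> I"
    unfolding derivation_ideal_def by (rule genideal_minimal) auto
qed

text \<open>The situation of \<open>A\<close> inside the fiber product \<open>R = A \<times>\<^sub>K B\<close>: besides the projection \<open>\<pi>\<close> there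
  is a section \<open>\<sigma> a = (a, \<epsilon> a)\<close>, which on \<open>\<mm>\<close> is the embedding \<open>x \<mapsto> (x, 0)\<close>.\<close>

locale ring_retract = A: cring A + R: cring R
  for A :: "('a, 'n) ring_scheme" and R :: "('r, 'q) ring_scheme" +
  fixes K :: "('k, 'm) ring_scheme" and \<iota>A :: "'k \<Rightarrow> 'a" and \<iota>R :: "'k \<Rightarrow> 'r"
    and \<pi> :: "'r \<Rightarrow> 'a" and \<sigma> :: "'a \<Rightarrow> 'r" and \<mm> :: "'a set"
  assumes pi_hom: "\<pi> \<in> ring_hom R A" and sigma_hom: "\<sigma> \<in> ring_hom A R"
    and pi_sigma: "a \<in> carrier A \<Longrightarrow> \<pi> (\<sigma> a) = a"
    and incl_A: "c \<in> carrier K \<Longrightarrow> \<iota>A c \<in> carrier A" and incl_R: "c \<in> carrier K \<Longrightarrow> \<iota>R c = \<sigma> (\<iota>A c)"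
    and m_ideal: "ideal \<mm> A"
    and sigma_mult: "x \<in> \<mm> \<Longrightarrow> r \<in> carrier R \<Longrightarrow> \<sigma> x \<otimes>\<^bsub>R\<^esub> r = \<sigma> (x \<otimes>\<^bsub>A\<^esub> \<pi> r)"
begin

lemma pi_simps [simp]:
  "r \<in> carrier R \<Longrightarrow> \<pi> r \<in> carrier A"
  "r \<in> carrier R \<Longrightarrow> s \<in> carrier R \<Longrightarrow> \<pi> (r \<oplus>\<^bsub>R\<^esub> s) = \<pi> r \<oplus>\<^bsub>A\<^esub> \<pi> s"
  "r \<in> carrier R \<Longrightarrow> s \<in> carrier R \<Longrightarrow> \<pi> (r \<otimes>\<^bsub>R\<^esub> s) = \<pi> r \<otimes>\<^bsub>A\<^esub> \<pi> s"
  using pi_hom by (auto simp: ring_hom_def)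

lemma sigma_simps [simp]:
  "a \<in> carrier A \<Longrightarrow> \<sigma> a \<in> carrier R"
  "a \<in> carrier A \<Longrightarrow> b \<in> carrier A \<Longrightarrow> \<sigma> (a \<oplus>\<^bsub>A\<^esub> b) = \<sigma> a \<oplus>\<^bsub>R\<^esub> \<sigma> b"
  "a \<in> carrier A \<Longrightarrow> b \<in> carrier A \<Longrightarrow> \<sigma> (a \<otimes>\<^bsub>A\<^esub> b) = \<sigma> a \<otimes>\<^bsub>R\<^esub> \<sigma> b"
  using sigma_hom by (auto simp: ring_hom_def)

interpretation pi: ring_hom_ring R A \<pi>
  by (rule ring_hom_ringI2[OF R.ring_axioms A.ring_axioms pi_hom])

interpretation sigma: ring_hom_ring A R \<sigma>
  by (rule ring_hom_ringI2[OF A.ring_axioms R.ring_axioms sigma_hom])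

lemma incl_R_closed: "c \<in> carrier K \<Longrightarrow> \<iota>R c \<in> carrier R"
  by (simp add: incl_A incl_R)

lemma pi_incl: "c \<in> carrier K \<Longrightarrow> \<pi> (\<iota>R c) = \<iota>A c"
  by (simp add: incl_A incl_R pi_sigma)

abbreviation "TA \<equiv> derivation_ideal K A \<iota>A"
abbreviation "TR \<equiv> derivation_ideal K R \<iota>R"

lemmas TA_props = A.derivation_ideal_props[where K = K and \<iota> = \<iota>A]
lemmas TR_props = R.derivation_ideal_props[where K = K and \<iota> = \<iota>R]

lemma set_map_pi: "set rs \<subseteq> carrier R \<Longrightarrow> set (map \<pi> rs) \<subseteq> carrier A"
  by auto

text \<open>The Leibniz rule on \<open>R\<close> asks for \<open>r \<otimes> \<sigma> v\<close> to
  equal \<open>\<sigma>\<close> applied to \<open>\<pi> r \<otimes> v\<close>, where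
  \<open>v\<close> is a value of \<open>D\<close>. This is \<open>sigma_mult\<close>, and the reason
  for demanding values in \<open>\<mm>\<close>.\<close>

lemma alternating_derivation_inflate:
  assumes D: "alternating_derivation K A \<iota>A d D"
    and Dm: "\<And>as. length as = d \<Longrightarrow> set as \<subseteq> carrier A \<Longrightarrow> D as \<in> \<mm>"
  shows "alternating_derivation K R \<iota>R d (\<lambda>rs. \<sigma> (D (map \<pi> rs)))"
  unfolding alternating_derivation_def
proof (intro allI impI, elim conjE, intro conjI allI impI ballI)
  fix rs assume rs: "length rs = d" "set rs \<subseteq> carrier R"
  define as where "as = map \<pi> rs"
  have as: "length as = d" "set as \<subseteq> carrier A" using rs by (auto simp: as_def)
  note DD = alternating_derivationD[OF D as]
  have upd: "map \<pi> (rs[i := r]) = as[i := \<pi> r]" for i r by (simp add: as_def map_update)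
  show "\<sigma> (D (map \<pi> rs)) \<in> carrier R" using DD(1) by (simp add: as_def)
  fix i assume i: "i < d"
  have Dc: "D (as[i := a]) \<in> \<mm>" "D (as[i := a]) \<in> carrier A" if "a \<in> carrier A" for a
  proof -
    show "D (as[i := a]) \<in> \<mm>"
      using as that by (intro Dm) (simp_all add: set_list_update_subset)
    then show "D (as[i := a]) \<in> carrier A" using ideal.Icarr[OF m_ideal] by blast
  qed
  show "\<sigma> (D (map \<pi> (rs[i := \<iota>R c]))) = \<zero>\<^bsub>R\<^esub>" if "c \<in> carrier K" for c
    using DD(4)[OF i that] that by (simp add: upd pi_incl)
  fix r s assume r: "r \<in> carrier R" and s: "s \<in> carrier R"
  show "\<sigma> (D (map \<pi> (rs[i := r \<oplus>\<^bsub>R\<^esub> s]))) = \<sigma> (D (map \<pi> (rs[i := r]))) \<oplus>\<^bsub>R\<^esub> \<sigma> (D (map \<pi> (rs[i := s])))"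
    using DD(2)[OF i, of "\<pi> r" "\<pi> s"] r s Dc by (simp add: upd)
  have eq: "\<sigma> (\<pi> r \<otimes>\<^bsub>A\<^esub> v) = r \<otimes>\<^bsub>R\<^esub> \<sigma> v" if "v \<in> \<mm>" "r \<in> carrier R" for r v
  proof -
    have v: "v \<in> carrier A" using ideal.Icarr[OF m_ideal that(1)] .
    have "\<sigma> (\<pi> r \<otimes>\<^bsub>A\<^esub> v) = \<sigma> (v \<otimes>\<^bsub>A\<^esub> \<pi> r)" using that v by (simp only: A.m_comm pi_simps)
    also have "\<dots> = \<sigma> v \<otimes>\<^bsub>R\<^esub> r" using sigma_mult[OF that] by simp
    finally show ?thesis using that v by (simp add: R.m_comm)
  qed
  have "\<sigma> (D (as[i := \<pi> r \<otimes>\<^bsub>A\<^esub> \<pi> s])) = \<sigma> (\<pi> r \<otimes>\<^bsub>A\<^esub> D (as[i := \<pi> s])) \<oplus>\<^bsub>R\<^esub> \<sigma> (\<pi> s \<otimes>\<^bsub>A\<^esub> D (as[i := \<pi> r]))"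
    using DD(3)[OF i, of "\<pi> r" "\<pi> s"] r s Dc(2) by (simp del: sigma_simps(3))
  then show "\<sigma> (D (map \<pi> (rs[i := r \<otimes>\<^bsub>R\<^esub> s]))) =
      r \<otimes>\<^bsub>R\<^esub> \<sigma> (D (map \<pi> (rs[i := s]))) \<oplus>\<^bsub>R\<^esub> s \<otimes>\<^bsub>R\<^esub> \<sigma> (D (map \<pi> (rs[i := r])))"
    using r s Dc(1) by (simp add: upd eq del: sigma_simps(3))
next
  fix rs i j assume rs: "length rs = d" "set rs \<subseteq> carrier R" and ij: "i < j \<and> j < d \<and> rs ! i = rs ! j"
  have "D (map \<pi> rs) = \<zero>\<^bsub>A\<^esub>"
    by (rule alternating_derivationD(5)[OF D, of _ i j]) (use rs ij in auto)
  then show "\<sigma> (D (map \<pi> rs)) = \<zero>\<^bsub>R\<^esub>" by simp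
qed

lemma alternating_derivation_scale:
  assumes D: "alternating_derivation K A \<iota>A d D" and x: "x \<in> carrier A"
  shows "alternating_derivation K A \<iota>A d (\<lambda>as. x \<otimes>\<^bsub>A\<^esub> D as)"
  unfolding alternating_derivation_def
proof (intro allI impI, elim conjE, intro conjI allI impI ballI)
  fix as assume as: "length as = d" "set as \<subseteq> carrier A"
  note DD = alternating_derivationD[OF D as]
  show "x \<otimes>\<^bsub>A\<^esub> D as \<in> carrier A" using DD(1) x by simp
  fix i assume i: "i < d"
  have Dc: "D (as[i := a]) \<in> carrier A" if "a \<in> carrier A" for a
    using as that by (intro alternating_derivationD(1)[OF D]) (simp_all add: set_list_update_subset)
  show "x \<otimes>\<^bsub>A\<^esub> D (as[i := \<iota>A c]) = \<zero>\<^bsub>A\<^esub>" if "c \<in> carrier K" for c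
    using DD(4)[OF i that] x by simp
  fix a b assume ab: "a \<in> carrier A" "b \<in> carrier A"
  show "x \<otimes>\<^bsub>A\<^esub> D (as[i := a \<oplus>\<^bsub>A\<^esub> b]) = x \<otimes>\<^bsub>A\<^esub> D (as[i := a]) \<oplus>\<^bsub>A\<^esub> x \<otimes>\<^bsub>A\<^esub> D (as[i := b])"
    using DD(2)[OF i ab] Dc ab x by (simp add: A.r_distr)
  show "x \<otimes>\<^bsub>A\<^esub> D (as[i := a \<otimes>\<^bsub>A\<^esub> b]) = a \<otimes>\<^bsub>A\<^esub> (x \<otimes>\<^bsub>A\<^esub> D (as[i := b])) \<oplus>\<^bsub>A\<^esub> b \<otimes>\<^bsub>A\<^esub> (x \<otimes>\<^bsub>A\<^esub> D (as[i := a]))"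
    using DD(3)[OF i ab] Dc ab x by (simp add: A.r_distr A.m_lcomm)
next
  fix as i j assume as: "length as = d" "set as \<subseteq> carrier A" and ij: "i < j \<and> j < d \<and> as ! i = as ! j"
  then have "D as = \<zero>\<^bsub>A\<^esub>" using alternating_derivationD(5)[OF D as, of i j] by blast
  then show "x \<otimes>\<^bsub>A\<^esub> D as = \<zero>\<^bsub>A\<^esub>" using x by simp
qed

lemma inflate_value:
  assumes D: "alternating_derivation K A \<iota>A d D"
    and Dm: "\<And>as. length as = d \<Longrightarrow> set as \<subseteq> carrier A \<Longrightarrow> D as \<in> \<mm>"
    and as: "length as = d" "set as \<subseteq> carrier A"
  shows "\<sigma> (D as) \<in> TR d"
proof -
  have "map \<pi> (map \<sigma> as) = as" using as(2) by (induction as) (auto simp: pi_sigma)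
  moreover have "\<sigma> (D (map \<pi> (map \<sigma> as))) \<in> TR d"
    using as by (intro TR_props(2)[OF alternating_derivation_inflate[OF D Dm], of "map \<sigma> as"]) auto
  ultimately show ?thesis by simp
qed

lemma sigma_vimage_ideal: "ideal I R \<Longrightarrow> ideal {a \<in> carrier A. \<sigma> a \<in> I} A"
  by (rule sigma.ideal_vimage)

lemma pi_vimage_ideal: "ideal I A \<Longrightarrow> ideal {r \<in> carrier R. \<pi> r \<in> I} R"
  by (rule pi.ideal_vimage)

lemma m_subset_TA_imp:
  assumes max: "\<And>J. ideal J A \<Longrightarrow> \<mm> \<subseteq> J \<Longrightarrow> J \<noteq> \<mm> \<Longrightarrow> J = carrier A" and T: "\<mm> \<subseteq> TA d"
  shows "\<sigma> ` \<mm> \<subseteq> TR d"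
proof (cases "TA d = \<mm>")
  case True
  have "TA d \<subseteq> {a \<in> carrier A. \<sigma> a \<in> TR d}"
  proof (rule TA_props(3)[OF sigma_vimage_ideal[OF TR_props(1)]])
    fix D as assume D: "alternating_derivation K A \<iota>A d D" and as: "length as = d" "set as \<subseteq> carrier A"
    have "\<sigma> (D as) \<in> TR d"
      by (rule inflate_value[OF D _ as]) (use TA_props(2)[OF D] True in blast)
    then show "D as \<in> {a \<in> carrier A. \<sigma> a \<in> TR d}" using alternating_derivationD(1)[OF D as] by simp
  qed
  then show ?thesis using T by auto
next
  case False
  then have "TA d = carrier A" using max[OF TA_props(1) T] by simp
  show ?thesis
  proof (rule image_subsetI)
    fix x assume x: "x \<in> \<mm>"
    have xc: "x \<in> carrier A" by (rule ideal.Icarr[OF m_ideal x])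
    define J where "J = {a \<in> carrier A. \<sigma> a \<in> TR d}"
    interpret J: ideal J A unfolding J_def by (rule sigma_vimage_ideal[OF TR_props(1)])
    \<comment> \<open>The ideal quotient of \<open>J\<close> by \<open>x\<close>. It contains every
      value of every alternating derivation of \<open>A\<close>, because these become values in
      \<open>\<mm>\<close> after multiplication by \<open>x\<close>; hence it contains
      \<open>TA d\<close>, which is all of \<open>A\<close>, and in particular the unit.\<close>
    have J': "ideal {a \<in> carrier A. x \<otimes>\<^bsub>A\<^esub> a \<in> J} A"
    proof (rule A.ideal_if_closed)
      show "\<zero>\<^bsub>A\<^esub> \<in> {a \<in> carrier A. x \<otimes>\<^bsub>A\<^esub> a \<in> J}" using xc by simp
      show "a \<oplus>\<^bsub>A\<^esub> b \<in> {a \<in> carrier A. x \<otimes>\<^bsub>A\<^esub> a \<in> J}"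
        if "a \<in> {a \<in> carrier A. x \<otimes>\<^bsub>A\<^esub> a \<in> J}" "b \<in> {a \<in> carrier A. x \<otimes>\<^bsub>A\<^esub> a \<in> J}" for a b
        using that xc by (simp add: A.r_distr)
      show "r \<otimes>\<^bsub>A\<^esub> a \<in> {a \<in> carrier A. x \<otimes>\<^bsub>A\<^esub> a \<in> J}"
        if "r \<in> carrier A" "a \<in> {a \<in> carrier A. x \<otimes>\<^bsub>A\<^esub> a \<in> J}" for r a
        using that J.I_l_closed[of "x \<otimes>\<^bsub>A\<^esub> a" r] xc by (simp add: A.m_lcomm)
    qed auto
    have "TA d \<subseteq> {a \<in> carrier A. x \<otimes>\<^bsub>A\<^esub> a \<in> J}"
    proof (rule TA_props(3)[OF J'])
      fix D as assume D: "alternating_derivation K A \<iota>A d D" and as: "length as = d" "set as \<subseteq> carrier A"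
      have "\<sigma> (x \<otimes>\<^bsub>A\<^esub> D as) \<in> TR d"
      proof (rule inflate_value[OF alternating_derivation_scale[OF D xc] _ as])
        fix bs assume "length bs = d" "set bs \<subseteq> carrier A"
        then show "x \<otimes>\<^bsub>A\<^esub> D bs \<in> \<mm>"
          by (rule ideal.I_r_closed[OF m_ideal x alternating_derivationD(1)[OF D]])
      qed
      moreover have Dc: "D as \<in> carrier A" by (rule alternating_derivationD(1)[OF D as])
      ultimately have "x \<otimes>\<^bsub>A\<^esub> D as \<in> J" unfolding J_def by (intro CollectI conjI A.m_closed xc)
      with Dc show "D as \<in> {a \<in> carrier A. x \<otimes>\<^bsub>A\<^esub> a \<in> J}" by blast
    qed
    then have sub: "carrier A \<subseteq> {a \<in> carrier A. x \<otimes>\<^bsub>A\<^esub> a \<in> J}" unfolding \<open>TA d = carrier A\<close> .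
    have "x \<otimes>\<^bsub>A\<^esub> \<one>\<^bsub>A\<^esub> \<in> J" using subsetD[OF sub A.one_closed] by blast
    then have "x \<in> J" by (simp only: A.r_one[OF xc])
    then show "\<sigma> x \<in> TR d" unfolding J_def by blast
  qed
qed

lemma alternating_derivation_restrict:
  assumes D: "alternating_derivation K R \<iota>R d D"
  shows "alternating_derivation K A \<iota>A d (\<lambda>as. \<pi> (D (map \<sigma> as)))"
  unfolding alternating_derivation_def
proof (intro allI impI, elim conjE, intro conjI allI impI ballI)
  fix as assume as: "length as = d" "set as \<subseteq> carrier A"
  define rs where "rs = map \<sigma> as"
  have rs: "length rs = d" "set rs \<subseteq> carrier R" using as by (auto simp: rs_def)
  note DD = alternating_derivationD[OF D rs]
  have upd: "map \<sigma> (as[i := a]) = rs[i := \<sigma> a]" for i a by (simp add: rs_def map_update)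
  show "\<pi> (D (map \<sigma> as)) \<in> carrier A" using DD(1) by (simp add: rs_def)
  fix i assume i: "i < d"
  have Dc: "D (rs[i := r]) \<in> carrier R" if "r \<in> carrier R" for r
    using rs that by (intro alternating_derivationD(1)[OF D]) (simp_all add: set_list_update_subset)
  show "\<pi> (D (map \<sigma> (as[i := \<iota>A c]))) = \<zero>\<^bsub>A\<^esub>" if "c \<in> carrier K" for c
    using DD(4)[OF i that] that by (simp add: upd incl_R)
  fix a b assume ab: "a \<in> carrier A" "b \<in> carrier A"
  show "\<pi> (D (map \<sigma> (as[i := a \<oplus>\<^bsub>A\<^esub> b]))) = \<pi> (D (map \<sigma> (as[i := a]))) \<oplus>\<^bsub>A\<^esub> \<pi> (D (map \<sigma> (as[i := b])))"
    using DD(2)[OF i, of "\<sigma> a" "\<sigma> b"] ab Dc by (simp add: upd)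
  show "\<pi> (D (map \<sigma> (as[i := a \<otimes>\<^bsub>A\<^esub> b]))) =
      a \<otimes>\<^bsub>A\<^esub> \<pi> (D (map \<sigma> (as[i := b]))) \<oplus>\<^bsub>A\<^esub> b \<otimes>\<^bsub>A\<^esub> \<pi> (D (map \<sigma> (as[i := a])))"
    using DD(3)[OF i, of "\<sigma> a" "\<sigma> b"] ab Dc by (simp add: upd pi_sigma)
next
  fix as i j assume as: "length as = d" "set as \<subseteq> carrier A" and ij: "i < j \<and> j < d \<and> as ! i = as ! j"
  have "D (map \<sigma> as) = \<zero>\<^bsub>R\<^esub>"
    by (rule alternating_derivationD(5)[OF D, of _ i j]) (use as ij in auto)
  then show "\<pi> (D (map \<sigma> as)) = \<zero>\<^bsub>A\<^esub>" by simp
qed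

text \<open>Since \<open>\<mm>\<close> annihilates the kernel of \<open>\<pi>\<close>, and nothing in \<open>A\<close>, the derivation \<open>\<pi> \<circ> D\<close> kills that kernel.\<close>

lemma restrict_value:
  assumes depth: "\<And>a. a \<in> carrier A \<Longrightarrow> (\<And>x. x \<in> \<mm> \<Longrightarrow> x \<otimes>\<^bsub>A\<^esub> a = \<zero>\<^bsub>A\<^esub>) \<Longrightarrow> a = \<zero>\<^bsub>A\<^esub>"
    and D: "alternating_derivation K R \<iota>R d D" and rs: "length rs = d" "set rs \<subseteq> carrier R"
  shows "\<pi> (D rs) = \<pi> (D (map \<sigma> (map \<pi> rs)))"
proof -
  have Dc: "D (rs[i := r]) \<in> carrier R" if "length rs = d" "set rs \<subseteq> carrier R" "r \<in> carrier R" for rs i r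
    using that by (intro alternating_derivationD(1)[OF D]) (simp_all add: set_list_update_subset)
  have step: "\<pi> (D (rs[i := \<sigma> (\<pi> r)])) = \<pi> (D (rs[i := r]))"
    if rs: "length rs = d" "set rs \<subseteq> carrier R" and i: "i < d" and r: "r \<in> carrier R" for rs i r
  proof -
    note DD = alternating_derivationD[OF D rs] and c = Dc[OF rs]
    define s where "s = r \<ominus>\<^bsub>R\<^esub> \<sigma> (\<pi> r)"
    have s: "s \<in> carrier R" using r by (simp add: s_def)
    have r_eq: "r = s \<oplus>\<^bsub>R\<^esub> \<sigma> (\<pi> r)" using r by (simp add: s_def R.minus_eq R.a_assoc R.l_neg)
    have ps: "\<pi> s = \<zero>\<^bsub>A\<^esub>" using r by (simp add: s_def R.minus_eq A.r_neg pi_sigma)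
    have "\<pi> (D (rs[i := s])) = \<zero>\<^bsub>A\<^esub>"
    proof (rule depth)
      fix x assume x: "x \<in> \<mm>"
      have xc: "x \<in> carrier A" by (rule ideal.Icarr[OF m_ideal x])
      have "\<sigma> x \<otimes>\<^bsub>R\<^esub> s = \<zero>\<^bsub>R\<^esub>" using sigma_mult[OF x s] ps xc by (simp del: sigma_simps(3))
      moreover have "\<zero>\<^bsub>R\<^esub> = \<zero>\<^bsub>R\<^esub> \<oplus>\<^bsub>R\<^esub> \<zero>\<^bsub>R\<^esub>" by simp
      then have "D (rs[i := \<zero>\<^bsub>R\<^esub>]) = D (rs[i := \<zero>\<^bsub>R\<^esub>]) \<oplus>\<^bsub>R\<^esub> D (rs[i := \<zero>\<^bsub>R\<^esub>])"
        using DD(2)[OF i R.zero_closed R.zero_closed] by simp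
      then have "D (rs[i := \<zero>\<^bsub>R\<^esub>]) = \<zero>\<^bsub>R\<^esub>" using c[OF R.zero_closed] by simp
      \<comment> \<open>The Leibniz rule for the vanishing product of \<open>\<sigma> x\<close> and
        \<open>s\<close>. Its second summand disappears under \<open>\<pi>\<close>, since
        \<open>s\<close> lies in the kernel.\<close>
      ultimately have "\<sigma> x \<otimes>\<^bsub>R\<^esub> D (rs[i := s]) \<oplus>\<^bsub>R\<^esub> s \<otimes>\<^bsub>R\<^esub> D (rs[i := \<sigma> x]) = \<zero>\<^bsub>R\<^esub>"
        using DD(3)[OF i, of "\<sigma> x" s] xc s by simp
      then have "\<pi> (\<sigma> x \<otimes>\<^bsub>R\<^esub> D (rs[i := s]) \<oplus>\<^bsub>R\<^esub> s \<otimes>\<^bsub>R\<^esub> D (rs[i := \<sigma> x])) = \<zero>\<^bsub>A\<^esub>" by simp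
      then show "x \<otimes>\<^bsub>A\<^esub> \<pi> (D (rs[i := s])) = \<zero>\<^bsub>A\<^esub>"
        using xc s c ps by (simp add: pi_sigma)
    qed (use c s in simp)
    moreover have "D (rs[i := r]) = D (rs[i := s]) \<oplus>\<^bsub>R\<^esub> D (rs[i := \<sigma> (\<pi> r)])"
      using DD(2)[OF i s, of "\<sigma> (\<pi> r)"] r_eq r by simp
    ultimately show ?thesis using c s r by simp
  qed
  have "\<pi> (D (map (\<lambda>a. \<sigma> (\<pi> a)) (take k rs) @ drop k rs)) = \<pi> (D rs)" if "k \<le> d" for k
    using that
  proof (induction k)
    case (Suc k)
    let ?L = "map (\<lambda>a. \<sigma> (\<pi> a)) (take k rs) @ drop k rs"
    have k: "k < length rs" using Suc.prems rs by simp
    have c: "rs ! k \<in> carrier R" using k rs by (auto simp: subset_iff)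
    have L: "length ?L = d" "set ?L \<subseteq> carrier R"
      using Suc.prems rs set_take_subset[of k rs] set_drop_subset[of k rs] by auto
    have 1: "?L[k := rs ! k] = ?L"
      using k by (intro list_update_same_conv[THEN iffD2]) (auto simp: nth_append)
    have 2: "?L[k := \<sigma> (\<pi> (rs ! k))] = map (\<lambda>a. \<sigma> (\<pi> a)) (take (Suc k) rs) @ drop (Suc k) rs"
      using k by (simp add: list_update_append take_Suc_conv_app_nth Cons_nth_drop_Suc[symmetric])
    have "\<pi> (D (?L[k := \<sigma> (\<pi> (rs ! k))])) = \<pi> (D (?L[k := rs ! k]))"
      using Suc.prems by (intro step L c) simp
    then have "\<pi> (D (map (\<lambda>a. \<sigma> (\<pi> a)) (take (Suc k) rs) @ drop (Suc k) rs)) = \<pi> (D ?L)" by (simp only: 1 2)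
    then show ?case using Suc by simp
  qed simp
  from this[of d] show ?thesis using rs by (simp add: comp_def)
qed

text \<open>By \<open>restrict_value\<close> the projection of a value of \<open>D\<close> is
  already a value of the restricted derivation on \<open>A\<close>. So \<open>\<pi>\<close> maps
  \<open>TR d\<close> into \<open>TA d\<close>, and it carries \<open>\<sigma> x\<close> back to
  \<open>x\<close>.\<close>

lemma sigma_m_subset_TR_imp:
  assumes depth: "\<And>a. a \<in> carrier A \<Longrightarrow> (\<And>x. x \<in> \<mm> \<Longrightarrow> x \<otimes>\<^bsub>A\<^esub> a = \<zero>\<^bsub>A\<^esub>) \<Longrightarrow> a = \<zero>\<^bsub>A\<^esub>"
    and T: "\<sigma> ` \<mm> \<subseteq> TR d"
  shows "\<mm> \<subseteq> TA d"
proof -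
  have "TR d \<subseteq> {r \<in> carrier R. \<pi> r \<in> TA d}"
  proof (rule TR_props(3)[OF pi_vimage_ideal[OF TA_props(1)]])
    fix D rs assume D: "alternating_derivation K R \<iota>R d D" and rs: "length rs = d" "set rs \<subseteq> carrier R"
    have "\<pi> (D (map \<sigma> (map \<pi> rs))) \<in> TA d"
      using TA_props(2)[OF alternating_derivation_restrict[OF D], of "map \<pi> rs"] rs set_map_pi by simp
    then show "D rs \<in> {r \<in> carrier R. \<pi> r \<in> TA d}"
      using restrict_value[OF depth D rs] alternating_derivationD(1)[OF D rs] by simp
  qed
  then show ?thesis using T pi_sigma ideal.Icarr[OF m_ideal] by (force simp: image_subset_iff)
qed

section \<open>Chains of primes along the retraction\<close>

lemma prime_chain_inflate:
  assumes P: "\<forall>i\<le>n. primeideal (P i) A" "\<forall>i<n. P i \<subset> P (Suc i)"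
  shows "\<exists>P. (\<forall>i\<le>n. primeideal (P i) R) \<and> (\<forall>i<n. P i \<subset> P (Suc i))"
proof (intro exI[of _ "\<lambda>i. {r \<in> carrier R. \<pi> r \<in> P i}"] conjI allI impI)
  show "primeideal {r \<in> carrier R. \<pi> r \<in> P i} R" if "i \<le> n" for i
    using pi.primeideal_vimage[OF R.is_cring] P(1) that by blast
  show "{r \<in> carrier R. \<pi> r \<in> P i} \<subset> {r \<in> carrier R. \<pi> r \<in> P (Suc i)}" if i: "i < n" for i
  proof -
    have sub: "P i \<subset> P (Suc i)" using P(2) i by blast
    then obtain a where a: "a \<in> P (Suc i)" "a \<notin> P i" by blast
    have prime: "primeideal (P (Suc i)) A" using P(1) i by simp
    have "a \<in> carrier A" by (rule ideal.Icarr[OF primeideal.axioms(1)[OF prime] a(1)])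
    then have "\<sigma> a \<in> {r \<in> carrier R. \<pi> r \<in> P (Suc i)}" "\<sigma> a \<notin> {r \<in> carrier R. \<pi> r \<in> P i}"
      using a by (simp_all add: pi_sigma)
    then show ?thesis using sub by blast
  qed
qed

text \<open>The primes are contracted along \<open>\<sigma>\<close>. Strictness survives because
  \<open>r\<close> and \<open>\<sigma> (\<pi> r)\<close> differ by an element of the kernel of
  \<open>\<pi>\<close>, which lies in all members of the chain, so both belong to the same
  members.\<close>

lemma prime_chain_restrict:
  assumes P: "\<forall>i\<le>n. primeideal (P i) R" "\<forall>i<n. P i \<subset> P (Suc i)"
    and ker: "\<And>r. r \<in> carrier R \<Longrightarrow> \<pi> r = \<zero>\<^bsub>A\<^esub> \<Longrightarrow> r \<in> P 0"
  shows "\<exists>P. (\<forall>i\<le>n. primeideal (P i) A) \<and> (\<forall>i<n. P i \<subset> P (Suc i))"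
proof (intro exI[of _ "\<lambda>i. {a \<in> carrier A. \<sigma> a \<in> P i}"] conjI allI impI)
  have P0: "P 0 \<subseteq> P i" if "i \<le> n" for i
    using that
  proof (induction i)
    case (Suc i)
    then have "P i \<subset> P (Suc i)" using P(2) by simp
    then show ?case using Suc by auto
  qed simp
  show "primeideal {a \<in> carrier A. \<sigma> a \<in> P i} A" if "i \<le> n" for i
    using sigma.primeideal_vimage[OF A.is_cring] P(1) that by blast
  show "{a \<in> carrier A. \<sigma> a \<in> P i} \<subset> {a \<in> carrier A. \<sigma> a \<in> P (Suc i)}" if i: "i < n" for i
  proof -
    have sub: "P i \<subset> P (Suc i)" using P(2) i by blast
    then obtain r where r: "r \<in> P (Suc i)" "r \<notin> P i" by blast
    interpret P1: primeideal "P (Suc i)" R using P(1) i by simp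
    interpret P0: primeideal "P i" R using P(1) i by simp
    have rc: "r \<in> carrier R" using r(1) P1.Icarr by blast
    define s where "s = \<sigma> (\<pi> r) \<ominus>\<^bsub>R\<^esub> r"
    have sc: "s \<in> carrier R" using rc by (simp add: s_def)
    have ps: "\<pi> s = \<zero>\<^bsub>A\<^esub>" using rc by (simp add: s_def R.minus_eq A.r_neg pi_sigma)
    have s: "s \<in> P i" "s \<in> P (Suc i)"
      using subsetD[OF P0[of i] ker[OF sc ps]] subsetD[OF P0[of "Suc i"] ker[OF sc ps]] i by simp_all
    have eq: "\<sigma> (\<pi> r) = s \<oplus>\<^bsub>R\<^esub> r" using rc by (simp add: s_def R.minus_eq R.a_assoc R.l_neg)
    have in1: "\<sigma> (\<pi> r) \<in> P (Suc i)" unfolding eq using s r by (intro P1.a_closed)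
    have "\<sigma> (\<pi> r) \<notin> P i"
    proof
      assume "\<sigma> (\<pi> r) \<in> P i"
      then have "\<sigma> (\<pi> r) \<ominus>\<^bsub>R\<^esub> s \<in> P i" using s(1) by (simp add: R.minus_eq P0.a_inv_closed)
      moreover have "\<sigma> (\<pi> r) \<ominus>\<^bsub>R\<^esub> s = r" unfolding eq using sc rc by (simp add: R.minus_eq R.a_comm[of s r] R.a_assoc R.r_neg)
      ultimately show False using r(2) by simp
    qed
    then show ?thesis using sub in1 rc by auto
  qed
qed

lemma krull_dim_le: "krull_dim A \<le> krull_dim R"
  unfolding krull_dim_def using prime_chain_inflate by (intro SUP_subset_mono) auto

end

section \<open>Fiber products\<close>

context graded_algebra
begin

lemma positive_part_ideal: "ideal positive_part S"
  using primeideal.axioms(1)[OF positive_part_prime] .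

lemma hc_positive_degree: "x \<in> gr n \<Longrightarrow> n > 0 \<Longrightarrow> x \<in> positive_part"
  by (simp add: positive_part_def gr_carrier hc_homogeneous)

lemma positive_part_sum:
  assumes "x \<in> positive_part"
  obtains n where "x = finsum S (hc x) {1..n}"
proof -
  have x: "x \<in> carrier S" "hc x 0 = \<zero>" using assms by (auto simp: positive_part_def)
  obtain n where n: "x \<in> Fil n" by (rule Fil_exists[OF x(1)])
  have "{i. hc x i \<noteq> \<zero>} \<subseteq> {1..n}"
  proof
    fix i assume i: "i \<in> {i. hc x i \<noteq> \<zero>}"
    then have "i \<noteq> 0" using x(2) by (cases i) auto
    moreover have "i \<le> n" using i n by (auto simp: Fil_def not_less[symmetric])
    ultimately show "i \<in> {1..n}" by simp
  qed
  then have "finsum S (hc x) {1..n} = x" by (intro hc_sum_superset[OF x(1)]) auto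
  then show thesis using that[of n] by simp
qed

lemma irrelevant_ideal_eq: "irrelevant_ideal S gr = positive_part"
proof
  show "irrelevant_ideal S gr \<subseteq> positive_part"
  proof
    fix x assume "x \<in> irrelevant_ideal S gr"
    then obtain c n where x: "x = finsum S c {1..n::nat}" "\<forall>i\<in>{1..n}. c i \<in> gr i"
      unfolding irrelevant_ideal_def by blast
    have "c i \<in> positive_part" if "i \<in> {1..n}" for i
      using x(2) that by (intro hc_positive_degree[of "c i" i]) auto
    then show "x \<in> positive_part" unfolding x(1) by (intro S.ideal_finsum[OF positive_part_ideal]) auto
  qed
  show "positive_part \<subseteq> irrelevant_ideal S gr"
  proof
    fix x assume x: "x \<in> positive_part"
    then obtain n where n: "x = finsum S (hc x) {1..n}" by (rule positive_part_sum)
    moreover have "\<forall>i\<in>{1..n}. hc x i \<in> gr i" using x hc_props(1) by (auto simp: positive_part_def)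
    ultimately show "x \<in> irrelevant_ideal S gr" unfolding irrelevant_ideal_def by blast
  qed
qed

text \<open>An element without constant term is the finite sum of its components of positive degree;
  a ring homomorphism that respects the positive degrees turns it into a sum of the shape that
  defines \<open>irrelevant_ideal\<close>.\<close>

lemma image_positive_part_subset:
  fixes T :: "('t, 'q) ring_scheme" (structure)
  assumes T: "ring T" and h: "h \<in> ring_hom S T" and gr: "\<And>i x. i > 0 \<Longrightarrow> x \<in> gr i \<Longrightarrow> h x \<in> grT i"
  shows "h ` positive_part \<subseteq> irrelevant_ideal T grT"
proof (rule image_subsetI)
  interpret h: ring_hom_ring S T h by (rule ring_hom_ringI2[OF S.ring_axioms T h])
  fix x assume x: "x \<in> positive_part"
  then have xc: "x \<in> carrier S" by (simp add: positive_part_def)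
  obtain n where n: "x = finsum S (hc x) {1..n}" by (rule positive_part_sum[OF x])
  have "h x = h (finsum S (hc x) {1..n})" using n by simp
  also have "\<dots> = finsum T (h \<circ> hc x) {1..n}" by (rule h.hom_finsum) (use xc in auto)
  finally have "h x = finsum T (h \<circ> hc x) {1..n}" .
  moreover have "\<forall>i\<in>{1..n}. (h \<circ> hc x) i \<in> grT i" using gr hc_props(1)[OF xc] by auto
  ultimately show "h x \<in> irrelevant_ideal T grT" unfolding irrelevant_ideal_def by blast
qed

lemma hc_incl: "c \<in> carrier K \<Longrightarrow> hc (\<iota> c) 0 = \<iota> c"
  using hc_homogeneous[of "\<iota> c" 0] incl_image[symmetric] by simp

lemma minus_mem_positive_part_iff:
  assumes x: "x \<in> carrier S" and c: "c \<in> carrier K"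
  shows "x \<ominus> \<iota> c \<in> positive_part \<longleftrightarrow> hc x 0 = \<iota> c"
proof -
  note ic = incl_closed[OF c]
  have "hc x 0 = hc (x \<ominus> \<iota> c) 0 \<oplus> hc (\<iota> c) 0"
    using hc_add[of "x \<ominus> \<iota> c" "\<iota> c" 0] x ic by (simp add: S.minus_eq S.a_assoc S.l_neg)
  then have "hc x 0 = hc (x \<ominus> \<iota> c) 0 \<oplus> \<iota> c" using hc_incl[OF c] by simp
  then show ?thesis
    using x ic S.add.r_cancel_one'[of "\<iota> c" "hc (x \<ominus> \<iota> c) 0"] by (auto simp: positive_part_def)
qed

abbreviation "\<epsilon> \<equiv> augmentation K S \<iota> gr"

text \<open>The augmentation reads off the constant term: \<open>x\<close> and
  \<open>\<iota> c\<close> have the same coset exactly if their difference has no constant term, and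
  \<open>c\<close> is unique by injectivity of \<open>\<iota>\<close>.\<close>

lemma augmentation_eqI:
  assumes x: "x \<in> carrier S" and c: "c \<in> carrier K" "hc x 0 = \<iota> c"
  shows "\<epsilon> x = c"
  unfolding augmentation_def irrelevant_ideal_eq
proof (rule the_equality)
  note iff = S.quotient_eq_iff_same_a_r_cos[OF positive_part_ideal x incl_closed]
  show "c \<in> carrier K \<and> positive_part +> x = positive_part +> \<iota> c"
    using iff[OF c(1)] minus_mem_positive_part_iff[OF x c(1)] c by blast
  fix k assume k: "k \<in> carrier K \<and> positive_part +> x = positive_part +> \<iota> k"
  then have "x \<ominus> \<iota> k \<in> positive_part" using iff[of k] by blast
  then have "\<iota> k = \<iota> c" using minus_mem_positive_part_iff[OF x, of k] k c(2) by simp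
  then show "k = c" using inj_onD[OF incl_inj] k c(1) by blast
qed

lemma augmentation_props:
  assumes "x \<in> carrier S"
  shows "\<epsilon> x \<in> carrier K" "\<iota> (\<epsilon> x) = hc x 0"
proof -
  obtain c where "c \<in> carrier K" "hc x 0 = \<iota> c" using hc_props(1)[OF assms, of 0] incl_image by blast
  then show "\<epsilon> x \<in> carrier K" "\<iota> (\<epsilon> x) = hc x 0" using augmentation_eqI[OF assms] by auto
qed

lemma augmentation_incl: "c \<in> carrier K \<Longrightarrow> \<epsilon> (\<iota> c) = c"
  by (rule augmentation_eqI) (simp_all add: incl_closed hc_incl)

lemma augmentation_hom: "\<epsilon> \<in> ring_hom S K"
proof -
  interpret h: ring_hom_ring K S \<iota>
    by (rule ring_hom_ringI2[OF ring_axioms S.ring_axioms incl_hom])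
  show ?thesis
  proof (rule ring_hom_memI)
    fix x y assume xy: "x \<in> carrier S" "y \<in> carrier S"
    note a = augmentation_props[OF xy(1)] augmentation_props[OF xy(2)]
    show "\<epsilon> (x \<otimes> y) = \<epsilon> x \<otimes>\<^bsub>K\<^esub> \<epsilon> y"
      by (rule augmentation_eqI) (use xy a in \<open>auto simp: hc_mult_0\<close>)
    show "\<epsilon> (x \<oplus> y) = \<epsilon> x \<oplus>\<^bsub>K\<^esub> \<epsilon> y"
      by (rule augmentation_eqI) (use xy a in \<open>auto simp: hc_add\<close>)
  next
    show "\<epsilon> \<one> = \<one>\<^bsub>K\<^esub>" by (rule augmentation_eqI) (auto simp: hc_homogeneous[OF one_gr])
  qed (rule augmentation_props)
qed

lemma augmentation_zero_iff: "x \<in> carrier S \<Longrightarrow> \<epsilon> x = \<zero>\<^bsub>K\<^esub> \<longleftrightarrow> x \<in> positive_part"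
proof -
  interpret h: ring_hom_ring K S \<iota>
    by (rule ring_hom_ringI2[OF ring_axioms S.ring_axioms incl_hom])
  assume x: "x \<in> carrier S"
  then show ?thesis
    using augmentation_props[OF x] augmentation_eqI[OF x zero_closed] by (auto simp: positive_part_def)
qed

text \<open>An element of \<open>J\<close> outside \<open>positive_part\<close> has a nonzero
  constant term. Subtracting the part of positive degree, which also lies in \<open>J\<close>,
  leaves this unit in \<open>J\<close>.\<close>

lemma positive_part_maximal:
  assumes J: "ideal J S" "positive_part \<subseteq> J" "J \<noteq> positive_part"
  shows "J = carrier S"
proof -
  obtain x where x: "x \<in> J" "x \<notin> positive_part" using J by blast
  have xc: "x \<in> carrier S" by (rule ideal_closed(1)[OF J(1) x(1)])
  note a = augmentation_props[OF xc]
  have "x \<ominus> hc x 0 \<in> J" using minus_mem_positive_part_iff[OF xc a(1)] a(2) J(2) by auto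
  then have "x \<ominus> (x \<ominus> hc x 0) \<in> J" using x(1) ideal_closed(3,6)[OF J(1)] by (simp add: S.minus_eq)
  moreover have "x \<ominus> (x \<ominus> hc x 0) = hc x 0"
    using xc by (simp add: S.minus_eq S.minus_add S.a_assoc[symmetric] S.r_neg)
  ultimately have hJ: "hc x 0 \<in> J" by simp
  have h: "hc x 0 \<in> gr 0 - {\<zero>}" using hc_props(1)[OF xc] x(2) xc by (auto simp: positive_part_def)
  have "inv (hc x 0) \<in> carrier S" using S.subfield_m_inv(1)[OF gr0_subfield h] gr_carrier by blast
  then have "inv (hc x 0) \<otimes> hc x 0 \<in> J" by (rule ideal_closed(4)[OF J(1) hJ])
  then have "\<one> \<in> J" using S.subfield_m_inv(3)[OF gr0_subfield h] by simp
  then have "y \<in> J" if "y \<in> carrier S" for y using ideal_closed(5)[OF J(1), of \<one> y] that by simp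
  then show ?thesis using ideal_closed(1)[OF J(1)] by blast
qed

text \<open>If this maximal ideal were zero, there would be no two primes in strict inclusion,
  against positive Krull dimension.\<close>

lemma positive_part_nonzero:
  assumes "krull_dim S > 0"
  shows "\<exists>x\<in>positive_part. x \<noteq> \<zero>"
proof (rule ccontr)
  assume no: "\<not> ?thesis"
  obtain n P where P: "\<forall>i\<le>n. primeideal (P i) S" "\<forall>i<n. P i \<subset> P (Suc i)" "enat n > 0"
    using assms unfolding krull_dim_def less_SUP_iff by blast
  have n: "0 < n" using P(3) by (cases n) (auto simp: zero_enat_def)
  have "primeideal (P 0) S" "primeideal (P (Suc 0)) S" using P(1) n by simp_all
  then have p0: "ideal (P 0) S" and p1: "ideal (P (Suc 0)) S" "P (Suc 0) \<noteq> carrier S"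
    using primeideal.axioms(1) primeideal.I_notcarr[of "P (Suc 0)" S] by auto
  obtain x where x: "x \<in> P (Suc 0)" "x \<notin> P 0" using P(2) n by blast
  have "positive_part \<subseteq> P (Suc 0)" using no ideal_closed(2)[OF p1(1)] by auto
  moreover have "x \<notin> positive_part" using no x(2) ideal_closed(2)[OF p0] by auto
  ultimately show False using positive_part_maximal[OF p1(1)] p1(2) x(1) by blast
qed

text \<open>A nonzero homogeneous \<open>x\<close> of positive degree exists, and
  \<open>x \<otimes> hc a 0\<close> is a component of \<open>x \<otimes> a = \<zero>\<close>. A
  nonzero constant term of \<open>a\<close>, being a unit, would force \<open>x\<close> to vanish.
  So \<open>a\<close> itself lies in \<open>positive_part\<close>, is killed by itself, and is zero
  by reducedness.\<close>

lemma positive_part_depth: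
  assumes red: "reduced_ring S" and dim: "krull_dim S > 0"
    and a: "a \<in> carrier S" "\<And>x. x \<in> positive_part \<Longrightarrow> x \<otimes> a = \<zero>"
  shows "a = \<zero>"
proof -
  have "hc a 0 = \<zero>"
  proof (rule ccontr)
    assume "hc a 0 \<noteq> \<zero>"
    then have h: "hc a 0 \<in> gr 0 - {\<zero>}" using hc_props(1)[OF a(1)] by auto
    obtain y where y: "y \<in> positive_part" "y \<noteq> \<zero>" using positive_part_nonzero[OF dim] by blast
    have yc: "y \<in> carrier S" "hc y 0 = \<zero>" using y(1) by (auto simp: positive_part_def)
    obtain i where i: "hc y i \<noteq> \<zero>"
      using y(2) hc_eq_iff[OF yc(1) S.zero_closed] by auto
    then have "i > 0" using yc(2) by (cases i) auto
    define x where "x = hc y i"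
    have x: "x \<in> gr i" using hc_props(1)[OF yc(1)] by (simp add: x_def)
    have xc: "x \<in> carrier S" by (rule gr_carrier[OF x])
    have "x \<otimes> a = \<zero>" by (rule a(2)[OF hc_positive_degree[OF x \<open>i > 0\<close>]])
    then have "x \<otimes> hc a 0 = \<zero>" using hc_mult_homogeneous[OF x a(1), of i] by simp
    moreover have ic: "inv (hc a 0) \<in> carrier S"
      using S.subfield_m_inv(1)[OF gr0_subfield h] gr_carrier by blast
    ultimately have "x \<otimes> hc a 0 \<otimes> inv (hc a 0) = \<zero>" by simp
    then have "x = \<zero>"
      using S.subfield_m_inv(2)[OF gr0_subfield h] ic xc a(1) by (simp add: S.m_assoc)
    then show False using i by (simp add: x_def)
  qed
  then have "a \<otimes> a = \<zero>" using a by (simp add: positive_part_def)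
  then have "a [^] (2::nat) = \<zero>" using a(1) by (simp add: numeral_2_eq_2)
  then show ?thesis by (rule S.reduced_pow_zero[OF red a(1)])
qed

lemma chain_bound_krull_dim:
  assumes "krull_dim S = enat r"
  shows "chain_bound {\<zero>} r"
  unfolding chain_bound_def
proof (intro allI impI, elim conjE)
  fix n P assume "\<forall>i\<le>n. primeideal (P i) S" "\<forall>i<n. P i \<subset> P (Suc i)"
  then have "enat n \<le> krull_dim S" unfolding krull_dim_def by (intro SUP_upper) blast
  then show "n \<le> r" using assms by simp
qed

end

section \<open>The fiber product and its two retractions\<close>

locale fiber_setup =
  A: graded_algebra K A \<iota>A grA + B: graded_algebra K B \<iota>B grB
  for K :: "('k, 'm) ring_scheme"
    and A :: "('a, 'n) ring_scheme" and \<iota>A :: "'k \<Rightarrow> 'a" and grA :: "nat \<Rightarrow> 'a set"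
    and B :: "('b, 'p) ring_scheme" and \<iota>B :: "'k \<Rightarrow> 'b" and grB :: "nat \<Rightarrow> 'b set"
begin

abbreviation "R \<equiv> fiber_product K A \<iota>A grA B \<iota>B grB"
abbreviation "\<iota>R \<equiv> fiber_incl \<iota>A \<iota>B"
abbreviation "grR \<equiv> fiber_grading K A \<iota>A grA B \<iota>B grB"

lemma R_simps:
  "carrier R = {(a, b). a \<in> carrier A \<and> b \<in> carrier B \<and> A.\<epsilon> a = B.\<epsilon> b}"
  "x \<otimes>\<^bsub>R\<^esub> y = (fst x \<otimes>\<^bsub>A\<^esub> fst y, snd x \<otimes>\<^bsub>B\<^esub> snd y)"
  "x \<oplus>\<^bsub>R\<^esub> y = (fst x \<oplus>\<^bsub>A\<^esub> fst y, snd x \<oplus>\<^bsub>B\<^esub> snd y)"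
  "\<one>\<^bsub>R\<^esub> = (\<one>\<^bsub>A\<^esub>, \<one>\<^bsub>B\<^esub>)" "\<zero>\<^bsub>R\<^esub> = (\<zero>\<^bsub>A\<^esub>, \<zero>\<^bsub>B\<^esub>)"
  by (simp_all add: fiber_product_def RDirProd_def DirProd_def monoid.defs case_prod_beta)

interpretation eA: ring_hom_ring A K A.\<epsilon>
  by (rule ring_hom_ringI2[OF A.S.ring_axioms A.ring_axioms A.augmentation_hom])

interpretation eB: ring_hom_ring B K B.\<epsilon>
  by (rule ring_hom_ringI2[OF B.S.ring_axioms A.ring_axioms B.augmentation_hom])

lemma R_cring: "cring R"
proof (rule cringI)
  show "abelian_group R"
  proof (rule abelian_groupI)
    fix x assume x: "x \<in> carrier R"
    show "\<exists>y\<in>carrier R. y \<oplus>\<^bsub>R\<^esub> x = \<zero>\<^bsub>R\<^esub>"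
      by (rule bexI[of _ "(\<ominus>\<^bsub>A\<^esub> fst x, \<ominus>\<^bsub>B\<^esub> snd x)"]) (use x in \<open>auto simp: R_simps A.S.l_neg B.S.l_neg\<close>)
  qed (auto simp: R_simps A.S.a_ac B.S.a_ac)
  show "comm_monoid R"
    by (rule comm_monoidI) (auto simp: R_simps A.S.m_ac B.S.m_ac)
qed (auto simp: R_simps A.S.l_distr B.S.l_distr)

sublocale R: cring R by (rule R_cring)

definition "\<sigma>A a = (a, \<iota>B (A.\<epsilon> a))"
definition "\<sigma>B b = (\<iota>A (B.\<epsilon> b), b)"

interpretation iA: ring_hom_ring K A \<iota>A
  by (rule ring_hom_ringI2[OF A.ring_axioms A.S.ring_axioms A.incl_hom])

interpretation iB: ring_hom_ring K B \<iota>B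
  by (rule ring_hom_ringI2[OF A.ring_axioms B.S.ring_axioms B.incl_hom])

sublocale ret_A: ring_retract A R K \<iota>A \<iota>R fst \<sigma>A A.positive_part
proof (intro ring_retract.intro ring_retract_axioms.intro)
  show "fst \<in> ring_hom R A" by (rule ring_hom_memI) (auto simp: R_simps)
  show "\<sigma>A \<in> ring_hom A R"
    by (rule ring_hom_memI) (auto simp: \<sigma>A_def R_simps B.augmentation_incl)
  \<comment> \<open>The augmentation of \<open>x\<close> is zero, so \<open>\<sigma>A x\<close> is
    \<open>(x, 0)\<close> and the second component of \<open>r\<close> is multiplied by
    zero.\<close>
  show "\<sigma>A x \<otimes>\<^bsub>R\<^esub> r = \<sigma>A (x \<otimes>\<^bsub>A\<^esub> fst r)" if "x \<in> A.positive_part" "r \<in> carrier R" for x r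
  proof -
    have x: "x \<in> carrier A" using that(1) by (simp add: A.positive_part_def)
    then have "A.\<epsilon> x = \<zero>\<^bsub>K\<^esub>" using A.augmentation_zero_iff that(1) by blast
    then show ?thesis using x that(2) by (auto simp: \<sigma>A_def R_simps)
  qed
qed (auto simp: \<sigma>A_def fiber_incl_def A.incl_closed A.augmentation_incl A.positive_part_ideal A.S.is_cring R_cring)

sublocale ret_B: ring_retract B R K \<iota>B \<iota>R snd \<sigma>B B.positive_part
proof (intro ring_retract.intro ring_retract_axioms.intro)
  show "snd \<in> ring_hom R B" by (rule ring_hom_memI) (auto simp: R_simps)
  show "\<sigma>B \<in> ring_hom B R"
    by (rule ring_hom_memI) (auto simp: \<sigma>B_def R_simps A.augmentation_incl)
  show "\<sigma>B x \<otimes>\<^bsub>R\<^esub> r = \<sigma>B (x \<otimes>\<^bsub>B\<^esub> snd r)" if "x \<in> B.positive_part" "r \<in> carrier R" for x r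
  proof -
    have x: "x \<in> carrier B" using that(1) by (simp add: B.positive_part_def)
    then have "B.\<epsilon> x = \<zero>\<^bsub>K\<^esub>" using B.augmentation_zero_iff that(1) by blast
    then show ?thesis using x that(2) by (auto simp: \<sigma>B_def R_simps)
  qed
qed (auto simp: \<sigma>B_def fiber_incl_def B.incl_closed B.augmentation_incl B.positive_part_ideal B.S.is_cring R_cring)

text \<open>The kernels of the two projections have product zero, so the smallest prime of a chain
  contains one of them. The chain then restricts to the corresponding factor without losing
  length.\<close>

lemma krull_dim_R: "krull_dim R = max (krull_dim A) (krull_dim B)"
proof (rule antisym)
  show "krull_dim R \<le> max (krull_dim A) (krull_dim B)"
    unfolding krull_dim_def[of R]
  proof (rule SUP_least)
    fix n assume "n \<in> {n. \<exists>P. (\<forall>i\<le>n. primeideal (P i) R) \<and> (\<forall>i<n. P i \<subset> P (Suc i))}"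
    then obtain P where P: "\<forall>i\<le>n. primeideal (P i) R" "\<forall>i<n. P i \<subset> P (Suc i)" by blast
    have "enat n \<le> krull_dim A \<or> enat n \<le> krull_dim B"
    proof (cases "\<forall>r\<in>carrier R. fst r = \<zero>\<^bsub>A\<^esub> \<longrightarrow> r \<in> P 0")
      case True
      then show ?thesis
        using ret_A.prime_chain_restrict[OF P] unfolding krull_dim_def[of A] by (auto intro!: SUP_upper)
    next
      case False
      then obtain r where r: "r \<in> carrier R" "fst r = \<zero>\<^bsub>A\<^esub>" "r \<notin> P 0" by blast
      interpret P0: primeideal "P 0" R using P(1) by simp
      have "s \<in> P 0" if s: "s \<in> carrier R" "snd s = \<zero>\<^bsub>B\<^esub>" for s
      proof -
        have "r \<otimes>\<^bsub>R\<^esub> s = \<zero>\<^bsub>R\<^esub>" using r s by (auto simp: R_simps)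
        then show ?thesis using P0.I_prime[OF r(1) s(1)] r(3) by simp
      qed
      then show ?thesis
        using ret_B.prime_chain_restrict[OF P] unfolding krull_dim_def[of B] by (auto intro!: SUP_upper)
    qed
    then show "enat n \<le> max (krull_dim A) (krull_dim B)" by (simp add: le_max_iff_disj)
  qed
  show "max (krull_dim A) (krull_dim B) \<le> krull_dim R"
    using ret_A.krull_dim_le ret_B.krull_dim_le by simp
qed

lemma sigma_decomp:
  assumes "a \<in> A.positive_part" "b \<in> B.positive_part"
  shows "\<sigma>A a \<oplus>\<^bsub>R\<^esub> \<sigma>B b = (a, b)"
  using assms A.augmentation_zero_iff[of a] B.augmentation_zero_iff[of b]
  by (simp add: \<sigma>A_def \<sigma>B_def R_simps A.positive_part_def B.positive_part_def)

text \<open>In positive degree an element \<open>(a, b)\<close> of the grading is the sum of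
  \<open>\<sigma>A a\<close> and \<open>\<sigma>B b\<close>. Hence the irrelevant ideal of
  \<open>R\<close> is tested separately on the two embedded irrelevant ideals, which is the form
  that the retractions treat.\<close>

lemma irrelevant_ideal_R_subset_iff:
  assumes T: "ideal T R"
  shows "irrelevant_ideal R grR \<subseteq> T \<longleftrightarrow> \<sigma>A ` A.positive_part \<subseteq> T \<and> \<sigma>B ` B.positive_part \<subseteq> T"
proof (intro iffI conjI)
  assume irr: "irrelevant_ideal R grR \<subseteq> T"
  have "\<sigma>A x \<in> grR i" if "i > 0" "x \<in> grA i" for i x
  proof -
    have x: "x \<in> carrier A" "x \<in> A.positive_part" using A.gr_carrier A.hc_positive_degree that by auto
    then have "\<sigma>A x = (x, \<zero>\<^bsub>B\<^esub>)" using A.augmentation_zero_iff[OF x(1)] by (simp add: \<sigma>A_def)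
    then show ?thesis using ret_A.sigma_simps(1)[OF x(1)] that(2) by (simp add: fiber_grading_def)
  qed
  then show "\<sigma>A ` A.positive_part \<subseteq> T"
    using A.image_positive_part_subset[OF R.ring_axioms ret_A.sigma_hom, of grR] irr by blast
  have "\<sigma>B x \<in> grR i" if "i > 0" "x \<in> grB i" for i x
  proof -
    have x: "x \<in> carrier B" "x \<in> B.positive_part" using B.gr_carrier B.hc_positive_degree that by auto
    then have "\<sigma>B x = (\<zero>\<^bsub>A\<^esub>, x)" using B.augmentation_zero_iff[OF x(1)] by (simp add: \<sigma>B_def)
    then show ?thesis using ret_B.sigma_simps(1)[OF x(1)] that(2) by (simp add: fiber_grading_def)
  qed
  then show "\<sigma>B ` B.positive_part \<subseteq> T"
    using B.image_positive_part_subset[OF R.ring_axioms ret_B.sigma_hom, of grR] irr by blast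
next
  interpret T: ideal T R by fact
  assume sub: "\<sigma>A ` A.positive_part \<subseteq> T \<and> \<sigma>B ` B.positive_part \<subseteq> T"
  show "irrelevant_ideal R grR \<subseteq> T"
  proof
    fix x assume "x \<in> irrelevant_ideal R grR"
    then obtain c n where x: "x = finsum R c {1..n::nat}" and c: "\<forall>i\<in>{1..n}. c i \<in> grR i"
      unfolding irrelevant_ideal_def by blast
    have cT: "c i \<in> T" if i: "i \<in> {1..n}" for i
    proof -
      have "c i \<in> grR i" using c i by blast
      then obtain a b where ab: "c i = (a, b)" "a \<in> grA i" "b \<in> grB i"
        by (cases "c i") (auto simp: fiber_grading_def)
      have m: "a \<in> A.positive_part" "b \<in> B.positive_part"
        using ab i A.hc_positive_degree B.hc_positive_degree by auto
      then have "\<sigma>A a \<oplus>\<^bsub>R\<^esub> \<sigma>B b \<in> T" using sub by (intro T.a_closed) auto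
      then show ?thesis using sigma_decomp[OF m] ab(1) by simp
    qed
    then show "x \<in> T" unfolding x by (intro R.ideal_finsum[OF T]) auto
  qed
qed

sublocale over_R: cring_over K R \<iota>R
  by unfold_locales (rule ret_A.incl_R_closed)

lemma nearly_regular_R:
  "nearly_regular K R \<iota>R grR \<longleftrightarrow> (\<exists>d. max (krull_dim A) (krull_dim B) = enat d \<and>
     \<sigma>A ` A.positive_part \<subseteq> derivation_ideal K R \<iota>R d \<and> \<sigma>B ` B.positive_part \<subseteq> derivation_ideal K R \<iota>R d)"
  unfolding nearly_regular_def over_R.trace_ideal_ext_power_kaehler krull_dim_R
    irrelevant_ideal_R_subset_iff[OF R.derivation_ideal_props(1)] ..

end

section \<open>Near regularity in terms of the derivation ideal\<close>

lemma (in graded_algebra) nearly_regular_iff: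
  "nearly_regular K S \<iota> gr \<longleftrightarrow> (\<exists>d. krull_dim S = enat d \<and> positive_part \<subseteq> derivation_ideal K S \<iota> d)"
  unfolding nearly_regular_def over.trace_ideal_ext_power_kaehler irrelevant_ideal_eq ..

text \<open>If the Krull dimension were below \<open>d\<close>, the derivation ideal in degree
  \<open>d\<close> would be zero and could not contain the nonzero ideal
  \<open>positive_part\<close>.\<close>

lemma (in graded_algebra) krull_dim_ge:
  assumes perf: "perfect_field K" and noeth: "noetherian_ring S" and red: "reduced_ring S"
    and dim: "krull_dim S > 0" "krull_dim S \<le> enat d" and T: "positive_part \<subseteq> derivation_ideal K S \<iota> d"
  shows "krull_dim S = enat d"
proof (rule ccontr)
  assume "krull_dim S \<noteq> enat d"
  then obtain r where r: "krull_dim S = enat r" "r < d"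
    using dim(2) by (cases "krull_dim S") auto
  have "derivation_ideal K S \<iota> d = {\<zero>}"
    by (rule derivation_ideal_zero[OF perf noeth red chain_bound_krull_dim[OF r(1)] r(2)])
  then show False using T positive_part_nonzero[OF dim(1)] by auto
qed

theorem corollary5p16:
  fixes K :: "('k, 'm) ring_scheme"
    and A :: "('a, 'n) ring_scheme" and \<iota>A :: "'k \<Rightarrow> 'a" and grA :: "nat \<Rightarrow> 'a set"
    and B :: "('b, 'p) ring_scheme" and \<iota>B :: "'k \<Rightarrow> 'b" and grB :: "nat \<Rightarrow> 'b set"
  assumes "perfect_field K"
    and "connected_graded_ring K A \<iota>A grA" and "noetherian_ring A"
    and "connected_graded_ring K B \<iota>B grB" and "noetherian_ring B"
    and "reduced_ring A" and "equidimensional A"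
    and "reduced_ring B" and "equidimensional B"
    and "krull_dim A > 0" and "krull_dim B > 0"
  shows "nearly_regular K (fiber_product K A \<iota>A grA B \<iota>B grB)
            (fiber_incl \<iota>A \<iota>B) (fiber_grading K A \<iota>A grA B \<iota>B grB) \<longleftrightarrow>
         nearly_regular K A \<iota>A grA \<and> nearly_regular K B \<iota>B grB \<and> krull_dim A = krull_dim B"
proof -
  interpret fiber_setup K A \<iota>A grA B \<iota>B grB
    using assms(2,4) by (intro fiber_setup.intro graded_algebra.intro)
  show ?thesis
    unfolding nearly_regular_R A.nearly_regular_iff B.nearly_regular_iff
  proof
    assume "\<exists>d. max (krull_dim A) (krull_dim B) = enat d \<and>
      \<sigma>A ` A.positive_part \<subseteq> derivation_ideal K R \<iota>R d \<and> \<sigma>B ` B.positive_part \<subseteq> derivation_ideal K R \<iota>R d"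
    then obtain d where d: "max (krull_dim A) (krull_dim B) = enat d"
      and T: "\<sigma>A ` A.positive_part \<subseteq> derivation_ideal K R \<iota>R d" "\<sigma>B ` B.positive_part \<subseteq> derivation_ideal K R \<iota>R d"
      by blast
    have TA: "A.positive_part \<subseteq> derivation_ideal K A \<iota>A d"
      by (rule ret_A.sigma_m_subset_TR_imp[OF A.positive_part_depth[OF assms(6,10)] T(1)])
    have TB: "B.positive_part \<subseteq> derivation_ideal K B \<iota>B d"
      by (rule ret_B.sigma_m_subset_TR_imp[OF B.positive_part_depth[OF assms(8,11)] T(2)])
    \<comment> \<open>The number \<open>d\<close> is the larger of the two dimensions, and both
      irrelevant ideals lie in derivation ideals of this same degree, so neither dimension can be
      smaller than \<open>d\<close>.\<close>
    have "krull_dim A = enat d"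
      by (rule A.krull_dim_ge[OF assms(1,3,6,10) _ TA]) (use d in \<open>metis max.cobounded1\<close>)
    moreover have "krull_dim B = enat d"
      by (rule B.krull_dim_ge[OF assms(1,5,8,11) _ TB]) (use d in \<open>metis max.cobounded2\<close>)
    ultimately show "(\<exists>d. krull_dim A = enat d \<and> A.positive_part \<subseteq> derivation_ideal K A \<iota>A d) \<and>
      (\<exists>d. krull_dim B = enat d \<and> B.positive_part \<subseteq> derivation_ideal K B \<iota>B d) \<and> krull_dim A = krull_dim B"
      using TA TB by auto
  next
    assume "(\<exists>d. krull_dim A = enat d \<and> A.positive_part \<subseteq> derivation_ideal K A \<iota>A d) \<and>
      (\<exists>d. krull_dim B = enat d \<and> B.positive_part \<subseteq> derivation_ideal K B \<iota>B d) \<and> krull_dim A = krull_dim B"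
    then obtain d where d: "krull_dim A = enat d" "krull_dim B = enat d"
      and T: "A.positive_part \<subseteq> derivation_ideal K A \<iota>A d" "B.positive_part \<subseteq> derivation_ideal K B \<iota>B d"
      by auto
    have "\<sigma>A ` A.positive_part \<subseteq> derivation_ideal K R \<iota>R d"
      by (rule ret_A.m_subset_TA_imp[OF A.positive_part_maximal T(1)])
    moreover have "\<sigma>B ` B.positive_part \<subseteq> derivation_ideal K R \<iota>R d"
      by (rule ret_B.m_subset_TA_imp[OF B.positive_part_maximal T(2)])
    ultimately show "\<exists>d. max (krull_dim A) (krull_dim B) = enat d \<and>
      \<sigma>A ` A.positive_part \<subseteq> derivation_ideal K R \<iota>R d \<and> \<sigma>B ` B.positive_part \<subseteq> derivation_ideal K R \<iota>R d"
      using d by auto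
  qed
qed

end
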